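(* Let $B$ be a standard real Brownian motion, $\alpha>-\frac12$, $h:(0,1]\to[0,+\infty)$ a square integrable function with $h\in RV_\alpha$, and $X_t=\int_0^th(t-s)\,dB_s$, $t\in[0,1]$. Let $H_2(t)=\int_0^th^2(s)\,ds$. Assume that in the representation $$h^2(t)=c(t)\,t^{2\alpha}\exp\Bigl(\int_t^{t_0}\frac{\rho(u)}u\,du\Bigr)$$ the function $c$ is differentiable with bounded derivative and $\rho$ is continuous. If $\alpha=0$ assume moreover that, in a right neighborhood of the origin, at least one of the following holds: (a) $\rho>0$; (b) $\rho<0$; (c) $\rho=0$ and $c'\le0$; (d) $\rho=0$ and $c'\ge0$. Then the family $(X^\varepsilon)_\varepsilon$, where $X^\varepsilon_t=X_{\varepsilon t}$ for $t\in[0,1]$, satisfies, as $\varepsilon\to0$, an LDP on $\mathcal C([0,1],\mathbb R)$ at speed $g(\varepsilon)=\frac1{H_2(\varepsilon)}$ and with rate function $$I(f)=\begin{cases}\frac12|f|^2_{\mathcal Y^0}&f\in\mathcal Y^0\\+\infty&\text{otherwise,}\end{cases}$$ where $\mathcal Y^0$, $|\cdot|_{\mathcal Y^0}$ are the RKHS and its norm of the process $$Y^0_t=\sqrt{2\alpha+1}\int_0^t(t-u)^\alpha\,dB_u,\quad t\in[0,1]$$ (which is a Brownian motion if $\alpha=0$).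
   Context: $RV_\beta$ is the class of functions $\lambda$, positive near $0$, regularly varying at $0$ with index $\beta$: $\lim_{\varepsilon\to0+}\lambda(\varepsilon t)/\lambda(\varepsilon)=t^\beta$ for every $t>0$. Such a function has a representation $\lambda(t)=c(t)\,t^\beta\exp\bigl(\int_t^{t_0}\frac{\rho(u)}u\,du\bigr)$, $t\in(0,1]$, with $t_0\in(0,1]$, $c,\rho$ measurable on $(0,1]$, $\lim_{t\to0}c(t)=c>0$ and $\lim_{t\to0}\rho(t)=0$; the hypothesis concerns such a representation of $h^2\in RV_{2\alpha}$ on $(0,1]$. Processes are taken in their continuous versions; $\mathcal C([0,1],\mathbb R)$ carries the supremum norm. A rate function on a topological space $E$ is a lower semicontinuous $I:E\to[0,+\infty]$ with compact level sets. A family of $E$-valued random variables with laws $(\mu_\varepsilon)_\varepsilon$ satisfies a Large Deviations Principle (LDP) as $\varepsilon\to0$ with speed $g$ (where $g(\varepsilon)\to+\infty$ as $\varepsilon\to0$) and rate function $I$ if $\limsup_{\varepsilon\to0}\frac1{g(\varepsilon)}\log\mu_\varepsilon(F)\le-\inf_FI$ for every closed $F\subset E$ and $\liminf_{\varepsilon\to0}\frac1{g(\varepsilon)}\log\mu_\varepsilon(G)\ge-\inf_GI$ for every open $G\subset E$. The RKHS (Cameron–Martin space) of a centered Gaussian random variable $Z$ with values in a separable Banach space $E$: let $\mathcal H_Z$ be the closure in $L^2$ of $\{\langle\alpha,Z\rangle:\alpha\in E'\}$; the RKHS is $\{\mathbb E[\xi Z]:\xi\in\mathcal H_Z\}\subset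 E$ with norm $|\mathbb E[\xi Z]|=\|\xi\|_{L^2}$. *)

theory Defs
  imports "HOL-Probability.Probability"
begin

section \<open>The separable Banach space of continuous functions on the unit interval\<close>

class compact_metric_space = metric_space +
  assumes compact_UNIV: "compact (UNIV :: 'a set)"

text \<open>Over a compact metric space the bounded continuous functions are all the continuous
  functions. Separability of that space is what makes Bochner integrals of
  \<open>'a \<Rightarrow>\<^sub>C real\<close>-valued random variables available.\<close>

lemma bcontfun_separable:
  "\<exists>A :: ('a::compact_metric_space \<Rightarrow>\<^sub>C 'b::{metric_space,second_countable_topology}) set.
     countable A \<and> (\<forall>f e. e > 0 \<longrightarrow> (\<exists>g\<in>A. dist f g < e))"
proof -
  obtain D :: "'b set" where D: "countable D" "\<And>U. open U \<Longrightarrow> U \<noteq> {} \<Longrightarrow> \<exists>d\<in>D. d \<in> U"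
    using countable_dense_setE by blast
  have "\<exists>xs :: 'a list. \<forall>x. \<exists>y\<in>set xs. dist y x < 1 / real (Suc n)" for n
  proof -
    obtain k where k: "finite k" "(UNIV :: 'a set) \<subseteq> (\<Union>x\<in>k. ball x (1 / real (Suc n)))"
      using conjunct2[OF compact_UNIV[unfolded compact_eq_totally_bounded], rule_format, of "1 / real (Suc n)"]
      by auto
    obtain xs where xs: "set xs = k"
      using finite_list[OF k(1)] by blast
    have "\<exists>y\<in>set xs. dist y x < 1 / real (Suc n)" for x
      using subsetD[OF k(2), of x] xs by (auto simp: dist_commute)
    then show ?thesis
      by blast
  qed
  then obtain net :: "nat \<Rightarrow> 'a list" where net: "\<And>n x. \<exists>y\<in>set (net n). dist y x < 1 / real (Suc n)"
    by metis
  define P :: "nat \<Rightarrow> nat \<Rightarrow> 'b list \<Rightarrow> ('a \<Rightarrow>\<^sub>C 'b) \<Rightarrow> bool" where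
    "P n m ds f \<longleftrightarrow> (\<forall>x y. dist x y < 1 / real (Suc n) \<longrightarrow> dist (apply_bcontfun f x) (apply_bcontfun f y) < 1 / real (Suc m)) \<and>
       (\<forall>i<length (net n). dist (apply_bcontfun f (net n ! i)) (ds ! i) < 1 / real (Suc m))" for n m ds f
  define A where "A = (\<lambda>(n, m, ds). SOME f. P n m ds f) ` (UNIV \<times> UNIV \<times> lists D)"
  have "countable A"
    unfolding A_def using D(1) by (intro countable_image countable_SIGMA) auto
  moreover have "\<exists>g\<in>A. dist f g < e" if "e > 0" for f :: "'a \<Rightarrow>\<^sub>C 'b" and e :: real
  proof -
    obtain m where m: "1 / real (Suc m) < e / 5"
      using \<open>e > 0\<close> nat_approx_posE[of "e / 5"] by (auto simp: inverse_eq_divide)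
    have "uniformly_continuous_on UNIV (apply_bcontfun f)"
      by (rule compact_uniformly_continuous) (auto simp: compact_UNIV)
    then obtain d where d: "d > 0" "\<And>x y. dist x y < d \<Longrightarrow> dist (apply_bcontfun f x) (apply_bcontfun f y) < 1 / real (Suc m)"
      unfolding uniformly_continuous_on_def
      by (auto dest!: spec[of _ "1 / real (Suc m)"] simp: dist_commute)
    obtain n where n: "1 / real (Suc n) < d"
      using \<open>d > 0\<close> nat_approx_posE[of d] by (auto simp: inverse_eq_divide)
    have "\<exists>b\<in>D. dist (apply_bcontfun f x) b < 1 / real (Suc m)" for x
      using D(2)[of "ball (apply_bcontfun f x) (1 / real (Suc m))"] by auto
    then obtain q where q: "\<And>x. q x \<in> D" "\<And>x. dist (apply_bcontfun f x) (q x) < 1 / real (Suc m)"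
      by metis
    define ds where "ds = map q (net n)"
    have "P n m ds f"
      unfolding P_def using d(2) n q(2) by (auto simp: ds_def)
    define g where "g = (SOME f. P n m ds f)"
    have g: "P n m ds g"
      unfolding g_def using \<open>P n m ds f\<close> by (rule someI)
    have "g \<in> A"
      unfolding A_def g_def using q(1) by (intro image_eqI[of _ _ "(n, m, ds)"]) (auto simp: ds_def)
    have "dist (apply_bcontfun f x) (apply_bcontfun g x) \<le> 4 / real (Suc m)" for x
    proof -
      obtain i where i: "i < length (net n)" "dist (net n ! i) x < 1 / real (Suc n)"
        using net[of n x] by (auto simp: in_set_conv_nth)
      let ?y = "net n ! i"
      have "dist (apply_bcontfun f ?y) (apply_bcontfun f x) < 1 / real (Suc m)" "dist (apply_bcontfun f ?y) (ds ! i) < 1 / real (Suc m)"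
        using \<open>P n m ds f\<close> i unfolding P_def by blast+
      moreover have "dist (apply_bcontfun g ?y) (apply_bcontfun g x) < 1 / real (Suc m)" "dist (apply_bcontfun g ?y) (ds ! i) < 1 / real (Suc m)"
        using g i unfolding P_def by blast+
      moreover have "dist (apply_bcontfun f x) (apply_bcontfun g x) \<le> dist (apply_bcontfun f ?y) (apply_bcontfun f x) + dist (apply_bcontfun f ?y) (ds ! i)
          + dist (apply_bcontfun g ?y) (ds ! i) + dist (apply_bcontfun g ?y) (apply_bcontfun g x)"
        using dist_triangle[of "apply_bcontfun f x" "apply_bcontfun g x" "apply_bcontfun f ?y"] dist_triangle[of "apply_bcontfun f ?y" "apply_bcontfun g x" "ds ! i"]
          dist_triangle[of "ds ! i" "apply_bcontfun g x" "apply_bcontfun g ?y"]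
        by (simp add: dist_commute)
      ultimately show ?thesis
        by simp
    qed
    then have "dist f g \<le> 4 / real (Suc m)"
      by (rule dist_bound)
    also have "\<dots> < e"
      using m \<open>e > 0\<close> by simp
    finally show ?thesis
      using \<open>g \<in> A\<close> by blast
  qed
  ultimately show ?thesis
    by blast
qed

instance bcontfun :: (compact_metric_space, "{metric_space,second_countable_topology}")
  second_countable_topology
proof
  obtain A :: "('a \<Rightarrow>\<^sub>C 'b) set" where A: "countable A" "\<And>f e. e > 0 \<Longrightarrow> \<exists>g\<in>A. dist f g < e"
    using bcontfun_separable by metis
  let ?B = "(\<lambda>(g, k). ball g (1 / real (Suc k))) ` (A \<times> (UNIV :: nat set))"
  have "topological_basis ?B"
  proof (rule topological_basisI)
    fix U and f :: "'a \<Rightarrow>\<^sub>C 'b"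
    assume "open U" "f \<in> U"
    then obtain e where e: "e > 0" "ball f e \<subseteq> U"
      using open_contains_ball by blast
    obtain k where k: "1 / real (Suc k) < e / 2"
      using e(1) nat_approx_posE[of "e / 2"] by (auto simp: inverse_eq_divide)
    obtain g where g: "g \<in> A" "dist f g < 1 / real (Suc k)"
      using A(2)[of "1 / real (Suc k)" f] by auto
    have "ball g (1 / real (Suc k)) \<subseteq> ball f e"
    proof
      fix z
      assume "z \<in> ball g (1 / real (Suc k))"
      then have "dist g z < 1 / real (Suc k)" by simp
      then have "dist f z < e"
        using g(2) k dist_triangle[of f z g] by linarith
      then show "z \<in> ball f e" by simp
    qed
    then have "f \<in> ball g (1 / real (Suc k))" "ball g (1 / real (Suc k)) \<subseteq> U"
      using g(2) e(2) by (auto simp: dist_commute)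
    then show "\<exists>V\<in>?B. f \<in> V \<and> V \<subseteq> U"
      using g(1) by blast
  qed auto
  moreover have "countable ?B"
    using A(1) by auto
  ultimately show "\<exists>B :: ('a \<Rightarrow>\<^sub>C 'b) set set. countable B \<and> open = generate_topology B"
    using topological_basis_imp_subbasis by blast
qed

instance bcontfun :: (metric_space, banach) banach ..

typedef unit_interval = "{0..1 :: real}"
  morphisms of_unit to_unit
  by auto

instantiation unit_interval :: metric_space
begin

definition dist_unit_interval :: "unit_interval \<Rightarrow> unit_interval \<Rightarrow> real" where
  "dist_unit_interval s t = dist (of_unit s) (of_unit t)"

definition uniformity_unit_interval :: "(unit_interval \<times> unit_interval) filter" where
  "uniformity_unit_interval = (INF e\<in>{0 <..}. principal {(s, t). dist s t < e})"

definition open_unit_interval :: "unit_interval set \<Rightarrow> bool" where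
  "open_unit_interval U = (\<forall>s\<in>U. \<forall>\<^sub>F (s', t) in uniformity. s' = s \<longrightarrow> t \<in> U)"

instance
  by standard (auto simp: dist_unit_interval_def uniformity_unit_interval_def
      open_unit_interval_def of_unit_inject dist_triangle2)

end

instance unit_interval :: compact_metric_space
proof
  have "continuous_on {0..1} to_unit"
    unfolding continuous_on_iff by (force simp: dist_unit_interval_def to_unit_inverse)
  then have "compact (to_unit ` {0..1})"
    by (rule compact_continuous_image) simp
  moreover have "to_unit ` {0..1} = UNIV"
    using type_definition.Abs_image[OF type_definition_unit_interval] .
  ultimately show "compact (UNIV :: unit_interval set)"
    by simp
qed

type_synonym C01 = "unit_interval \<Rightarrow>\<^sub>C real"

text \<open>The \<open>C01\<close>-valued map given by a process with continuous paths on \<open>{0..1}\<close>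
  (a path that is not continuous there is sent to an arbitrary element).\<close>

definition path_of :: "(real \<Rightarrow> 'a \<Rightarrow> real) \<Rightarrow> 'a \<Rightarrow> C01" where
  "path_of X \<omega> = Bcontfun (\<lambda>t. X (of_unit t) \<omega>)"

lemma path_of_apply:
  assumes "continuous_on {0..1} (\<lambda>t. X t \<omega>)"
  shows "apply_bcontfun (path_of X \<omega>) t = X (of_unit t) \<omega>"
proof -
  have cont: "continuous_on UNIV of_unit"
    unfolding continuous_on_iff by (force simp: dist_unit_interval_def)
  have "continuous_on UNIV (\<lambda>t. X (of_unit t) \<omega>)"
    by (rule continuous_on_compose2[OF assms cont]) (metis image_subset_iff of_unit)
  then have "(\<lambda>t. X (of_unit t) \<omega>) \<in> bcontfun"
    by (simp add: bcontfun_def compact_imp_bounded compact_continuous_image compact_UNIV)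
  then show ?thesis
    by (simp add: path_of_def Bcontfun_inverse)
qed


section \<open>Brownian motion, Wiener integrals and Volterra processes\<close>

definition brownian_motion_on :: "real set \<Rightarrow> 'a measure \<Rightarrow> (real \<Rightarrow> 'a \<Rightarrow> real) \<Rightarrow> bool" where
  "brownian_motion_on T M B \<longleftrightarrow> prob_space M
    \<and> (\<forall>t\<in>T. B t \<in> borel_measurable M)
    \<and> (AE \<omega> in M. B 0 \<omega> = 0)
    \<and> (\<forall>s\<in>T. \<forall>t\<in>T. s < t \<longrightarrow>
         distributed M lborel (\<lambda>\<omega>. B t \<omega> - B s \<omega>) (normal_density 0 (sqrt (t - s))))
    \<and> (\<forall>n (\<tau> :: nat \<Rightarrow> real). (\<forall>i\<le>n. \<tau> i \<in> T) \<and> (\<forall>i<n. \<tau> i < \<tau> (Suc i)) \<longrightarrow>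
         prob_space.indep_vars M (\<lambda>_. borel) (\<lambda>i \<omega>. B (\<tau> (Suc i)) \<omega> - B (\<tau> i) \<omega>) {..<n})
    \<and> (AE \<omega> in M. continuous_on T (\<lambda>t. B t \<omega>))"

text \<open>A list of triples \<open>(x, l, r)\<close> encodes the step function that is the sum of the functions
  \<open>x\<close> times the indicator of \<open>{l<..r}\<close>.\<close>

definition step_fun :: "(real \<times> real \<times> real) list \<Rightarrow> real \<Rightarrow> real" where
  "step_fun ps u = (\<Sum>(x, l, r)\<leftarrow>ps. x * indicator {l<..r} u)"

definition step_integral ::
  "(real \<Rightarrow> 'a \<Rightarrow> real) \<Rightarrow> (real \<times> real \<times> real) list \<Rightarrow> 'a \<Rightarrow> real" where
  "step_integral B ps \<omega> = (\<Sum>(x, l, r)\<leftarrow>ps. x * (B r \<omega> - B l \<omega>))"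

text \<open>\<open>Y\<close> is a version of the Wiener integral of \<open>f\<close> over \<open>{0..t}\<close>: the limit in
  \<open>L\<^sup>2\<close> of the integrals of step functions that converge to \<open>f\<close> in \<open>L\<^sup>2\<close>. The nonnegative
  integrals force \<open>f\<close> and \<open>Y\<close> to be square integrable.\<close>

definition has_wiener_integral ::
  "'a measure \<Rightarrow> (real \<Rightarrow> 'a \<Rightarrow> real) \<Rightarrow> real \<Rightarrow> (real \<Rightarrow> real) \<Rightarrow> ('a \<Rightarrow> real) \<Rightarrow> bool" where
  "has_wiener_integral M B t f Y \<longleftrightarrow>
     set_borel_measurable lborel {0..t} f \<and> Y \<in> borel_measurable M \<and>
     (\<exists>ps :: nat \<Rightarrow> (real \<times> real \<times> real) list.
        (\<forall>n. \<forall>(x, l, r)\<in>set (ps n). 0 \<le> l \<and> l \<le> r \<and> r \<le> t) \<and>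
        (\<lambda>n. \<integral>\<^sup>+u\<in>{0..t}. ennreal ((f u - step_fun (ps n) u)\<^sup>2) \<partial>lborel) \<longlonglongrightarrow> 0 \<and>
        (\<lambda>n. \<integral>\<^sup>+\<omega>. ennreal ((Y \<omega> - step_integral B (ps n) \<omega>)\<^sup>2) \<partial>M) \<longlonglongrightarrow> 0)"

text \<open>\<open>X\<close> is a continuous version, on \<open>{0..1}\<close>, of the process of integrals over \<open>{0..t}\<close> of
  \<open>k (t - s)\<close> against \<open>B\<close>. The value of \<open>k\<close> at \<open>0\<close> does not matter.\<close>

definition volterra_process ::
  "'a measure \<Rightarrow> (real \<Rightarrow> 'a \<Rightarrow> real) \<Rightarrow> (real \<Rightarrow> real) \<Rightarrow> (real \<Rightarrow> 'a \<Rightarrow> real) \<Rightarrow> bool" where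
  "volterra_process M B k X \<longleftrightarrow>
     (\<forall>t\<in>{0..1}. has_wiener_integral M B t (\<lambda>s. k (t - s)) (X t)) \<and>
     (\<forall>\<omega>\<in>space M. continuous_on {0..1} (\<lambda>t. X t \<omega>))"


section \<open>Reproducing kernel Hilbert space of a Gaussian random variable\<close>

text \<open>The \<open>L\<^sup>2\<close> closure of the linear space of the random variables \<open>a (Z \<omega>)\<close>, \<open>a\<close> in the
  topological dual, as a set of functions (not of classes modulo null sets).\<close>

definition gaussian_space ::
  "'a measure \<Rightarrow> ('a \<Rightarrow> 'e::real_normed_vector) \<Rightarrow> ('a \<Rightarrow> real) set" where
  "gaussian_space M Z = {\<xi> \<in> borel_measurable M. integrable M (\<lambda>\<omega>. (\<xi> \<omega>)\<^sup>2) \<and>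
     (\<exists>a :: nat \<Rightarrow> ('e \<Rightarrow>\<^sub>L real).
        (\<lambda>n. \<integral>\<^sup>+\<omega>. ennreal ((\<xi> \<omega> - blinfun_apply (a n) (Z \<omega>))\<^sup>2) \<partial>M) \<longlonglongrightarrow> 0)}"

definition rkhs ::
  "'a measure \<Rightarrow> ('a \<Rightarrow> 'e::{banach,second_countable_topology}) \<Rightarrow> 'e set" where
  "rkhs M Z = (\<lambda>\<xi>. \<integral>\<omega>. \<xi> \<omega> *\<^sub>R Z \<omega> \<partial>M) ` gaussian_space M Z"

definition rkhs_norm ::
  "'a measure \<Rightarrow> ('a \<Rightarrow> 'e::{banach,second_countable_topology}) \<Rightarrow> 'e \<Rightarrow> real" where
  "rkhs_norm M Z f = (THE r. \<exists>\<xi>\<in>gaussian_space M Z.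
     f = (\<integral>\<omega>. \<xi> \<omega> *\<^sub>R Z \<omega> \<partial>M) \<and> r = sqrt (\<integral>\<omega>. (\<xi> \<omega>)\<^sup>2 \<partial>M))"


section \<open>Large deviations\<close>

definition rate_function :: "('e::topological_space \<Rightarrow> ereal) \<Rightarrow> bool" where
  "rate_function I \<longleftrightarrow> (\<forall>x. 0 \<le> I x) \<and> (\<forall>a. open {x. a < I x}) \<and>
     (\<forall>a::real. compact {x. I x \<le> ereal a})"

text \<open>Extended logarithm: the library's real \<open>ln\<close> has \<open>ln 0 = 0\<close>.\<close>

definition elog :: "real \<Rightarrow> ereal" where
  "elog p = (if p = 0 then - \<infinity> else ereal (ln p))"

definition large_deviations ::
  "(real \<Rightarrow> 'e::topological_space measure) \<Rightarrow> (real \<Rightarrow> real) \<Rightarrow> ('e \<Rightarrow> ereal) \<Rightarrow> bool" where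
  "large_deviations \<mu> g I \<longleftrightarrow> filterlim g at_top (at_right 0) \<and> rate_function I \<and>
     (\<forall>F. closed F \<longrightarrow>
        Limsup (at_right 0) (\<lambda>\<epsilon>. ereal (1 / g \<epsilon>) * elog (measure (\<mu> \<epsilon>) F)) \<le> - (INF x\<in>F. I x)) \<and>
     (\<forall>G. open G \<longrightarrow>
        Liminf (at_right 0) (\<lambda>\<epsilon>. ereal (1 / g \<epsilon>) * elog (measure (\<mu> \<epsilon>) G)) \<ge> - (INF x\<in>G. I x))"


section \<open>Regular variation\<close>

definition RV :: "real \<Rightarrow> (real \<Rightarrow> real) set" where
  "RV \<beta> = {f. (\<forall>\<^sub>F \<epsilon> in at_right 0. f \<epsilon> > 0) \<and>
     (\<forall>t>0. ((\<lambda>\<epsilon>. f (\<epsilon> * t) / f \<epsilon>) \<longlongrightarrow> t powr \<beta>) (at_right 0))}"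

end

theory Submission
  imports Defs "HOL-Complex_Analysis.Great_Picard" "HOL-Real_Asymp.Real_Asymp"
begin

text \<open>With \<open>H(\<epsilon>) = H\<^sub>2(\<epsilon>)\<close>, the process \<open>X\<^sup>\<epsilon> / \<surd>H(\<epsilon>)\<close> is Gaussian and its covariances converge to those of
  \<open>Y\<^sup>0\<close>: by scaling its kernel is \<open>x \<mapsto> h(\<epsilon>x) \<surd>(\<epsilon> / H(\<epsilon>))\<close>, which converges to \<open>\<surd>(2\<alpha>+1) x\<^sup>\<alpha>\<close> and is
  dominated through Potter bounds read off from the representation of \<open>h\<^sup>2\<close>. The representation also gives
  \<open>\<bar>h(y) - h(x)\<bar> \<le> C h(x) (y - x) / x\<close> for \<open>x \<le> y \<le> 2x\<close> near \<open>0\<close>, hence increments with variance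
  at most \<open>C H(\<epsilon>) \<bar>t - s\<bar>\<^sup>\<gamma>\<close>, uniformly in \<open>\<epsilon>\<close>.

  The large deviation principle follows from these two facts. For discrete functionals \<open>a\<close> (linear combinations of
  evaluations) let \<open>J(f) = sup\<^sub>a (a(f) - E[a(Y)\<^sup>2] / 2)\<close>. A union bound over dyadic increments gives
  exponential tightness, and the exponential Chebyshev inequality on finitely many half spaces that cover the
  rest of a closed set gives the upper bound with rate \<open>J\<close>. For the lower bound at
  \<open>f = E[a(Y) Y]\<close> the law is tilted by \<open>exp(a(X\<^sup>\<epsilon>) / H - E[a(X\<^sup>\<epsilon>)\<^sup>2] / (2H\<^sup>2))\<close>: under the tilted law the moment
  generating functions of all discrete functionals are still explicit, so the same tail bound shows that
  \<open>X\<^sup>\<epsilon>\<close> concentrates at \<open>f\<close>. Finally \<open>J\<close> is half the squared norm of the reproducing kernel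
  Hilbert space.\<close>

section \<open>Continuous functions with prescribed dyadic increments\<close>

text \<open>The obstacle is that covariances, which are data about finitely many times, have to
  control a supremum norm. The argument therefore works with \<open>eval_span\<close>, the linear
  combinations of point evaluations, and with moment generating functions, which stay explicit there
  before and after tilting. Gaussian measures on the function space and its dual are never
  described; Bernstein operators reach the remaining functionals at the end.

  One ratio \<open>r\<close> governs all dyadic levels. Increments of level \<open>n\<close> have
  variance of order \<open>r ^ (4 * n)\<close>, hence standard deviation of order
  \<open>r ^ (2 * n)\<close>, while the compact sets ask only for \<open>r ^ n\<close>. The spare
  factor \<open>r ^ n\<close> makes Gaussian tails summable against the \<open>2 ^ n\<close>
  increments of a level, and it leaves room for the shift of the mean that a tilt produces. So the
  same compact sets serve the original and the tilted laws.\<close>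

lemma of_unit_bounds [simp]: "0 \<le> of_unit t" "of_unit t \<le> 1"
  using of_unit[of t] by auto

definition evl :: "unit_interval \<Rightarrow> C01 \<Rightarrow>\<^sub>L real" where
  "evl t = Blinfun (\<lambda>f. apply_bcontfun f t)"

lemma evl_apply [simp]: "blinfun_apply (evl t) f = apply_bcontfun f t"
proof -
  have "\<bar>apply_bcontfun f t\<bar> \<le> norm f" for f :: C01
    using norm_bounded[of f t] by simp
  then have "bounded_linear (\<lambda>f :: C01. apply_bcontfun f t)"
    by (intro bounded_linear_intro[where K = 1]) auto
  then show ?thesis
    by (simp add: evl_def bounded_linear_Blinfun_apply)
qed

definition dyadic :: "nat \<Rightarrow> nat \<Rightarrow> unit_interval" where
  "dyadic n k = to_unit (real k / 2 ^ n)"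

lemma of_unit_dyadic: "k \<le> 2 ^ n \<Longrightarrow> of_unit (dyadic n k) = real k / 2 ^ n"
proof -
  assume "k \<le> 2 ^ n"
  then have "real k \<le> 2 ^ n"
    by (metis of_nat_le_iff of_nat_numeral of_nat_power)
  then show ?thesis
    unfolding dyadic_def by (intro to_unit_inverse) auto
qed

text \<open>Only neighbouring dyadic points are compared, so membership is a countable family of
  conditions on single functionals of \<open>eval_span\<close>, as a union bound requires. Chaining
  recovers a Hoelder modulus whose exponent is the base 2 logarithm of \<open>1 / r\<close>.\<close>

definition hoelder_set :: "real \<Rightarrow> real \<Rightarrow> C01 set" where
  "hoelder_set r R = {f. apply_bcontfun f (to_unit 0) = 0 \<and>
     (\<forall>n. \<forall>k<2 ^ n. \<bar>apply_bcontfun f (dyadic n (Suc k)) - apply_bcontfun f (dyadic n k)\<bar> \<le> R * r ^ n)}"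

lemma closed_hoelder_set: "closed (hoelder_set r R)"
proof -
  have "hoelder_set r R = {f. evl (to_unit 0) f = 0} \<inter>
     (\<Inter>n. \<Inter>k\<in>{..<2 ^ n}. {f. \<bar>evl (dyadic n (Suc k)) f - evl (dyadic n k) f\<bar> \<le> R * r ^ n})"
    by (auto simp: hoelder_set_def)
  also have "closed \<dots>"
    by (intro closed_Int closed_INT ballI closed_Collect_eq closed_Collect_le continuous_intros)
  finally show ?thesis .
qed

definition dyadic_below :: "nat \<Rightarrow> unit_interval \<Rightarrow> nat" where
  "dyadic_below n t = nat \<lfloor>2 ^ n * of_unit t\<rfloor>"

lemma dyadic_below_bounds:
  "real (dyadic_below n t) \<le> 2 ^ n * of_unit t" "2 ^ n * of_unit t < real (dyadic_below n t) + 1"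
  by (simp_all add: dyadic_below_def)

lemma dyadic_below_le: "dyadic_below n t \<le> 2 ^ n"
proof -
  have "real (dyadic_below n t) \<le> 2 ^ n * of_unit t"
    by (rule dyadic_below_bounds)
  also have "\<dots> \<le> 2 ^ n * 1"
    by (intro mult_left_mono) auto
  finally show ?thesis
    by (metis mult_1_right of_nat_le_iff of_nat_numeral of_nat_power)
qed

text \<open>Passing to the next level halves the cell that contains \<open>t\<close>. Hence a chain
  of grid points towards \<open>t\<close> uses at most one increment of each level.\<close>

lemma dyadic_below_Suc:
  "dyadic_below (Suc n) t = 2 * dyadic_below n t \<or> dyadic_below (Suc n) t = 2 * dyadic_below n t + 1"
proof -
  have "real (dyadic_below (Suc n) t) < real (2 * dyadic_below n t + 2)"
    "real (2 * dyadic_below n t) < real (dyadic_below (Suc n) t + 1)"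
    using dyadic_below_bounds[of n t] dyadic_below_bounds[of "Suc n" t] by (auto simp: algebra_simps)
  then show ?thesis
    unfolding of_nat_less_iff by linarith
qed

lemma dyadic_below_tendsto: "(\<lambda>n. dyadic n (dyadic_below n t)) \<longlonglongrightarrow> t"
  unfolding tendsto_iff
proof safe
  fix e :: real assume "e > 0"
  have "\<forall>\<^sub>F n in sequentially. (1 / 2 :: real) ^ n < e"
    using \<open>e > 0\<close> by (intro order_tendstoD[OF LIMSEQ_power_zero]) auto
  then show "\<forall>\<^sub>F n in sequentially. dist (dyadic n (dyadic_below n t)) t < e"
  proof eventually_elim
    case (elim n)
    have "real (dyadic_below n t) / 2 ^ n - of_unit t = (real (dyadic_below n t) - 2 ^ n * of_unit t) / 2 ^ n"
      by (simp add: field_simps)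
    then have "\<bar>real (dyadic_below n t) / 2 ^ n - of_unit t\<bar> = \<bar>real (dyadic_below n t) - 2 ^ n * of_unit t\<bar> / 2 ^ n"
      by (simp add: abs_divide)
    also have "\<dots> \<le> 1 / 2 ^ n"
      using dyadic_below_bounds[of n t] by (intro divide_right_mono) auto
    finally have "dist (dyadic n (dyadic_below n t)) t \<le> (1 / 2) ^ n"
      by (simp add: dist_unit_interval_def of_unit_dyadic dyadic_below_le dist_real_def power_one_over)
    then show ?case using elim by simp
  qed
qed

text \<open>Chaining: the grid points below \<open>t\<close> converge to \<open>t\<close>, each step
  of the chain is zero or one increment, and the increments are dominated by a geometric
  series.\<close>

lemma hoelder_set_chain:
  assumes f: "f \<in> hoelder_set r R" and r: "0 < r" "r < 1" and R: "0 \<le> R"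
  shows "\<bar>apply_bcontfun f t - apply_bcontfun f (dyadic n (dyadic_below n t))\<bar> \<le> R * r ^ n / (1 - r)"
proof -
  define x where "x n = apply_bcontfun f (dyadic n (dyadic_below n t))" for n
  have step: "\<bar>x (Suc n) - x n\<bar> \<le> R * r ^ n" for n
  proof -
    let ?k = "dyadic_below n t"
    have eq: "dyadic (Suc n) (2 * ?k) = dyadic n ?k"
      by (simp add: dyadic_def)
    show ?thesis
    proof (cases "dyadic_below (Suc n) t = 2 * ?k")
      case True
      then show ?thesis using eq R r by (simp add: x_def)
    next
      case False
      then have k: "dyadic_below (Suc n) t = Suc (2 * ?k)"
        using dyadic_below_Suc[of n t] by simp
      moreover have "2 * ?k < 2 ^ Suc n"
        using dyadic_below_le[of "Suc n" t] k by simp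
      ultimately have "\<bar>x (Suc n) - x n\<bar> \<le> R * r ^ Suc n"
        using f unfolding hoelder_set_def x_def eq[symmetric] by (simp del: power_Suc)
      also have "\<dots> \<le> R * r ^ n"
        using r R by (intro mult_left_mono) (auto simp: mult_left_le_one_le)
      finally show ?thesis .
    qed
  qed
  have "\<bar>x (n + j) - x n\<bar> \<le> R * r ^ n * (1 - r ^ j) / (1 - r)" for j
  proof (induction j)
    case (Suc j)
    have "\<bar>x (n + Suc j) - x n\<bar> \<le> R * r ^ n * (1 - r ^ j) / (1 - r) + R * r ^ (n + j)"
      using Suc step[of "n + j"] by simp
    also have "\<dots> = R * r ^ n * (1 - r ^ Suc j) / (1 - r)"
      using r by (simp add: field_simps power_add)
    finally show ?case .
  qed auto
  moreover have "R * r ^ n * (1 - r ^ j) / (1 - r) \<le> R * r ^ n / (1 - r)" for j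
    using r R by (intro divide_right_mono mult_left_le) auto
  ultimately have b: "\<bar>x (n + j) - x n\<bar> \<le> R * r ^ n / (1 - r)" for j
    using order_trans by blast
  have "isCont (apply_bcontfun f) t"
    using apply_bcontfun[of f] by (auto simp: bcontfun_def continuous_on_eq_continuous_at)
  then have "x \<longlonglongrightarrow> apply_bcontfun f t"
    unfolding x_def by (intro isCont_tendsto_compose[OF _ dyadic_below_tendsto])
  then have "(\<lambda>j. x (j + n)) \<longlonglongrightarrow> apply_bcontfun f t"
    by (rule LIMSEQ_ignore_initial_segment)
  then have "(\<lambda>j. \<bar>x (n + j) - x n\<bar>) \<longlonglongrightarrow> \<bar>apply_bcontfun f t - x n\<bar>"
    by (intro tendsto_intros) (simp add: add.commute)
  then show ?thesis
    unfolding x_def[symmetric] using b by (intro LIMSEQ_le_const2) auto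
qed

lemma hoelder_set_norm:
  assumes f: "f \<in> hoelder_set r R" and r: "0 < r" "r < 1" and R: "0 \<le> R"
  shows "norm f \<le> R * (1 + 1 / (1 - r))"
proof (rule norm_bound)
  fix t
  have 0: "apply_bcontfun f (dyadic 0 0) = 0" "\<bar>apply_bcontfun f (dyadic 0 (Suc 0)) - apply_bcontfun f (dyadic 0 0)\<bar> \<le> R"
    using f unfolding hoelder_set_def by (auto simp: dyadic_def dest!: spec[of _ 0])
  have "dyadic_below 0 t = 0 \<or> dyadic_below 0 t = Suc 0"
    using dyadic_below_le[of 0 t] by auto
  then have "\<bar>apply_bcontfun f (dyadic 0 (dyadic_below 0 t))\<bar> \<le> R"
    using 0 R by auto
  then show "norm (apply_bcontfun f t) \<le> R * (1 + 1 / (1 - r))"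
    using hoelder_set_chain[OF assms, of t 0] by (simp add: algebra_simps)
qed

text \<open>Points closer than the mesh lie in equal or adjacent cells, so two chains and at most
  one increment of level \<open>n\<close> join them.\<close>

lemma hoelder_set_modulus:
  assumes f: "f \<in> hoelder_set r R" and r: "0 < r" "r < 1" and R: "0 \<le> R"
    and st: "dist s t < 1 / 2 ^ n"
  shows "\<bar>apply_bcontfun f s - apply_bcontfun f t\<bar> \<le> R * r ^ n * (1 + 2 / (1 - r))"
proof -
  have adj: "\<bar>apply_bcontfun f (dyadic n (dyadic_below n s)) - apply_bcontfun f (dyadic n (dyadic_below n t))\<bar> \<le> R * r ^ n"
  proof -
    have aux: "\<bar>apply_bcontfun f (dyadic n k) - apply_bcontfun f (dyadic n l)\<bar> \<le> R * r ^ n"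
      if "k = l \<or> k = Suc l" "k \<le> 2 ^ n" for k l
      using that f R r unfolding hoelder_set_def by auto
    have "\<bar>2 ^ n * of_unit s - 2 ^ n * of_unit t\<bar> = 2 ^ n * dist s t"
      by (simp add: dist_unit_interval_def dist_real_def abs_mult flip: right_diff_distrib)
    then have "\<bar>2 ^ n * of_unit s - 2 ^ n * of_unit t\<bar> < 1"
      using st by (simp add: field_simps)
    then have "real (dyadic_below n s) < real (dyadic_below n t + 2)" "real (dyadic_below n t) < real (dyadic_below n s + 2)"
      using dyadic_below_bounds[of n t] dyadic_below_bounds[of n s] by linarith+
    then consider "dyadic_below n s = dyadic_below n t \<or> dyadic_below n s = Suc (dyadic_below n t)" |
       "dyadic_below n t = dyadic_below n s \<or> dyadic_below n t = Suc (dyadic_below n s)"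
      unfolding of_nat_less_iff by linarith
    then show ?thesis
      using aux[OF _ dyadic_below_le] abs_minus_commute by metis
  qed
  have "\<bar>apply_bcontfun f s - apply_bcontfun f t\<bar> \<le> R * r ^ n / (1 - r) + R * r ^ n + R * r ^ n / (1 - r)"
    using adj hoelder_set_chain[OF f r R, of s n] hoelder_set_chain[OF f r R, of t n] by linarith
  also have "\<dots> = R * r ^ n * (1 + 2 / (1 - r))"
    by (simp add: algebra_simps)
  finally show ?thesis .
qed

text \<open>The modulus above depends on \<open>r\<close> and \<open>R\<close> alone, so the set is
  equicontinuous as well as bounded. Arzela-Ascoli yields a uniformly convergent subsequence, and
  closedness keeps its limit in the set.\<close>

lemma compact_hoelder_set:
  assumes r: "0 < r" "r < 1" and R: "0 \<le> R"
  shows "compact (hoelder_set r R)"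
  unfolding compact_eq_seq_compact_metric seq_compact_def
proof safe
  fix F :: "nat \<Rightarrow> C01" assume F: "\<forall>n. F n \<in> hoelder_set r R"
  define G where "G n x = apply_bcontfun (F n) (to_unit x)" for n and x :: real
  have "\<exists>d. 0 < d \<and> (\<forall>n y. y \<in> {0..1} \<and> norm (x - y) < d \<longrightarrow> norm (G n x - G n y) < e)"
    if "x \<in> {0..1}" "0 < e" for x e
  proof -
    have "(\<lambda>n. R * r ^ n * (1 + 2 / (1 - r))) \<longlonglongrightarrow> R * 0 * (1 + 2 / (1 - r))"
      using r by (intro tendsto_intros LIMSEQ_power_zero) auto
    then have "\<forall>\<^sub>F n in sequentially. R * r ^ n * (1 + 2 / (1 - r)) < e"
      using \<open>0 < e\<close> by (intro order_tendstoD) auto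
    then obtain n where n: "R * r ^ n * (1 + 2 / (1 - r)) < e"
      by (auto simp: eventually_sequentially)
    have "norm (G m x - G m y) < e" if "y \<in> {0..1}" "norm (x - y) < 1 / 2 ^ n" for m y
    proof -
      have "dist (to_unit x) (to_unit y) < 1 / 2 ^ n"
        using that \<open>x \<in> {0..1}\<close> by (simp add: dist_unit_interval_def to_unit_inverse dist_real_def)
      then have "norm (G m x - G m y) \<le> R * r ^ n * (1 + 2 / (1 - r))"
        unfolding G_def real_norm_def using F by (intro hoelder_set_modulus[OF _ r R]) auto
      then show ?thesis
        using n by simp
    qed
    then show ?thesis
      by (intro exI[of _ "1 / 2 ^ n"]) auto
  qed
  moreover have "norm (G n x) \<le> R * (1 + 1 / (1 - r))" for n x
    unfolding G_def using hoelder_set_norm[OF F[rule_format] r R, of n] norm_bounded[of "F n" "to_unit x"]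
    by linarith
  ultimately obtain g k where g: "continuous_on {0..1} g" and k: "strict_mono (k :: nat \<Rightarrow> nat)"
    and conv: "\<And>e. 0 < e \<Longrightarrow> \<exists>N. \<forall>n x. n \<ge> N \<and> x \<in> {0..1} \<longrightarrow> norm (G (k n) x - g x) < e"
    using Arzela_Ascoli[of "{0..1}" G "R * (1 + 1 / (1 - r))"] by (metis compact_Icc)
  define l where "l = path_of (\<lambda>x _. g x) ()"
  have l: "apply_bcontfun l t = g (of_unit t)" for t
    unfolding l_def using g by (subst path_of_apply) auto
  have "(F \<circ> k) \<longlonglongrightarrow> l"
    unfolding tendsto_iff
  proof safe
    fix e :: real assume "e > 0"
    then obtain N where N: "\<And>n x. n \<ge> N \<Longrightarrow> x \<in> {0..1} \<Longrightarrow> norm (G (k n) x - g x) < e / 2"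
      using conv[of "e / 2"] by auto
    have "dist ((F \<circ> k) n) l < e" if "n \<ge> N" for n
    proof -
      have "dist ((F \<circ> k) n) l \<le> e / 2"
      proof (rule dist_bound)
        fix t
        show "dist (apply_bcontfun ((F \<circ> k) n) t) (apply_bcontfun l t) \<le> e / 2"
          using N[OF that, of "of_unit t"] by (simp add: l G_def dist_real_def of_unit_inverse)
      qed
      then show ?thesis using \<open>e > 0\<close> by simp
    qed
    then show "\<forall>\<^sub>F n in sequentially. dist ((F \<circ> k) n) l < e"
      by (auto simp: eventually_sequentially)
  qed
  moreover have "l \<in> hoelder_set r R"
    using closed_sequentially[OF closed_hoelder_set _ calculation, of r R] F by simp
  ultimately show "\<exists>l\<in>hoelder_set r R. \<exists>r. strict_mono r \<and> (F \<circ> r) \<longlonglongrightarrow> l"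
    using k by blast
qed

text \<open>These functionals stand in for the dual space: by bilinearity their covariances are
  determined by the covariance function of the process, which is the quantity that the kernel
  estimates control.\<close>

definition eval_span :: "(C01 \<Rightarrow>\<^sub>L real) set" where
  "eval_span = span (range evl)"

lemma evl_in_eval_span [simp]: "evl t \<in> eval_span"
  by (simp add: eval_span_def span_base)

lemma eval_span_closed [simp]:
  "0 \<in> eval_span"
  "a \<in> eval_span \<Longrightarrow> b \<in> eval_span \<Longrightarrow> a + b \<in> eval_span"
  "a \<in> eval_span \<Longrightarrow> b \<in> eval_span \<Longrightarrow> a - b \<in> eval_span"
  "a \<in> eval_span \<Longrightarrow> x *\<^sub>R a \<in> eval_span"
  by (auto simp: eval_span_def span_add span_diff span_scale span_zero)

lemma eval_span_induct [consumes 1, case_names zero add]: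
  assumes "a \<in> eval_span" "P 0" "\<And>x t a. a \<in> eval_span \<Longrightarrow> P a \<Longrightarrow> P (x *\<^sub>R evl t + a)"
  shows "P a"
proof -
  have "a \<in> eval_span \<and> P a"
    using assms(1) unfolding eval_span_def
    by (induction rule: span_induct_alt)
      (auto simp: assms(2,3) simp flip: eval_span_def)
  then show ?thesis ..
qed

section \<open>Square integrable functions\<close>

text \<open>The integral of a function that is not integrable is 0 by convention, so square
  integrability has to accompany every formula for a second moment.\<close>

definition sq_int :: "'a measure \<Rightarrow> ('a \<Rightarrow> real) \<Rightarrow> bool" where
  "sq_int M f \<longleftrightarrow> f \<in> borel_measurable M \<and> integrable M (\<lambda>x. (f x)\<^sup>2)"

lemma sq_int_measurable: "sq_int M f \<Longrightarrow> f \<in> borel_measurable M"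
  by (simp add: sq_int_def)

lemma sq_int_square: "sq_int M f \<Longrightarrow> integrable M (\<lambda>x. (f x)\<^sup>2)"
  by (simp add: sq_int_def)

lemma sq_int_mult:
  assumes "sq_int M f" "sq_int M g"
  shows "integrable M (\<lambda>x. f x * g x)"
proof (rule Bochner_Integration.integrable_bound)
  show "integrable M (\<lambda>x. (f x)\<^sup>2 + (g x)\<^sup>2)"
    using assms by (auto simp: sq_int_def)
  show "AE x in M. norm (f x * g x) \<le> norm ((f x)\<^sup>2 + (g x)\<^sup>2)"
  proof (rule AE_I2)
    fix x
    have "2 * (\<bar>f x\<bar> * \<bar>g x\<bar>) \<le> \<bar>f x\<bar>\<^sup>2 + \<bar>g x\<bar>\<^sup>2"
      using sum_squares_bound[of "\<bar>f x\<bar>" "\<bar>g x\<bar>"] by (simp add: mult.assoc)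
    moreover have "0 \<le> \<bar>f x\<bar> * \<bar>g x\<bar>"
      by simp
    ultimately have "\<bar>f x\<bar> * \<bar>g x\<bar> \<le> (f x)\<^sup>2 + (g x)\<^sup>2"
      unfolding power2_abs by linarith
    then show "norm (f x * g x) \<le> norm ((f x)\<^sup>2 + (g x)\<^sup>2)"
      by (simp add: abs_mult)
  qed
qed (use assms in \<open>auto simp: sq_int_def\<close>)

lemma sq_int_scale: "sq_int M f \<Longrightarrow> sq_int M (\<lambda>x. c * f x)"
  by (auto simp: sq_int_def power_mult_distrib)

lemma sq_int_add:
  assumes "sq_int M f" "sq_int M g"
  shows "sq_int M (\<lambda>x. f x + g x)"
  using assms sq_int_mult[OF assms] by (auto simp: sq_int_def power2_sum mult.assoc)

lemma sq_int_diff: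
  assumes "sq_int M f" "sq_int M g"
  shows "sq_int M (\<lambda>x. f x - g x)"
  using assms sq_int_mult[OF assms] by (auto simp: sq_int_def power2_diff mult.assoc)

lemma sq_int_abs: "sq_int M f \<Longrightarrow> sq_int M (\<lambda>x. \<bar>f x\<bar>)"
  by (auto simp: sq_int_def)

lemma (in prob_space) sq_int_integrable:
  assumes "sq_int M f"
  shows "integrable M f"
  using sq_int_mult[OF assms, of "\<lambda>_. 1"] by (simp add: sq_int_def)

lemma integral_square_add:
  assumes "sq_int M f" "sq_int M g"
  shows "(\<integral>x. (f x + g x)\<^sup>2 \<partial>M) = (\<integral>x. (f x)\<^sup>2 \<partial>M) + 2 * (\<integral>x. f x * g x \<partial>M) + (\<integral>x. (g x)\<^sup>2 \<partial>M)"
proof -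
  have "(\<integral>x. (f x + g x)\<^sup>2 \<partial>M) = (\<integral>x. (f x)\<^sup>2 + 2 * (f x * g x) + (g x)\<^sup>2 \<partial>M)"
    by (simp add: power2_sum algebra_simps)
  then show ?thesis
    using assms sq_int_mult[OF assms] by (simp add: sq_int_def)
qed

text \<open>The quadratic \<open>A + 2 * t * B + t\<^sup>2 * C\<close> in \<open>t\<close> is
  nonnegative, being the integral of a square; its discriminant gives the bound.\<close>

lemma Cauchy_Schwarz_integral:
  assumes f: "sq_int M f" and g: "sq_int M g"
  shows "\<bar>\<integral>x. f x * g x \<partial>M\<bar> \<le> sqrt (\<integral>x. (f x)\<^sup>2 \<partial>M) * sqrt (\<integral>x. (g x)\<^sup>2 \<partial>M)"
proof -
  define A B C where "A = (\<integral>x. (f x)\<^sup>2 \<partial>M)" and "B = (\<integral>x. f x * g x \<partial>M)" and "C = (\<integral>x. (g x)\<^sup>2 \<partial>M)"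
  have q: "0 \<le> A + 2 * t * B + t\<^sup>2 * C" for t
  proof -
    have "0 \<le> (\<integral>x. (f x + t * g x)\<^sup>2 \<partial>M)"
      by simp
    also have "\<dots> = A + 2 * t * B + t\<^sup>2 * C"
      using integral_square_add[OF f sq_int_scale[OF g, of t]]
      by (simp add: A_def B_def C_def power_mult_distrib mult.left_commute[of _ t])
    finally show ?thesis .
  qed
  have "B\<^sup>2 \<le> A * C"
  proof (cases "C = 0")
    case True
    have "B = 0"
    proof (rule ccontr)
      assume "B \<noteq> 0"
      \<comment> \<open>With \<open>C = 0\<close> the quadratic is affine, and at this argument it
        takes the value -1.\<close>
      then show False
        using q[of "- (A + 1) / (2 * B)"] True by (simp add: field_simps)
    qed
    then show ?thesis using True by simp
  next
    case False
    moreover have "0 \<le> C"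
      by (simp add: C_def)
    ultimately have "C > 0"
      by simp
    \<comment> \<open>The argument \<open>- B / C\<close> minimizes the quadratic.\<close>
    then have "0 \<le> (A + 2 * (- B / C) * B + (- B / C)\<^sup>2 * C) * C"
      by (intro mult_nonneg_nonneg q) auto
    also have "\<dots> = A * C - B\<^sup>2"
      using \<open>C > 0\<close> by (simp add: field_simps power2_eq_square)
    finally show ?thesis by simp
  qed
  then have "sqrt (B\<^sup>2) \<le> sqrt (A * C)"
    by (rule real_sqrt_le_mono)
  then show ?thesis
    by (simp add: A_def B_def C_def real_sqrt_mult)
qed

lemma Cauchy_Schwarz_integral_abs:
  assumes f: "sq_int M f" and g: "sq_int M g"
  shows "(\<integral>x. \<bar>f x * g x\<bar> \<partial>M) \<le> sqrt (\<integral>x. (f x)\<^sup>2 \<partial>M) * sqrt (\<integral>x. (g x)\<^sup>2 \<partial>M)"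
  using Cauchy_Schwarz_integral[OF f[THEN sq_int_abs] g[THEN sq_int_abs]] by (simp add: abs_mult)

lemma (in prob_space) integral_abs_le_L2:
  assumes f: "sq_int M f"
  shows "(\<integral>x. \<bar>f x\<bar> \<partial>M) \<le> sqrt (\<integral>x. (f x)\<^sup>2 \<partial>M)"
  using Cauchy_Schwarz_integral_abs[OF f, of "\<lambda>_. 1"] by (simp add: sq_int_def prob_space)

section \<open>Mean square limits and completeness\<close>

definition L2_lim :: "'a measure \<Rightarrow> (nat \<Rightarrow> 'a \<Rightarrow> real) \<Rightarrow> ('a \<Rightarrow> real) \<Rightarrow> bool" where
  "L2_lim M u v \<longleftrightarrow> (\<forall>n. sq_int M (u n)) \<and> sq_int M v \<and> (\<lambda>n. \<integral>x. (v x - u n x)\<^sup>2 \<partial>M) \<longlonglongrightarrow> 0"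

lemma L2_lim_const: "sq_int M u \<Longrightarrow> L2_lim M (\<lambda>_. u) u"
  by (simp add: L2_lim_def)

lemma L2_lim_mult:
  assumes u: "L2_lim M u u'" and v: "L2_lim M v v'"
  shows "(\<lambda>n. \<integral>x. u n x * v n x \<partial>M) \<longlonglongrightarrow> (\<integral>x. u' x * v' x \<partial>M)"
proof -
  have s: "sq_int M (u n)" "sq_int M (v n)" "sq_int M u'" "sq_int M v'" for n
    using u v by (auto simp: L2_lim_def)
  note d = sq_int_diff[OF s(3) s(1)] sq_int_diff[OF s(4) s(2)]
  define a b where "a n = sqrt (\<integral>x. (u' x - u n x)\<^sup>2 \<partial>M)" and "b n = sqrt (\<integral>x. (v' x - v n x)\<^sup>2 \<partial>M)" for n
  define A B where "A = sqrt (\<integral>x. (u' x)\<^sup>2 \<partial>M)" and "B = sqrt (\<integral>x. (v' x)\<^sup>2 \<partial>M)"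
  have ab: "a \<longlonglongrightarrow> 0" "b \<longlonglongrightarrow> 0"
    using u v unfolding L2_lim_def a_def b_def by (auto intro: tendsto_eq_intros)
  have bound: "\<bar>(\<integral>x. u n x * v n x \<partial>M) - (\<integral>x. u' x * v' x \<partial>M)\<bar> \<le> a n * b n + a n * B + A * b n" for n
  proof -
    have "(\<integral>x. u n x * v n x \<partial>M) - (\<integral>x. u' x * v' x \<partial>M) = (\<integral>x. u n x * v n x - u' x * v' x \<partial>M)"
      by (intro Bochner_Integration.integral_diff[symmetric] sq_int_mult s)
    also have "\<dots> = (\<integral>x. (u' x - u n x) * (v' x - v n x) - (u' x - u n x) * v' x - u' x * (v' x - v n x) \<partial>M)"
      by (simp add: algebra_simps)
    also have "\<dots> = (\<integral>x. (u' x - u n x) * (v' x - v n x) \<partial>M) - (\<integral>x. (u' x - u n x) * v' x \<partial>M)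
         - (\<integral>x. u' x * (v' x - v n x) \<partial>M)"
      by (simp add: sq_int_mult d s)
    also have "\<bar>\<dots>\<bar> \<le> a n * b n + a n * B + A * b n"
      using Cauchy_Schwarz_integral[OF d(1)[of n] d(2)[of n]] Cauchy_Schwarz_integral[OF d(1)[of n] s(4)]
        Cauchy_Schwarz_integral[OF s(3) d(2)[of n]]
      unfolding a_def b_def A_def B_def by linarith
    finally show ?thesis .
  qed
  have "(\<lambda>n. a n * b n + a n * B + A * b n) \<longlonglongrightarrow> 0 * 0 + 0 * B + A * 0"
    by (intro tendsto_intros ab)
  then have "(\<lambda>n. a n * b n + a n * B + A * b n) \<longlonglongrightarrow> 0"
    by simp
  then have "(\<lambda>n. (\<integral>x. u n x * v n x \<partial>M) - (\<integral>x. u' x * v' x \<partial>M)) \<longlonglongrightarrow> 0"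
    by (rule Lim_null_comparison[OF always_eventually, where g = "\<lambda>n. a n * b n + a n * B + A * b n", rotated]) (use bound in auto)
  then show ?thesis
    using LIM_zero_iff by blast
qed

lemma L2_lim_square:
  assumes u: "L2_lim M u u'"
  shows "(\<lambda>n. \<integral>x. (u n x)\<^sup>2 \<partial>M) \<longlonglongrightarrow> (\<integral>x. (u' x)\<^sup>2 \<partial>M)"
  using L2_lim_mult[OF u u] by (simp add: power2_eq_square)

text \<open>The definitions of Wiener integrals and of \<open>gaussian_space\<close> speak of
  nonnegative integrals, which make sense without integrability. Once the distance to some
  \<open>u n\<close> is finite, \<open>v\<close> is a square integrable perturbation of
  \<open>u n\<close>, and Bochner integrals can take over.\<close>

lemma tendsto_nn_integral_imp_L2_lim:
  assumes u: "\<And>n. sq_int M (u n)" and v: "v \<in> borel_measurable M"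
    and lim: "(\<lambda>n. \<integral>\<^sup>+x. ennreal ((v x - u n x)\<^sup>2) \<partial>M) \<longlonglongrightarrow> 0"
  shows "L2_lim M u v"
proof -
  have [measurable]: "u n \<in> borel_measurable M" "v \<in> borel_measurable M" for n
    using u v by (auto simp: sq_int_def)
  have "\<forall>\<^sub>F n in sequentially. (\<integral>\<^sup>+x. ennreal ((v x - u n x)\<^sup>2) \<partial>M) < 1"
    using lim by (rule order_tendstoD) simp
  then obtain n where n: "(\<integral>\<^sup>+x. ennreal ((v x - u n x)\<^sup>2) \<partial>M) < 1"
    by (auto simp: eventually_sequentially)
  have "sq_int M (\<lambda>x. v x - u n x)"
    unfolding sq_int_def using less_trans[OF n, of \<infinity>] by (auto intro!: integrableI_bounded)
  from sq_int_add[OF this u[of n]] have v': "sq_int M v"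
    by simp
  have "(\<integral>\<^sup>+x. ennreal ((v x - u n x)\<^sup>2) \<partial>M) = ennreal (\<integral>x. (v x - u n x)\<^sup>2 \<partial>M)" for n
    using sq_int_diff[OF v' u] by (intro nn_integral_eq_integral) (auto simp: sq_int_def)
  with lim have "(\<lambda>n. ennreal (\<integral>x. (v x - u n x)\<^sup>2 \<partial>M)) \<longlonglongrightarrow> ennreal 0"
    by simp
  then have "(\<lambda>n. \<integral>x. (v x - u n x)\<^sup>2 \<partial>M) \<longlonglongrightarrow> 0"
    by (subst (asm) tendsto_ennreal_iff) auto
  then show ?thesis
    using u v' by (simp add: L2_lim_def)
qed

lemma L2_lim_imp_tendsto_nn_integral:
  assumes "L2_lim M u v"
  shows "(\<lambda>n. \<integral>\<^sup>+x. ennreal ((v x - u n x)\<^sup>2) \<partial>M) \<longlonglongrightarrow> 0"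
proof -
  have "(\<integral>\<^sup>+x. ennreal ((v x - u n x)\<^sup>2) \<partial>M) = ennreal (\<integral>x. (v x - u n x)\<^sup>2 \<partial>M)" for n
    using sq_int_diff[of M v "u n"] assms
    by (intro nn_integral_eq_integral) (auto simp: sq_int_def L2_lim_def)
  moreover have "(\<lambda>n. ennreal (\<integral>x. (v x - u n x)\<^sup>2 \<partial>M)) \<longlonglongrightarrow> ennreal 0"
    using assms by (intro tendsto_ennrealI) (simp add: L2_lim_def)
  ultimately show ?thesis
    by simp
qed

lemma (in prob_space) L2_lim_AE_subseq:
  assumes "L2_lim M u v"
  shows "\<exists>r. strict_mono r \<and> (AE x in M. (\<lambda>n. u (r n) x) \<longlonglongrightarrow> v x)"
proof -
  have s: "sq_int M (u n)" "sq_int M v" for n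
    using assms by (auto simp: L2_lim_def)
  have "(\<lambda>n. sqrt (\<integral>x. (v x - u n x)\<^sup>2 \<partial>M)) \<longlonglongrightarrow> 0"
    using assms by (auto simp: L2_lim_def intro: tendsto_eq_intros)
  then have "(\<lambda>n. \<integral>x. \<bar>v x - u n x\<bar> \<partial>M) \<longlonglongrightarrow> 0"
    by (rule tendsto_sandwich[OF always_eventually always_eventually tendsto_const, rotated 2])
      (use integral_abs_le_L2[OF sq_int_diff[OF s(2) s(1)]] in simp_all)
  then have "(\<lambda>n. \<integral>x. norm (u n x - v x) \<partial>M) \<longlonglongrightarrow> 0"
    by (simp add: abs_minus_commute)
  from tendsto_L1_AE_subseq[OF _ this] obtain r where r: "strict_mono (r :: nat \<Rightarrow> nat)"
    and ae: "AE x in M. (\<lambda>n. u (r n) x - v x) \<longlonglongrightarrow> 0"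
    using sq_int_integrable[OF s(1)] sq_int_integrable[OF s(2)] by auto
  from ae have "AE x in M. (\<lambda>n. u (r n) x) \<longlonglongrightarrow> v x"
    by eventually_elim (simp add: LIM_zero_iff)
  with r show ?thesis by blast
qed

text \<open>Riesz-Fischer. Along a subsequence with gaps \<open>(1 / 2) ^ j\<close> the increments
  are summable in mean, hence almost everywhere. Fatou's lemma then bounds the distance of every
  late \<open>u n\<close> to the limit, so the whole sequence converges.\<close>

lemma (in prob_space) L2_complete:
  assumes u: "\<And>n. sq_int M (u n)"
    and Cauchy: "\<And>e. e > 0 \<Longrightarrow> \<exists>N. \<forall>m\<ge>N. \<forall>n\<ge>N. (\<integral>x. (u m x - u n x)\<^sup>2 \<partial>M) \<le> e"
  shows "\<exists>v. L2_lim M u v"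
proof -
  have [measurable]: "u n \<in> borel_measurable M" for n
    using u by (auto simp: sq_int_def)
  have "\<exists>N. \<forall>j. (\<forall>m\<ge>N j. \<forall>n\<ge>N j. (\<integral>x. (u m x - u n x)\<^sup>2 \<partial>M) \<le> ((1 / 2) ^ j)\<^sup>2)"
    by (intro choice allI Cauchy) auto
  then obtain N where N: "\<And>j m n. m \<ge> N j \<Longrightarrow> n \<ge> N j \<Longrightarrow> (\<integral>x. (u m x - u n x)\<^sup>2 \<partial>M) \<le> ((1 / 2) ^ j)\<^sup>2"
    by blast
  \<comment> \<open>The sum makes \<open>k\<close> monotone and at least \<open>N j\<close>; the
    summand \<open>j\<close> lets it pass any threshold, as the use of Fatou's lemma below
    requires.\<close>
  define k where "k j = (\<Sum>i\<le>j. N i) + j" for j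
  have kN: "N j \<le> k j" "k j \<le> k (Suc j)" "j \<le> k j" for j
    using member_le_sum[of j "{..j}" N] by (auto simp: k_def)
  define d where "d j x = u (k (Suc j)) x - u (k j) x" for j x
  have d: "sq_int M (d j)" for j
    unfolding d_def by (intro sq_int_diff u)
  have [measurable]: "d j \<in> borel_measurable M" for j
    using d by (auto simp: sq_int_def)
  have "(\<integral>x. \<bar>d j x\<bar> \<partial>M) \<le> (1 / 2) ^ j" for j
  proof -
    have "(\<integral>x. (d j x)\<^sup>2 \<partial>M) \<le> ((1 / 2) ^ j)\<^sup>2"
      unfolding d_def using N[of j "k (Suc j)" "k j"] kN(1)[of j] kN(2)[of j] by simp
    then have "sqrt (\<integral>x. (d j x)\<^sup>2 \<partial>M) \<le> (1 / 2) ^ j"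
      by (intro real_le_lsqrt) auto
    then show ?thesis
      using integral_abs_le_L2[OF d, of j] by linarith
  qed
  then have "(\<integral>\<^sup>+x. ennreal \<bar>d j x\<bar> \<partial>M) \<le> ennreal ((1 / 2) ^ j)" for j
    using sq_int_integrable[OF d, of j]
    by (subst nn_integral_eq_integral) (auto intro!: ennreal_leI)
  then have "(\<Sum>j. \<integral>\<^sup>+x. ennreal \<bar>d j x\<bar> \<partial>M) \<le> (\<Sum>j. ennreal ((1 / 2) ^ j))"
    by (intro suminf_le) auto
  also have "\<dots> = ennreal (\<Sum>j. (1 / 2) ^ j)"
    by (intro suminf_ennreal2) (auto intro!: summable_geometric)
  finally have "(\<integral>\<^sup>+x. (\<Sum>j. ennreal \<bar>d j x\<bar>) \<partial>M) < \<infinity>"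
    by (subst nn_integral_suminf) (auto simp: less_top[symmetric] top_unique)
  then have "AE x in M. (\<Sum>j. ennreal \<bar>d j x\<bar>) \<noteq> \<infinity>"
    by (intro nn_integral_noteq_infinite) auto
  then have conv: "AE x in M. convergent (\<lambda>j. u (k j) x)"
  proof eventually_elim
    case (elim x)
    then have "summable (\<lambda>j. \<bar>d j x\<bar>)"
      by (intro summable_suminf_not_top) auto
    then have "summable (\<lambda>j. d j x)"
      by (rule summable_rabs_cancel)
    then have "convergent (\<lambda>n. \<Sum>j<n. d j x)"
      by (simp add: summable_iff_convergent)
    then have "convergent (\<lambda>n. u (k n) x - u (k 0) x)"
      unfolding d_def using sum_lessThan_telescope[of "\<lambda>j. u (k j) x"] by simp
    then show ?case
      using convergent_diff_const_right_iff[of "\<lambda>n. u (k n) x" "u (k 0) x"] by simp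
  qed
  define v where "v x = lim (\<lambda>j. u (k j) x)" for x
  have v[measurable]: "v \<in> borel_measurable M"
    unfolding v_def by measurable
  have fatou: "(\<integral>\<^sup>+x. ennreal ((v x - u n x)\<^sup>2) \<partial>M) \<le> ennreal e"
    if n: "\<forall>m\<ge>N. (\<integral>x. (u m x - u n x)\<^sup>2 \<partial>M) \<le> e" for n N e
  proof -
    have "(\<integral>\<^sup>+x. ennreal ((v x - u n x)\<^sup>2) \<partial>M) = (\<integral>\<^sup>+x. liminf (\<lambda>j. ennreal ((u (k j) x - u n x)\<^sup>2)) \<partial>M)"
      using conv
    proof (intro nn_integral_cong_AE, eventually_elim)
      case (elim x)
      then have "(\<lambda>j. u (k j) x) \<longlonglongrightarrow> v x"
        unfolding v_def by (simp add: convergent_LIMSEQ_iff)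
      then have "(\<lambda>j. ennreal ((u (k j) x - u n x)\<^sup>2)) \<longlonglongrightarrow> ennreal ((v x - u n x)\<^sup>2)"
        by (intro tendsto_ennrealI tendsto_intros)
      from lim_imp_Liminf[OF _ this] show ?case by simp
    qed
    also have "\<dots> \<le> liminf (\<lambda>j. \<integral>\<^sup>+x. ennreal ((u (k j) x - u n x)\<^sup>2) \<partial>M)"
      by (intro nn_integral_liminf) auto
    also have "\<dots> \<le> limsup (\<lambda>j. \<integral>\<^sup>+x. ennreal ((u (k j) x - u n x)\<^sup>2) \<partial>M)"
      by (intro Liminf_le_Limsup) auto
    also have "\<dots> \<le> ennreal e"
    proof (intro Limsup_bounded eventually_sequentiallyI[of N])
      fix j assume "j \<ge> N"
      then have "(\<integral>x. (u (k j) x - u n x)\<^sup>2 \<partial>M) \<le> e"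
        using n kN(3)[of j] by auto
      then show "(\<integral>\<^sup>+x. ennreal ((u (k j) x - u n x)\<^sup>2) \<partial>M) \<le> ennreal e"
        using sq_int_diff[OF u u, of "k j" n]
        by (subst nn_integral_eq_integral) (auto intro!: ennreal_leI simp: sq_int_def)
    qed
    finally show ?thesis .
  qed
  have "(\<lambda>n. \<integral>\<^sup>+x. ennreal ((v x - u n x)\<^sup>2) \<partial>M) \<longlonglongrightarrow> 0"
  proof (rule order_tendstoI)
    fix e' :: ennreal assume "0 < e'"
    then obtain e where "e > 0" and e': "ennreal e \<le> e'"
      by (cases e') (auto intro: that[of 1])
    obtain N where N: "\<And>m n. m \<ge> N \<Longrightarrow> n \<ge> N \<Longrightarrow> (\<integral>x. (u m x - u n x)\<^sup>2 \<partial>M) \<le> e / 2"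
      using Cauchy[of "e / 2"] \<open>e > 0\<close> by auto
    show "\<forall>\<^sub>F n in sequentially. (\<integral>\<^sup>+x. ennreal ((v x - u n x)\<^sup>2) \<partial>M) < e'"
    proof (rule eventually_sequentiallyI)
      fix n assume "n \<ge> N"
      then have "(\<integral>\<^sup>+x. ennreal ((v x - u n x)\<^sup>2) \<partial>M) \<le> ennreal (e / 2)"
        using N by (intro fatou[of N]) auto
      also have "\<dots> < ennreal e"
        using \<open>e > 0\<close> by (intro ennreal_lessI) auto
      finally show "(\<integral>\<^sup>+x. ennreal ((v x - u n x)\<^sup>2) \<partial>M) < e'"
        using e' by simp
    qed
  qed simp
  then show ?thesis
    using tendsto_nn_integral_imp_L2_lim[OF _ v, of u] u by blast
qed

section \<open>Exponential moments of mean square limits\<close>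

lemma abs_exp_diff_le: "\<bar>exp x - exp y\<bar> \<le> \<bar>x - y\<bar> * (exp x + exp y)" for x y :: real
proof -
  have *: "exp x - exp y \<le> (x - y) * (exp x + exp y)" "0 \<le> exp x - exp y" if "y \<le> x" for x y :: real
  proof -
    have "(1 + (y - x)) * exp x \<le> exp (y - x) * exp x"
      by (intro mult_right_mono exp_ge_add_one_self) auto
    also have "\<dots> = exp y"
      by (simp flip: exp_add)
    finally have "exp x - exp y \<le> (x - y) * exp x"
      by (simp add: algebra_simps)
    also have "\<dots> \<le> (x - y) * (exp x + exp y)"
      using that by (intro mult_left_mono) auto
    finally show "exp x - exp y \<le> (x - y) * (exp x + exp y)" .
  qed (use that in simp)
  show ?thesis
  proof (cases "y \<le> x")
    case True
    then show ?thesis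
      using *[OF True] by simp
  next
    case False
    then have "x \<le> y" by simp
    from *[OF this] show ?thesis
      using False by (simp add: abs_minus_commute[of x y] abs_minus_commute[of "exp x"] add.commute[of "exp x"])
  qed
qed

text \<open>Mean square convergence does not by itself carry over to exponentials. The generating
  function at 2 bounds the second moments of \<open>exp (u n x)\<close>, Fatou's lemma transfers
  this to \<open>exp (w x)\<close>, and Cauchy-Schwarz applied to \<open>abs_exp_diff_le\<close>
  gives convergence of the means.\<close>

lemma (in prob_space) L2_lim_gaussian_mgf:
  assumes lim: "L2_lim M u w"
    and mgf: "\<And>n c. has_bochner_integral M (\<lambda>x. exp (c * u n x)) (exp (c\<^sup>2 * v n / 2))"
    and v: "v \<longlonglongrightarrow> s"
  shows "has_bochner_integral M (\<lambda>x. exp (w x)) (exp (s / 2))"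
proof -
  have [measurable]: "u n \<in> borel_measurable M" "w \<in> borel_measurable M" for n
    using lim by (auto simp: L2_lim_def sq_int_def)
  obtain r where r: "strict_mono r" and ae: "AE x in M. (\<lambda>n. u (r n) x) \<longlonglongrightarrow> w x"
    using L2_lim_AE_subseq[OF lim] by blast
  have two: "has_bochner_integral M (\<lambda>x. (exp (u n x))\<^sup>2) (exp (2 * v n))" for n
  proof -
    have "has_bochner_integral M (\<lambda>x. exp (2 * u n x)) (exp (2 * v n))"
      using mgf[of 2 n] by simp
    then show ?thesis
      by (simp only: exp_double)
  qed
  have vr: "(\<lambda>n. v (r n)) \<longlonglongrightarrow> s"
    using LIMSEQ_subseq_LIMSEQ[OF v r] by (simp add: comp_def)
  have "(\<integral>\<^sup>+x. ennreal ((exp (w x))\<^sup>2) \<partial>M) = (\<integral>\<^sup>+x. liminf (\<lambda>n. ennreal ((exp (u (r n) x))\<^sup>2)) \<partial>M)"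
    using ae
  proof (intro nn_integral_cong_AE, eventually_elim)
    case (elim x)
    then have "(\<lambda>n. ennreal ((exp (u (r n) x))\<^sup>2)) \<longlonglongrightarrow> ennreal ((exp (w x))\<^sup>2)"
      by (intro tendsto_ennrealI tendsto_intros)
    from lim_imp_Liminf[OF _ this] show ?case by simp
  qed
  also have "\<dots> \<le> liminf (\<lambda>n. \<integral>\<^sup>+x. ennreal ((exp (u (r n) x))\<^sup>2) \<partial>M)"
    by (intro nn_integral_liminf) auto
  also have "(\<lambda>n. \<integral>\<^sup>+x. ennreal ((exp (u (r n) x))\<^sup>2) \<partial>M) = (\<lambda>n. ennreal (exp (2 * v (r n))))"
  proof
    fix n
    show "(\<integral>\<^sup>+x. ennreal ((exp (u (r n) x))\<^sup>2) \<partial>M) = ennreal (exp (2 * v (r n)))"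
      using two[of "r n"] unfolding has_bochner_integral_iff by (subst nn_integral_eq_integral) auto
  qed
  also have "liminf (\<lambda>n. ennreal (exp (2 * v (r n)))) = ennreal (exp (2 * s))"
    by (intro lim_imp_Liminf tendsto_ennrealI tendsto_intros vr) auto
  finally have w2: "(\<integral>\<^sup>+x. ennreal ((exp (w x))\<^sup>2) \<partial>M) \<le> ennreal (exp (2 * s))" .
  have sw: "sq_int M (\<lambda>x. exp (w x))"
    unfolding sq_int_def using le_less_trans[OF w2, of \<infinity>] by (auto intro!: integrableI_bounded)
  have su: "sq_int M (\<lambda>x. exp (u n x))" for n
    unfolding sq_int_def using two[of n] by (auto simp: has_bochner_integral_iff)
  have I2: "(\<integral>x. (exp (w x))\<^sup>2 \<partial>M) \<le> exp (2 * s)"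
  proof -
    have "ennreal (\<integral>x. (exp (w x))\<^sup>2 \<partial>M) = (\<integral>\<^sup>+x. ennreal ((exp (w x))\<^sup>2) \<partial>M)"
      using sq_int_square[OF sw] by (intro nn_integral_eq_integral[symmetric]) auto
    then have "ennreal (\<integral>x. (exp (w x))\<^sup>2 \<partial>M) \<le> ennreal (exp (2 * s))"
      using w2 by simp
    then show ?thesis
      by (subst (asm) ennreal_le_iff) auto
  qed
  define d where "d n = sqrt (\<integral>x. (w x - u n x)\<^sup>2 \<partial>M)" for n
  have d: "d \<longlonglongrightarrow> 0"
    using tendsto_real_sqrt[of _ 0 sequentially] lim unfolding L2_lim_def d_def[abs_def] by fastforce
  have diff: "\<bar>(\<integral>x. exp (u n x) \<partial>M) - (\<integral>x. exp (w x) \<partial>M)\<bar> \<le> d n * (exp (v n) + exp s)" for n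
  proof -
    have sd: "sq_int M (\<lambda>x. \<bar>w x - u n x\<bar>)" for n
      using lim by (intro sq_int_abs sq_int_diff) (auto simp: L2_lim_def)
    have "\<bar>(\<integral>x. exp (u n x) \<partial>M) - (\<integral>x. exp (w x) \<partial>M)\<bar> = \<bar>\<integral>x. exp (w x) - exp (u n x) \<partial>M\<bar>"
      using sq_int_integrable[OF su] sq_int_integrable[OF sw] by (simp add: abs_minus_commute)
    also have "\<dots> \<le> (\<integral>x. \<bar>exp (w x) - exp (u n x)\<bar> \<partial>M)"
      using sq_int_integrable[OF su] sq_int_integrable[OF sw] by (intro integral_abs_bound)
    also have "\<dots> \<le> (\<integral>x. \<bar>w x - u n x\<bar> * exp (w x) + \<bar>w x - u n x\<bar> * exp (u n x) \<partial>M)"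
      using abs_exp_diff_le sq_int_integrable[OF su] sq_int_integrable[OF sw]
      by (intro integral_mono Bochner_Integration.integrable_add sq_int_mult sd sw su)
        (auto simp: distrib_left[symmetric])
    also have "\<dots> = (\<integral>x. \<bar>w x - u n x\<bar> * exp (w x) \<partial>M) + (\<integral>x. \<bar>w x - u n x\<bar> * exp (u n x) \<partial>M)"
      by (intro Bochner_Integration.integral_add sq_int_mult sd sw su)
    also have "\<dots> \<le> d n * sqrt (\<integral>x. (exp (w x))\<^sup>2 \<partial>M) + d n * sqrt (\<integral>x. (exp (u n x))\<^sup>2 \<partial>M)"
      using Cauchy_Schwarz_integral[OF sd[of n] sw] Cauchy_Schwarz_integral[OF sd[of n] su[of n]]
      unfolding d_def power2_abs by linarith
    also have "\<dots> \<le> d n * exp s + d n * exp (v n)"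
    proof (intro add_mono mult_left_mono)
      show "sqrt (\<integral>x. (exp (w x))\<^sup>2 \<partial>M) \<le> exp s"
        using I2 unfolding exp_double by (intro real_le_lsqrt) auto
      show "sqrt (\<integral>x. (exp (u n x))\<^sup>2 \<partial>M) \<le> exp (v n)"
        using two[of n] unfolding exp_double has_bochner_integral_iff by (intro real_le_lsqrt) auto
    qed (auto simp: d_def)
    finally show ?thesis
      by (simp add: algebra_simps)
  qed
  have "(\<lambda>n. d n * (exp (v n) + exp s)) \<longlonglongrightarrow> 0 * (exp s + exp s)"
    by (intro tendsto_intros d v)
  then have "(\<lambda>n. d n * (exp (v n) + exp s)) \<longlonglongrightarrow> 0"
    by simp
  then have "(\<lambda>n. (\<integral>x. exp (u n x) \<partial>M) - (\<integral>x. exp (w x) \<partial>M)) \<longlonglongrightarrow> 0"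
    by (rule Lim_null_comparison[OF always_eventually, where g = "\<lambda>n. d n * (exp (v n) + exp s)", rotated]) (use diff in auto)
  then have "(\<lambda>n. \<integral>x. exp (u n x) \<partial>M) \<longlonglongrightarrow> (\<integral>x. exp (w x) \<partial>M)"
    using LIM_zero_iff by blast
  moreover have "(\<lambda>n. \<integral>x. exp (u n x) \<partial>M) \<longlonglongrightarrow> exp (s / 2)"
  proof -
    have "(\<integral>x. exp (u n x) \<partial>M) = exp (v n / 2)" for n
      using mgf[of 1 n] by (simp add: has_bochner_integral_iff)
    then show ?thesis
      by (auto intro!: tendsto_intros v)
  qed
  ultimately have "(\<integral>x. exp (w x) \<partial>M) = exp (s / 2)"
    by (rule LIMSEQ_unique)
  then show ?thesis
    using sq_int_integrable[OF sw] by (simp add: has_bochner_integral_iff)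
qed

section \<open>Wiener integrals\<close>

text \<open>The measure is arbitrary because the isometry needs this twice: for Brownian increments
  on the probability space and for the indicators of the same intervals on the line.\<close>

lemma integral_square_orthogonal_sum:
  fixes D :: "nat \<Rightarrow> 'a \<Rightarrow> real"
  assumes sq: "\<And>i. i < n \<Longrightarrow> sq_int N (D i)"
    and orth: "\<And>i j. i < n \<Longrightarrow> j < n \<Longrightarrow> (\<integral>x. D i x * D j x \<partial>N) = (if i = j then d i else 0)"
  shows "sq_int N (\<lambda>x. \<Sum>i<n. y i * D i x)"
    and "(\<integral>x. (\<Sum>i<n. y i * D i x)\<^sup>2 \<partial>N) = (\<Sum>i<n. (y i)\<^sup>2 * d i)"
proof -
  have "sq_int N (\<lambda>x. \<Sum>i<m. y i * D i x)" if "m \<le> n" for m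
    using that
  proof (induction m)
    case (Suc m)
    then show ?case
      using sq_int_add[OF _ sq_int_scale[OF sq[of m], of "y m"], of "\<lambda>x. \<Sum>i<m. y i * D i x"] by simp
  qed (simp add: sq_int_def)
  then show "sq_int N (\<lambda>x. \<Sum>i<n. y i * D i x)"
    by simp
  have "(\<Sum>i<n. y i * D i x)\<^sup>2 = (\<Sum>i<n. \<Sum>j<n. (y i * y j) * (D i x * D j x))" for x
    by (simp add: power2_eq_square sum_product algebra_simps)
  then have "(\<integral>x. (\<Sum>i<n. y i * D i x)\<^sup>2 \<partial>N) = (\<Sum>i<n. \<Sum>j<n. (y i * y j) * (\<integral>x. D i x * D j x \<partial>N))"
    by (simp only:)
      (subst Bochner_Integration.integral_sum;
        auto intro!: Bochner_Integration.integrable_sum sum.cong simp: Bochner_Integration.integral_sum sq_int_mult sq)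
  also have "\<dots> = (\<Sum>i<n. \<Sum>j<n. if j = i then (y i)\<^sup>2 * d i else 0)"
    by (intro sum.cong refl) (auto simp: orth power2_eq_square)
  also have "\<dots> = (\<Sum>i<n. (y i)\<^sup>2 * d i)"
    by simp
  finally show "(\<integral>x. (\<Sum>i<n. y i * D i x)\<^sup>2 \<partial>N) = (\<Sum>i<n. (y i)\<^sup>2 * d i)" .
qed

text \<open>Stated for all \<open>F\<close> at once, so that it applies to the increments of a Brownian path
  and to those of \<open>x \<mapsto> of_bool (u \<le> x)\<close>, that is, to indicator functions.\<close>

lemma interval_sum_refinement:
  fixes ps :: "(real \<times> real \<times> real) list"
  assumes ps: "\<forall>(x, l, r)\<in>set ps. 0 \<le> l \<and> l \<le> r"
  obtains n :: nat and \<tau> y :: "nat \<Rightarrow> real"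
  where "\<forall>i\<le>n. 0 \<le> \<tau> i" "\<forall>i<n. \<tau> i < \<tau> (Suc i)"
    "\<And>F :: real \<Rightarrow> real. (\<Sum>(x, l, r)\<leftarrow>ps. x * (F r - F l)) = (\<Sum>i<n. y i * (F (\<tau> (Suc i)) - F (\<tau> i)))"
proof -
  \<comment> \<open>The point 0 keeps the grid nonempty when \<open>ps\<close> is empty, so that
    \<open>n\<close> counts its cells.\<close>
  define P where "P = insert 0 (\<Union>(x, l, r)\<in>set ps. {l, r})"
  have "finite P"
    by (auto simp: P_def)
  define xs where "xs = sorted_list_of_set P"
  have xs: "set xs = P" "sorted_wrt (<) xs"
    using \<open>finite P\<close> by (auto simp: xs_def)
  have "P \<noteq> {}"
    by (auto simp: P_def)
  then have len: "0 < length xs"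
    using xs by auto
  define n where "n = length xs - 1"
  define \<tau> where "\<tau> i = xs ! i" for i
  have \<tau>_less: "\<tau> i < \<tau> j" if "i < j" "j \<le> n" for i j
  proof -
    have "j < length xs"
      using that(2) len unfolding n_def by linarith
    then show ?thesis
      unfolding \<tau>_def by (rule sorted_wrt_nth_less[OF xs(2) that(1)])
  qed
  have idx: "\<exists>i\<le>n. \<tau> i = p" if p: "p \<in> P" for p
  proof -
    obtain i where "i < length xs" "xs ! i = p"
      using p unfolding xs(1)[symmetric] in_set_conv_nth by blast
    then show ?thesis
      unfolding \<tau>_def n_def by (intro exI[of _ i]) auto
  qed
  have "\<exists>y. \<forall>F :: real \<Rightarrow> real. (\<Sum>(x, l, r)\<leftarrow>qs. x * (F r - F l)) = (\<Sum>i<n. y i * (F (\<tau> (Suc i)) - F (\<tau> i)))"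
    if "set qs \<subseteq> set ps" for qs
    using that
  proof (induction qs)
    case Nil
    show ?case by (rule exI[of _ "\<lambda>_. 0"]) simp
  next
    case (Cons q qs)
    obtain x l r where q: "q = (x, l, r)"
      by (cases q) auto
    obtain y where y: "\<And>F :: real \<Rightarrow> real. (\<Sum>(x, l, r)\<leftarrow>qs. x * (F r - F l)) = (\<Sum>i<n. y i * (F (\<tau> (Suc i)) - F (\<tau> i)))"
      using Cons by auto
    have "l \<in> P" "r \<in> P" "l \<le> r"
      using Cons.prems q ps by (force simp: P_def)+
    then obtain i j where ij: "i \<le> n" "\<tau> i = l" "j \<le> n" "\<tau> j = r"
      using idx by metis
    have "i \<le> j"
      using \<tau>_less[of j i] ij \<open>l \<le> r\<close> by (cases "i \<le> j") auto
    \<comment> \<open>The interval from \<open>l\<close> to \<open>r\<close> is a run of consecutive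
      cells, so a constant coefficient on the run telescopes.\<close>
    define z where "z m = (if i \<le> m \<and> m < j then x else 0)" for m
    have "x * (F r - F l) = (\<Sum>m<n. z m * (F (\<tau> (Suc m)) - F (\<tau> m)))" for F :: "real \<Rightarrow> real"
    proof -
      have "(\<Sum>m<n. z m * (F (\<tau> (Suc m)) - F (\<tau> m))) = (\<Sum>m\<in>{i..<j}. x * (F (\<tau> (Suc m)) - F (\<tau> m)))"
        using ij by (intro sum.mono_neutral_cong_right) (auto simp: z_def)
      also have "\<dots> = x * (F r - F l)"
        using sum_Suc_diff'[OF \<open>i \<le> j\<close>, of "\<lambda>m. F (\<tau> m)"] ij by (simp flip: sum_distrib_left)
      finally show ?thesis by simp
    qed
    then show ?case
      using y by (intro exI[of _ "\<lambda>m. z m + y m"]) (simp add: q distrib_right sum.distrib)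
  qed
  then obtain y where y: "\<And>F :: real \<Rightarrow> real. (\<Sum>(x, l, r)\<leftarrow>ps. x * (F r - F l)) = (\<Sum>i<n. y i * (F (\<tau> (Suc i)) - F (\<tau> i)))"
    by blast
  have "0 \<le> \<tau> i" if "i \<le> n" for i
  proof -
    have "i < length xs"
      using that len unfolding n_def by linarith
    then have "\<tau> i \<in> P"
      unfolding xs(1)[symmetric] \<tau>_def by (rule nth_mem)
    then show ?thesis
      using ps by (auto simp: P_def)
  qed
  with y \<tau>_less show ?thesis
    by (intro that[of n \<tau> y]) auto
qed

section \<open>Gaussian increments of Brownian motion and the isometry for step functions\<close>

lemma normal_mgf:
  assumes "0 < \<sigma>"
  shows "has_bochner_integral lborel (\<lambda>x. normal_density 0 \<sigma> x * exp (c * x)) (exp (c\<^sup>2 * \<sigma>\<^sup>2 / 2))"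
proof -
  \<comment> \<open>Completing the square: the exponential weight moves the mean of the normal
    density to \<open>c * \<sigma>\<^sup>2\<close>.\<close>
  have "normal_density 0 \<sigma> x * exp (c * x) = exp (c\<^sup>2 * \<sigma>\<^sup>2 / 2) * normal_density (c * \<sigma>\<^sup>2) \<sigma> x" for x
  proof -
    have "- x\<^sup>2 / (2 * \<sigma>\<^sup>2) + c * x = c\<^sup>2 * \<sigma>\<^sup>2 / 2 + - (x - c * \<sigma>\<^sup>2)\<^sup>2 / (2 * \<sigma>\<^sup>2)"
      using assms by (simp add: field_simps power2_eq_square)
    then show ?thesis
      by (simp add: normal_density_def flip: exp_add)
  qed
  then show ?thesis
    using assms by (simp add: has_bochner_integral_iff)
qed

lemma brownian_motion_prob_space: "brownian_motion_on T M B \<Longrightarrow> prob_space M"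
  by (simp add: brownian_motion_on_def)

lemma brownian_motion_increment:
  assumes B: "brownian_motion_on {0..} M B" and st: "0 \<le> s" "s < t"
  shows "has_bochner_integral M (\<lambda>\<omega>. exp (c * (B t \<omega> - B s \<omega>))) (exp (c\<^sup>2 * (t - s) / 2))"
    and "sq_int M (\<lambda>\<omega>. B t \<omega> - B s \<omega>)"
    and "(\<integral>\<omega>. B t \<omega> - B s \<omega> \<partial>M) = 0"
    and "(\<integral>\<omega>. (B t \<omega> - B s \<omega>)\<^sup>2 \<partial>M) = t - s"
proof -
  interpret prob_space M
    using B by (rule brownian_motion_prob_space)
  let ?\<sigma> = "sqrt (t - s)"
  have \<sigma>: "0 < ?\<sigma>"
    using st by simp
  have D: "distributed M lborel (\<lambda>\<omega>. B t \<omega> - B s \<omega>) (normal_density 0 ?\<sigma>)"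
    using B st unfolding brownian_motion_on_def by auto
  have meas[measurable]: "B t \<in> borel_measurable M" "B s \<in> borel_measurable M"
    using B st unfolding brownian_motion_on_def by auto
  show "has_bochner_integral M (\<lambda>\<omega>. exp (c * (B t \<omega> - B s \<omega>))) (exp (c\<^sup>2 * (t - s) / 2))"
    using normal_mgf[OF \<sigma>, of c] distributed_integral[OF D, of "\<lambda>x. exp (c * x)"]
      distributed_integrable[OF D, of "\<lambda>x. exp (c * x)"] st
    by (simp add: has_bochner_integral_iff)
  show E: "(\<integral>\<omega>. B t \<omega> - B s \<omega> \<partial>M) = 0"
    using normal_distributed_expectation[OF \<sigma> D] .
  show "sq_int M (\<lambda>\<omega>. B t \<omega> - B s \<omega>)"
    using distributed_integrable[OF D, of "\<lambda>x. x\<^sup>2"] integrable_normal_moment[OF \<sigma>, of 0 2]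
    by (simp add: sq_int_def)
  show "(\<integral>\<omega>. (B t \<omega> - B s \<omega>)\<^sup>2 \<partial>M) = t - s"
    using normal_distributed_variance[OF \<sigma> D] E st by simp
qed

text \<open>Independence and zero means make the increments orthogonal; independence again factors
  the exponential of the sum over the increments.\<close>

lemma brownian_motion_increments_sum:
  fixes y :: "nat \<Rightarrow> real"
  assumes B: "brownian_motion_on {0..} M B"
    and \<tau>: "\<forall>i\<le>n. 0 \<le> \<tau> i" "\<forall>i<n. \<tau> i < \<tau> (Suc i)"
  defines "S \<equiv> \<lambda>\<omega>. \<Sum>i<n. y i * (B (\<tau> (Suc i)) \<omega> - B (\<tau> i) \<omega>)"
    and "v \<equiv> \<Sum>i<n. (y i)\<^sup>2 * (\<tau> (Suc i) - \<tau> i)"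
  shows "sq_int M S" "(\<integral>\<omega>. (S \<omega>)\<^sup>2 \<partial>M) = v"
    "has_bochner_integral M (\<lambda>\<omega>. exp (c * S \<omega>)) (exp (c\<^sup>2 * v / 2))"
proof -
  interpret prob_space M
    using B by (rule brownian_motion_prob_space)
  define D where "D i \<omega> = B (\<tau> (Suc i)) \<omega> - B (\<tau> i) \<omega>" for i \<omega>
  have ind: "indep_vars (\<lambda>_. borel) D {..<n}"
    using B \<tau> unfolding brownian_motion_on_def D_def[abs_def] by auto
  have inc: "0 \<le> \<tau> i" "\<tau> i < \<tau> (Suc i)" if "i < n" for i
    using \<tau> that by auto
  have D: "has_bochner_integral M (\<lambda>\<omega>. exp (c * D i \<omega>)) (exp (c\<^sup>2 * (\<tau> (Suc i) - \<tau> i) / 2))"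
    "sq_int M (D i)" "(\<integral>\<omega>. D i \<omega> \<partial>M) = 0" "(\<integral>\<omega>. (D i \<omega>)\<^sup>2 \<partial>M) = \<tau> (Suc i) - \<tau> i" if "i < n" for i c
    unfolding D_def by (rule brownian_motion_increment[OF B inc[OF that]])+
  have "(\<integral>\<omega>. D i \<omega> * D j \<omega> \<partial>M) = (if i = j then \<tau> (Suc i) - \<tau> i else 0)" if "i < n" "j < n" for i j
  proof (cases "i = j")
    case True
    then show ?thesis
      using D(4)[OF that(1)] by (simp add: power2_eq_square)
  next
    case False
    \<comment> \<open>The two factors are read as a product over the index set
      \<open>{i, j}\<close>, the form in which independence factors an expectation.\<close>
    have "(\<integral>\<omega>. (\<Prod>k\<in>{i, j}. D k \<omega>) \<partial>M) = (\<Prod>k\<in>{i, j}. \<integral>\<omega>. D k \<omega> \<partial>M)"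
      using that by (intro indep_vars_lebesgue_integral indep_vars_subset[OF ind] sq_int_integrable D(2)) auto
    then show ?thesis
      using that D(3) False by simp
  qed
  from integral_square_orthogonal_sum[OF D(2) this, where y = y]
  show "sq_int M S" "(\<integral>\<omega>. (S \<omega>)\<^sup>2 \<partial>M) = v"
    by (simp_all add: S_def v_def D_def[symmetric])
  have ind': "indep_vars (\<lambda>_. borel) (\<lambda>i \<omega>. exp (c * y i * D i \<omega>)) {..<n}"
    by (rule indep_vars_compose2[OF ind]) simp
  have Dm: "has_bochner_integral M (\<lambda>\<omega>. exp (c * y i * D i \<omega>)) (exp ((c * y i)\<^sup>2 * (\<tau> (Suc i) - \<tau> i) / 2))" if "i < n" for i
    by (rule D(1)[OF that])
  have prod: "exp (c * S \<omega>) = (\<Prod>i<n. exp (c * y i * D i \<omega>))" for \<omega>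
    by (simp add: S_def D_def exp_sum[symmetric] sum_distrib_left mult.assoc)
  have prod': "exp (c\<^sup>2 * v / 2) = (\<Prod>i<n. exp ((c * y i)\<^sup>2 * (\<tau> (Suc i) - \<tau> i) / 2))"
    by (simp add: v_def exp_sum[symmetric] sum_distrib_left sum_divide_distrib power_mult_distrib mult.assoc)
  show "has_bochner_integral M (\<lambda>\<omega>. exp (c * S \<omega>)) (exp (c\<^sup>2 * v / 2))"
    unfolding prod prod' has_bochner_integral_iff
    using indep_vars_lebesgue_integral[OF _ ind'] indep_vars_integrable[OF _ ind'] Dm
    by (auto simp: has_bochner_integral_iff intro!: prod.cong)
qed

lemma step_fun_increments:
  assumes "\<forall>(x, l, r)\<in>set ps. 0 \<le> l \<and> l \<le> r"
  shows "step_fun ps u = (\<Sum>(x, l, r)\<leftarrow>ps. x * (of_bool (u \<le> r) - of_bool (u \<le> l)))"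
  unfolding step_fun_def using assms
  by (intro arg_cong[of _ _ sum_list] map_cong) (auto split: split_indicator)

text \<open>One refinement serves both sides: it turns the step integral into a combination of
  increments and the step function into the same combination of disjoint indicators, so both second
  moments equal the same finite sum.\<close>

lemma step_integral_isometry:
  assumes B: "brownian_motion_on {0..} M B"
    and ps: "\<forall>(x, l, r)\<in>set ps. 0 \<le> l \<and> l \<le> r"
  shows "sq_int M (step_integral B ps)" "sq_int lborel (step_fun ps)"
    "(\<integral>\<omega>. (step_integral B ps \<omega>)\<^sup>2 \<partial>M) = (\<integral>u. (step_fun ps u)\<^sup>2 \<partial>lborel)"
    "has_bochner_integral M (\<lambda>\<omega>. exp (c * step_integral B ps \<omega>)) (exp (c\<^sup>2 * (\<integral>u. (step_fun ps u)\<^sup>2 \<partial>lborel) / 2))"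
proof -
  obtain n \<tau> y where \<tau>: "\<forall>i\<le>n. 0 \<le> \<tau> i" "\<forall>i<n. \<tau> i < \<tau> (Suc i)"
    and eq: "\<And>F :: real \<Rightarrow> real. (\<Sum>(x, l, r)\<leftarrow>ps. x * (F r - F l)) = (\<Sum>i<n. y i * (F (\<tau> (Suc i)) - F (\<tau> i)))"
    using interval_sum_refinement[OF ps] by blast
  define D :: "nat \<Rightarrow> real \<Rightarrow> real" where "D i u = of_bool (u \<le> \<tau> (Suc i)) - of_bool (u \<le> \<tau> i)" for i u
  have I: "step_integral B ps = (\<lambda>\<omega>. \<Sum>i<n. y i * (B (\<tau> (Suc i)) \<omega> - B (\<tau> i) \<omega>))"
    unfolding step_integral_def by (intro ext eq)
  have f: "step_fun ps = (\<lambda>u. \<Sum>i<n. y i * D i u)"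
    unfolding step_fun_increments[OF ps] D_def by (intro ext eq)
  have \<tau>_mono: "\<tau> i \<le> \<tau> j" if "i \<le> j" "j \<le> n" for i j
    using that
  proof (induction j rule: dec_induct)
    case (step j)
    then have "\<tau> i \<le> \<tau> j" "\<tau> j < \<tau> (Suc j)"
      using \<tau>(2) by auto
    then show ?case by simp
  qed simp
  have D: "D i = indicator {\<tau> i<..\<tau> (Suc i)}" if "i < n" for i
    using \<tau>(2) that by (auto simp: D_def fun_eq_iff indicator_def)
  have sq: "sq_int lborel (D i)" if "i < n" for i
    unfolding D[OF that] sq_int_def power2_eq_square indicator_inter_arith[symmetric]
    using \<tau>(2) that by (auto intro!: integrable_real_indicator simp: less_imp_le)
  have "(\<integral>u. D i u * D j u \<partial>lborel) = (if i = j then \<tau> (Suc i) - \<tau> i else 0)" if "i < n" "j < n" for i j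
  proof (cases "i = j")
    case True
    then show ?thesis
      using \<tau>(2) that by (simp add: D indicator_inter_arith[symmetric] less_imp_le)
  next
    case False
    have "{\<tau> i<..\<tau> (Suc i)} \<inter> {\<tau> j<..\<tau> (Suc j)} = {}"
      using False \<tau>_mono[of "Suc i" j] \<tau>_mono[of "Suc j" i] that
      by (cases i j rule: linorder_cases) auto
    then have "u \<notin> {\<tau> i<..\<tau> (Suc i)} \<or> u \<notin> {\<tau> j<..\<tau> (Suc j)}" for u
      by blast
    then have "D i u * D j u = 0" for u
      unfolding D[OF that(1)] D[OF that(2)] by (metis indicator_simps(2) mult_eq_0_iff)
    with False show ?thesis
      by (simp only: Bochner_Integration.integral_zero if_False)
  qed
  note iso = integral_square_orthogonal_sum[OF sq this, where y = y]
  have v: "(\<integral>u. (step_fun ps u)\<^sup>2 \<partial>lborel) = (\<Sum>i<n. (y i)\<^sup>2 * (\<tau> (Suc i) - \<tau> i))"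
    unfolding f by (rule iso) auto
  show "sq_int lborel (step_fun ps)"
    unfolding f by (rule iso) auto
  show "sq_int M (step_integral B ps)"
    "(\<integral>\<omega>. (step_integral B ps \<omega>)\<^sup>2 \<partial>M) = (\<integral>u. (step_fun ps u)\<^sup>2 \<partial>lborel)"
    "has_bochner_integral M (\<lambda>\<omega>. exp (c * step_integral B ps \<omega>)) (exp (c\<^sup>2 * (\<integral>u. (step_fun ps u)\<^sup>2 \<partial>lborel) / 2))"
    unfolding v I using brownian_motion_increments_sum[OF B \<tau>, where y = y] by blast+
qed

text \<open>The time horizon has moved into the integrand as an indicator. Integrals up to different
  times thus belong to one linear space and can be added, compared and polarized.\<close>

definition wiener :: "'a measure \<Rightarrow> (real \<Rightarrow> 'a \<Rightarrow> real) \<Rightarrow> (real \<Rightarrow> real) \<Rightarrow> ('a \<Rightarrow> real) \<Rightarrow> bool" where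
  "wiener M B g \<zeta> \<longleftrightarrow> (\<exists>ps. (\<forall>n. \<forall>(x, l, r)\<in>set (ps n). 0 \<le> l \<and> l \<le> r) \<and>
     L2_lim lborel (\<lambda>n. step_fun (ps n)) g \<and> L2_lim M (\<lambda>n. step_integral B (ps n)) \<zeta>)"

lemma has_wiener_integral_imp_wiener:
  assumes B: "brownian_motion_on {0..} M B"
    and I: "has_wiener_integral M B t f Y"
  shows "wiener M B (\<lambda>u. indicator {0..t} u * f u) Y"
proof -
  obtain ps where ps: "\<And>n. \<forall>(x, l, r)\<in>set (ps n). 0 \<le> l \<and> l \<le> r \<and> r \<le> t"
    and f: "(\<lambda>n. \<integral>\<^sup>+u\<in>{0..t}. ennreal ((f u - step_fun (ps n) u)\<^sup>2) \<partial>lborel) \<longlonglongrightarrow> 0"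
    and Y: "(\<lambda>n. \<integral>\<^sup>+\<omega>. ennreal ((Y \<omega> - step_integral B (ps n) \<omega>)\<^sup>2) \<partial>M) \<longlonglongrightarrow> 0"
    and meas: "set_borel_measurable lborel {0..t} f" "Y \<in> borel_measurable M"
    using I unfolding has_wiener_integral_def by blast
  have ps': "\<forall>(x, l, r)\<in>set (ps n). 0 \<le> l \<and> l \<le> r" for n
    using ps[of n] by auto
  \<comment> \<open>The intervals stay within \<open>{0..t}\<close>, so the step functions vanish
    outside and the integral over \<open>{0..t}\<close> becomes one over the line.\<close>
  have "step_fun (ps n) u = 0" if "u \<notin> {0..t}" for n u
  proof -
    have "map (\<lambda>(x, l, r). x * indicator {l<..r} u) (ps n) = map (\<lambda>_. 0 :: real) (ps n)"
      using ps[of n] that by (intro map_cong) (auto split: split_indicator)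
    then show ?thesis
      unfolding step_fun_def by (metis sum_list_0)
  qed
  then have "ennreal ((f u - step_fun (ps n) u)\<^sup>2) * indicator {0..t} u
      = ennreal ((indicator {0..t} u * f u - step_fun (ps n) u)\<^sup>2)" for n u
    by (auto split: split_indicator)
  then have "(\<lambda>n. \<integral>\<^sup>+u. ennreal ((indicator {0..t} u * f u - step_fun (ps n) u)\<^sup>2) \<partial>lborel) \<longlonglongrightarrow> 0"
    using f by simp
  then have "L2_lim lborel (\<lambda>n. step_fun (ps n)) (\<lambda>u. indicator {0..t} u * f u)"
    using meas step_integral_isometry(2)[OF B ps']
    by (intro tendsto_nn_integral_imp_L2_lim) (auto simp: set_borel_measurable_def)
  moreover have "L2_lim M (\<lambda>n. step_integral B (ps n)) Y"
    using meas step_integral_isometry(1)[OF B ps'] Y by (intro tendsto_nn_integral_imp_L2_lim) auto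
  ultimately show ?thesis
    unfolding wiener_def using ps' by blast
qed

section \<open>Linearity and isometry of the Wiener integral\<close>

lemma L2_lim_add:
  assumes u: "L2_lim M u u'" and v: "L2_lim M v v'"
  shows "L2_lim M (\<lambda>n x. u n x + v n x) (\<lambda>x. u' x + v' x)"
proof -
  have s: "sq_int M (u n)" "sq_int M (v n)" "sq_int M u'" "sq_int M v'" for n
    using u v by (auto simp: L2_lim_def)
  have "(\<lambda>n. 2 * (\<integral>x. (u' x - u n x)\<^sup>2 \<partial>M) + 2 * (\<integral>x. (v' x - v n x)\<^sup>2 \<partial>M)) \<longlonglongrightarrow> 2 * 0 + 2 * 0"
    using u v by (intro tendsto_intros) (auto simp: L2_lim_def)
  then have lim: "(\<lambda>n. 2 * (\<integral>x. (u' x - u n x)\<^sup>2 \<partial>M) + 2 * (\<integral>x. (v' x - v n x)\<^sup>2 \<partial>M)) \<longlonglongrightarrow> 0"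
    by simp
  have bound: "(\<integral>x. (u' x + v' x - (u n x + v n x))\<^sup>2 \<partial>M) \<le> 2 * (\<integral>x. (u' x - u n x)\<^sup>2 \<partial>M) + 2 * (\<integral>x. (v' x - v n x)\<^sup>2 \<partial>M)" for n
  proof -
    have "(u' x + v' x - (u n x + v n x))\<^sup>2 \<le> 2 * (u' x - u n x)\<^sup>2 + 2 * (v' x - v n x)\<^sup>2" for x
      using sum_squares_bound[of "u' x - u n x" "v' x - v n x"] by (simp add: power2_eq_square algebra_simps)
    then have "(\<integral>x. (u' x + v' x - (u n x + v n x))\<^sup>2 \<partial>M) \<le> (\<integral>x. 2 * (u' x - u n x)\<^sup>2 + 2 * (v' x - v n x)\<^sup>2 \<partial>M)"
      by (intro integral_mono Bochner_Integration.integrable_add integrable_mult_right sq_int_square sq_int_diff sq_int_add s)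
    also have "\<dots> = 2 * (\<integral>x. (u' x - u n x)\<^sup>2 \<partial>M) + 2 * (\<integral>x. (v' x - v n x)\<^sup>2 \<partial>M)"
      by (simp add: sq_int_square sq_int_diff s)
    finally show ?thesis .
  qed
  have "(\<lambda>n. \<integral>x. (u' x + v' x - (u n x + v n x))\<^sup>2 \<partial>M) \<longlonglongrightarrow> 0"
    by (rule tendsto_sandwich[OF always_eventually always_eventually tendsto_const lim]) (use bound in simp_all)
  then show ?thesis
    using s by (simp add: L2_lim_def sq_int_add)
qed

lemma L2_lim_scale:
  assumes u: "L2_lim M u u'"
  shows "L2_lim M (\<lambda>n x. c * u n x) (\<lambda>x. c * u' x)"
proof -
  have "(\<lambda>n. c\<^sup>2 * (\<integral>x. (u' x - u n x)\<^sup>2 \<partial>M)) \<longlonglongrightarrow> c\<^sup>2 * 0"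
    using u by (intro tendsto_intros) (auto simp: L2_lim_def)
  then show ?thesis
    using u by (simp add: L2_lim_def sq_int_scale power_mult_distrib flip: right_diff_distrib)
qed

lemma wiener_zero: "wiener M B (\<lambda>_. 0) (\<lambda>_. 0)"
proof -
  have "sq_int M (\<lambda>_. 0)" "sq_int lborel (\<lambda>_ :: real. 0)"
    by (simp_all add: sq_int_def)
  then show ?thesis
    unfolding wiener_def
    by (intro exI[of _ "\<lambda>_. []"]) (auto simp: step_fun_def[abs_def] step_integral_def[abs_def] intro!: L2_lim_const)
qed

text \<open>The intervals of a step list may overlap, so concatenating lists adds both the step
  functions and their integrals.\<close>

lemma wiener_add:
  assumes "wiener M B g \<zeta>" "wiener M B g' \<zeta>'"
  shows "wiener M B (\<lambda>u. g u + g' u) (\<lambda>\<omega>. \<zeta> \<omega> + \<zeta>' \<omega>)"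
proof -
  obtain ps qs where ps: "\<forall>n. \<forall>(x, l, r)\<in>set (ps n). 0 \<le> l \<and> l \<le> r" "L2_lim lborel (\<lambda>n. step_fun (ps n)) g"
      "L2_lim M (\<lambda>n. step_integral B (ps n)) \<zeta>"
    and qs: "\<forall>n. \<forall>(x, l, r)\<in>set (qs n). 0 \<le> l \<and> l \<le> r" "L2_lim lborel (\<lambda>n. step_fun (qs n)) g'"
      "L2_lim M (\<lambda>n. step_integral B (qs n)) \<zeta>'"
    using assms unfolding wiener_def by blast
  show ?thesis
    unfolding wiener_def
  proof (intro exI[of _ "\<lambda>n. ps n @ qs n"] conjI)
    show "L2_lim lborel (\<lambda>n. step_fun (ps n @ qs n)) (\<lambda>u. g u + g' u)"
      using L2_lim_add[OF ps(2) qs(2)] by (simp add: step_fun_def[abs_def])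
    show "L2_lim M (\<lambda>n. step_integral B (ps n @ qs n)) (\<lambda>\<omega>. \<zeta> \<omega> + \<zeta>' \<omega>)"
      using L2_lim_add[OF ps(3) qs(3)] by (simp add: step_integral_def[abs_def])
  qed (use ps(1) qs(1) in force)
qed

lemma wiener_scale:
  assumes "wiener M B g \<zeta>"
  shows "wiener M B (\<lambda>u. c * g u) (\<lambda>\<omega>. c * \<zeta> \<omega>)"
proof -
  obtain ps where ps: "\<forall>n. \<forall>(x, l, r)\<in>set (ps n). 0 \<le> l \<and> l \<le> r" "L2_lim lborel (\<lambda>n. step_fun (ps n)) g"
      "L2_lim M (\<lambda>n. step_integral B (ps n)) \<zeta>"
    using assms unfolding wiener_def by blast
  have map: "(\<Sum>(x, l, r)\<leftarrow>map (\<lambda>(x, l, r). (c * x, l, r)) qs. x * F l r) = c * (\<Sum>(x, l, r)\<leftarrow>qs. x * F l r)"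
    for qs and F :: "real \<Rightarrow> real \<Rightarrow> real"
    by (induction qs) (auto simp: algebra_simps)
  show ?thesis
    unfolding wiener_def
  proof (intro exI[of _ "\<lambda>n. map (\<lambda>(x, l, r). (c * x, l, r)) (ps n)"] conjI)
    show "L2_lim lborel (\<lambda>n. step_fun (map (\<lambda>(x, l, r). (c * x, l, r)) (ps n))) (\<lambda>u. c * g u)"
      using L2_lim_scale[OF ps(2), of c] unfolding step_fun_def[abs_def] map .
    show "L2_lim M (\<lambda>n. step_integral B (map (\<lambda>(x, l, r). (c * x, l, r)) (ps n))) (\<lambda>\<omega>. c * \<zeta> \<omega>)"
      using L2_lim_scale[OF ps(3), of c] unfolding step_integral_def[abs_def] map .
  qed (use ps(1) in force)
qed

lemma wiener_sq_int:
  assumes "wiener M B g \<zeta>"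
  shows "sq_int lborel g" "sq_int M \<zeta>"
  using assms by (auto simp: wiener_def L2_lim_def)

lemma wiener_isometry:
  assumes B: "brownian_motion_on {0..} M B" and W: "wiener M B g \<zeta>"
  shows "(\<integral>\<omega>. (\<zeta> \<omega>)\<^sup>2 \<partial>M) = (\<integral>u. (g u)\<^sup>2 \<partial>lborel)"
    and "has_bochner_integral M (\<lambda>\<omega>. exp (\<zeta> \<omega>)) (exp ((\<integral>u. (g u)\<^sup>2 \<partial>lborel) / 2))"
proof -
  interpret prob_space M
    using B by (rule brownian_motion_prob_space)
  obtain ps where ps: "\<And>n. \<forall>(x, l, r)\<in>set (ps n). 0 \<le> l \<and> l \<le> r" and g: "L2_lim lborel (\<lambda>n. step_fun (ps n)) g"
    and \<zeta>: "L2_lim M (\<lambda>n. step_integral B (ps n)) \<zeta>"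
    using W unfolding wiener_def by blast
  note step = step_integral_isometry[OF B ps]
  show "(\<integral>\<omega>. (\<zeta> \<omega>)\<^sup>2 \<partial>M) = (\<integral>u. (g u)\<^sup>2 \<partial>lborel)"
    using L2_lim_square[OF g] L2_lim_square[OF \<zeta>] unfolding step(3) by (rule LIMSEQ_unique[rotated])
  show "has_bochner_integral M (\<lambda>\<omega>. exp (\<zeta> \<omega>)) (exp ((\<integral>u. (g u)\<^sup>2 \<partial>lborel) / 2))"
    by (rule L2_lim_gaussian_mgf[OF \<zeta> step(4) L2_lim_square[OF g]])
qed

text \<open>Polarization: the isometry for the sum and for both summands leaves only the mixed
  term.\<close>

lemma wiener_covariance:
  assumes B: "brownian_motion_on {0..} M B" and W: "wiener M B g \<zeta>" "wiener M B g' \<zeta>'"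
  shows "(\<integral>\<omega>. \<zeta> \<omega> * \<zeta>' \<omega> \<partial>M) = (\<integral>u. g u * g' u \<partial>lborel)"
  using wiener_isometry(1)[OF B wiener_add[OF W]] wiener_isometry(1)[OF B W(1)] wiener_isometry(1)[OF B W(2)]
    integral_square_add[OF wiener_sq_int(1)[OF W(1)] wiener_sq_int(1)[OF W(2)]]
    integral_square_add[OF wiener_sq_int(2)[OF W(1)] wiener_sq_int(2)[OF W(2)]]
  by simp

section \<open>Gaussian tails and exponential tilting\<close>

text \<open>The variance enters through an upper bound \<open>w\<close>, which covers degenerate
  variables and lets one bound serve a whole dyadic level.\<close>

lemma (in prob_space) chernoff_bound:
  assumes mgf: "\<And>c. has_bochner_integral M (\<lambda>\<omega>. exp (c * (Z \<omega> - m))) (exp (c\<^sup>2 * v / 2))"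
    and v: "v \<le> w" and w: "0 < w" and x: "0 < x"
  shows "measure M {\<omega>\<in>space M. x \<le> \<bar>Z \<omega> - m\<bar>} \<le> 2 * exp (- (x\<^sup>2 / (2 * w)))"
proof -
  have meas: "(\<lambda>\<omega>. exp (c * (Z \<omega> - m))) \<in> borel_measurable M" for c
    using mgf[of c] by (auto simp: has_bochner_integral_iff intro: borel_measurable_integrable)
  \<comment> \<open>The two solutions \<open>c = x / w\<close> and \<open>c = - (x / w)\<close> are
    the optimal exponents for variance \<open>w\<close>, one for each tail.\<close>
  have *: "measure M {\<omega>\<in>space M. exp (x\<^sup>2 / w) \<le> exp (c * (Z \<omega> - m))} \<le> exp (- (x\<^sup>2 / (2 * w)))"
    if c: "c\<^sup>2 = (x / w)\<^sup>2" for c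
  proof -
    have "measure M {\<omega>\<in>space M. exp (x\<^sup>2 / w) \<le> exp (c * (Z \<omega> - m))} \<le> exp (c\<^sup>2 * v / 2) / exp (x\<^sup>2 / w)"
      using mgf[of c] integral_Markov_inequality_measure[of M "\<lambda>\<omega>. exp (c * (Z \<omega> - m))" "{}" "exp (x\<^sup>2 / w)"]
      by (simp add: has_bochner_integral_iff)
    also have "\<dots> = exp (c\<^sup>2 * v / 2 - x\<^sup>2 / w)"
      by (simp add: exp_diff)
    also have "\<dots> \<le> exp (c\<^sup>2 * w / 2 - x\<^sup>2 / w)"
      using v by (simp add: mult_left_mono divide_right_mono)
    also have "c\<^sup>2 * w / 2 - x\<^sup>2 / w = - (x\<^sup>2 / (2 * w))"
      unfolding c using w by (simp add: field_simps power2_eq_square)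
    finally show ?thesis .
  qed
  have sub: "{\<omega>\<in>space M. x \<le> \<bar>Z \<omega> - m\<bar>} \<subseteq>
     {\<omega>\<in>space M. exp (x\<^sup>2 / w) \<le> exp ((x / w) * (Z \<omega> - m))} \<union> {\<omega>\<in>space M. exp (x\<^sup>2 / w) \<le> exp ((- (x / w)) * (Z \<omega> - m))}"
    (is "_ \<subseteq> ?A \<union> ?B")
  proof
    fix \<omega> assume \<omega>: "\<omega> \<in> {\<omega>\<in>space M. x \<le> \<bar>Z \<omega> - m\<bar>}"
    then consider "x \<le> Z \<omega> - m" | "x \<le> - (Z \<omega> - m)"
      by (auto simp: abs_if split: if_splits)
    then have "(x / w) * x \<le> (x / w) * (Z \<omega> - m) \<or> (x / w) * x \<le> (x / w) * (- (Z \<omega> - m))"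
      using x w by (metis divide_nonneg_pos less_imp_le mult_left_mono)
    then have "x\<^sup>2 / w \<le> (x / w) * (Z \<omega> - m) \<or> x\<^sup>2 / w \<le> (- (x / w)) * (Z \<omega> - m)"
      by (simp only: power2_eq_square minus_mult_commute times_divide_eq_left)
    then show "\<omega> \<in> ?A \<union> ?B"
      using \<omega> by auto
  qed
  have AB: "?A \<in> sets M" "?B \<in> sets M"
    using meas[of "x / w"] meas[of "- (x / w)"] by measurable
  have "measure M {\<omega>\<in>space M. x \<le> \<bar>Z \<omega> - m\<bar>} \<le> measure M (?A \<union> ?B)"
    using AB by (intro finite_measure_mono sub) auto
  also have "\<dots> \<le> measure M ?A + measure M ?B"
    using AB by (intro measure_Un_le)
  also have "\<dots> \<le> exp (- (x\<^sup>2 / (2 * w))) + exp (- (x\<^sup>2 / (2 * w)))"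
    by (intro add_mono *) simp_all
  finally show ?thesis by simp
qed

section \<open>Tail bound for all dyadic increments at once\<close>

definition dyadic_inc :: "nat \<Rightarrow> nat \<Rightarrow> C01 \<Rightarrow>\<^sub>L real" where
  "dyadic_inc n k = evl (dyadic n (Suc k)) - evl (dyadic n k)"

lemma dyadic_inc_eval_span [simp]: "dyadic_inc n k \<in> eval_span"
  by (simp add: dyadic_inc_def)

lemma hoelder_set_dyadic_inc:
  "f \<in> hoelder_set r R \<longleftrightarrow> evl (to_unit 0) f = 0 \<and> (\<forall>n. \<forall>k<2 ^ n. \<bar>dyadic_inc n k f\<bar> \<le> R * r ^ n)"
  by (simp add: hoelder_set_def dyadic_inc_def blinfun.diff_left)

text \<open>Level \<open>n\<close> has \<open>2 ^ n\<close> increments, each with a Gaussian tail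
  whose exponent grows like \<open>(1 / r\<^sup>2) ^ n\<close>. The dependence on the radius
  \<open>R\<close> has been split off.\<close>

definition tail_const :: "real \<Rightarrow> real" where
  "tail_const r = (\<Sum>n. 2 ^ n * (2 * exp (- ((1 / r\<^sup>2) ^ n / 2))))"

lemma summable_tail_const:
  fixes r :: real
  assumes r: "0 < r" "r < 1"
  shows "summable (\<lambda>n. 2 ^ n * (2 * exp (- ((1 / r\<^sup>2) ^ n / 2))))"
proof -
  define q where "q = 1 / r\<^sup>2"
  have "r\<^sup>2 < 1"
    using r power_strict_mono[of r 1 2] by simp
  then have "q > 1"
    using r by (simp add: q_def field_simps)
  then have "eventually (\<lambda>n. 2 ^ n * (2 * exp (- (q ^ n / 2))) \<le> (1 / 2) ^ n) at_top"
    by real_asymp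
  then have "eventually (\<lambda>n. norm (2 ^ n * (2 * exp (- (q ^ n / 2)))) \<le> (1 / 2) ^ n) at_top"
    by simp
  then show ?thesis
    unfolding q_def[symmetric] by (rule summable_comparison_test_ev) (simp add: summable_geometric)
qed

lemma tail_const_nonneg:
  assumes r: "0 < r" "r < 1"
  shows "0 \<le> tail_const r"
  unfolding tail_const_def by (intro suminf_nonneg summable_tail_const r) auto

text \<open>A union bound over all increments. At level \<open>n\<close> the threshold is
  \<open>R * r ^ n\<close>, while the standard deviation is of order \<open>r ^ (2 * n)\<close>.
  Half of the threshold is reserved for the mean \<open>m n k\<close>, so that the estimate applies
  to tilted laws too.\<close>

lemma (in prob_space) hoelder_set_tail:
  fixes Z :: "'a \<Rightarrow> C01"
  assumes Z: "Z \<in> borel_measurable M" and Z0: "AE \<omega> in M. evl (to_unit 0) (Z \<omega>) = 0"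
    and mgf: "\<And>n k c. k < 2 ^ n \<Longrightarrow>
      has_bochner_integral M (\<lambda>\<omega>. exp (c * (dyadic_inc n k (Z \<omega>) - m n k))) (exp (c\<^sup>2 * v n k / 2))"
    and v: "\<And>n k. k < 2 ^ n \<Longrightarrow> v n k \<le> C * r ^ (4 * n)"
    and m: "\<And>n k. k < 2 ^ n \<Longrightarrow> \<bar>m n k\<bar> \<le> R / 2 * r ^ n"
    and r: "0 < r" "r < 1" and C: "0 < C" and R: "0 < R" "8 * C \<le> R\<^sup>2"
  shows "measure M {\<omega>\<in>space M. Z \<omega> \<notin> hoelder_set r R} \<le> tail_const r * exp (- (R\<^sup>2 / (16 * C)))"
proof -
  \<comment> \<open>The Chernoff exponent at level 0, for a deviation of \<open>R / 2\<close> at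
    variance \<open>C\<close>.\<close>
  define A where "A = R\<^sup>2 / (8 * C)"
  have A: "1 \<le> A"
    using R C by (simp add: A_def)
  define q where "q = 1 / r\<^sup>2"
  have q: "q \<ge> 1"
    using r by (simp add: q_def power_le_one)
  define N where "N = {\<omega>\<in>space M. evl (to_unit 0) (Z \<omega>) \<noteq> 0}"
  define E where "E n k = {\<omega>\<in>space M. R * r ^ n < \<bar>dyadic_inc n k (Z \<omega>)\<bar>}" for n k
  have meas[measurable]: "(\<lambda>\<omega>. blinfun_apply a (Z \<omega>)) \<in> borel_measurable M" for a :: "C01 \<Rightarrow>\<^sub>L real"
    using Z by (intro borel_measurable_continuous_on[of "blinfun_apply a"] continuous_intros)
  have N: "N \<in> sets M" "measure M N = 0"
  proof -
    show "N \<in> sets M"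
      unfolding N_def by measurable
    then show "measure M N = 0"
      using Z0 by (subst prob_eq_0) (auto simp: N_def)
  qed
  have E: "E n k \<in> sets M" for n k
    unfolding E_def by measurable
  have E_le: "measure M (E n k) \<le> exp (- (A / 2)) * (2 * exp (- (q ^ n / 2)))" if k: "k < 2 ^ n" for n k
  proof -
    have "E n k \<subseteq> {\<omega>\<in>space M. R / 2 * r ^ n \<le> \<bar>dyadic_inc n k (Z \<omega>) - m n k\<bar>}"
    proof
      fix \<omega> assume "\<omega> \<in> E n k"
      then have "\<omega> \<in> space M" "R * r ^ n < \<bar>dyadic_inc n k (Z \<omega>)\<bar>"
        by (auto simp: E_def)
      moreover have "R * r ^ n = R / 2 * r ^ n + R / 2 * r ^ n"
        by simp
      ultimately have "R / 2 * r ^ n \<le> \<bar>dyadic_inc n k (Z \<omega>) - m n k\<bar>"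
        using m[OF k] by linarith
      then show "\<omega> \<in> {\<omega>\<in>space M. R / 2 * r ^ n \<le> \<bar>dyadic_inc n k (Z \<omega>) - m n k\<bar>}"
        using \<open>\<omega> \<in> space M\<close> by blast
    qed
    then have "measure M (E n k) \<le> measure M {\<omega>\<in>space M. R / 2 * r ^ n \<le> \<bar>dyadic_inc n k (Z \<omega>) - m n k\<bar>}"
      by (intro finite_measure_mono) measurable
    also have "\<dots> \<le> 2 * exp (- ((R / 2 * r ^ n)\<^sup>2 / (2 * (C * r ^ (4 * n)))))"
      using r C R by (intro chernoff_bound[OF mgf[OF k] v[OF k]]) auto
    also have "(R / 2 * r ^ n)\<^sup>2 / (2 * (C * r ^ (4 * n))) = A * q ^ n"
    proof -
      have "r ^ (4 * n) = (r ^ n)\<^sup>2 * (r\<^sup>2) ^ n"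
        by (simp add: power_mult[symmetric] power_add[symmetric] mult.commute)
      then show ?thesis
        using r C by (simp add: A_def q_def field_simps power_mult_distrib)
    qed
    also have "2 * exp (- (A * q ^ n)) \<le> 2 * (exp (- (A / 2)) * exp (- (q ^ n / 2)))"
    proof -
      \<comment> \<open>Bounding the product \<open>A * q ^ n\<close> below by a sum separates the
        radius from the level. It costs half of the exponent, whence 16 in the conclusion in place
        of 8.\<close>
      have "1 \<le> q ^ n"
        using q by (rule one_le_power)
      then have "0 \<le> (A - 1 / 2) * (q ^ n - 1) + (A - 1) / 2"
        using A by (intro add_nonneg_nonneg mult_nonneg_nonneg) auto
      also have "\<dots> = A * q ^ n - (A / 2 + q ^ n / 2)"
        by (simp add: field_simps)
      finally have "A / 2 + q ^ n / 2 \<le> A * q ^ n"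
        by simp
      then show ?thesis
        by (simp add: exp_add[symmetric])
    qed
    finally show ?thesis by simp
  qed
  define L where "L n = (\<Union>k\<in>{..<2 ^ n}. E n k)" for n
  have L: "range L \<subseteq> sets M"
    using E by (auto simp: L_def)
  have L_le: "measure M (L n) \<le> exp (- (A / 2)) * (2 ^ n * (2 * exp (- (q ^ n / 2))))" for n
  proof -
    have "measure M (L n) \<le> (\<Sum>k<2 ^ n. measure M (E n k))"
      unfolding L_def using E by (intro finite_measure_subadditive_finite) auto
    also have "\<dots> \<le> (\<Sum>k<(2::nat) ^ n. exp (- (A / 2)) * (2 * exp (- (q ^ n / 2))))"
      by (intro sum_mono E_le) auto
    finally show ?thesis
      by (simp add: mult.left_commute)
  qed
  note sm = summable_mult[OF summable_tail_const[OF r], of "exp (- (A / 2))", folded q_def]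
  have sL: "summable (\<lambda>n. measure M (L n))"
    using L_le by (intro summable_comparison_test'[OF sm, of 0]) simp
  have "measure M {\<omega>\<in>space M. Z \<omega> \<notin> hoelder_set r R} \<le> measure M (N \<union> (\<Union>n. L n))"
  proof (rule finite_measure_mono)
    show "{\<omega>\<in>space M. Z \<omega> \<notin> hoelder_set r R} \<subseteq> N \<union> (\<Union>n. L n)"
      by (auto simp: hoelder_set_dyadic_inc N_def L_def E_def not_le)
  qed (use N L in auto)
  also have "\<dots> \<le> measure M N + measure M (\<Union>n. L n)"
    using N L by (intro measure_Un_le) auto
  also have "measure M (\<Union>n. L n) \<le> (\<Sum>n. measure M (L n))"
    by (rule finite_measure_subadditive_countably[OF L sL])
  also have "\<dots> \<le> (\<Sum>n. exp (- (A / 2)) * (2 ^ n * (2 * exp (- (q ^ n / 2)))))"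
    by (rule suminf_le[OF L_le sL sm])
  also have "\<dots> = exp (- (A / 2)) * tail_const r"
    unfolding tail_const_def q_def by (rule suminf_mult[OF summable_tail_const[OF r]])
  finally show ?thesis
    using N(2) by (simp add: A_def mult.commute)
qed

section \<open>Gaussian maps and their exponential tilts\<close>

definition cov :: "'a measure \<Rightarrow> ('a \<Rightarrow> C01) \<Rightarrow> (C01 \<Rightarrow>\<^sub>L real) \<Rightarrow> (C01 \<Rightarrow>\<^sub>L real) \<Rightarrow> real" where
  "cov M Z a b = (\<integral>\<omega>. a (Z \<omega>) * b (Z \<omega>) \<partial>M)"

text \<open>A centred Gaussian law is encoded by generating functions on \<open>eval_span\<close>.
  As this set is closed under scaling, the condition determines the law of each functional: centred
  normal with variance \<open>cov M Z a a\<close>.\<close>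

definition gaussian_map :: "'a measure \<Rightarrow> ('a \<Rightarrow> C01) \<Rightarrow> bool" where
  "gaussian_map M Z \<longleftrightarrow> Z \<in> borel_measurable M \<and> (\<forall>a\<in>eval_span. sq_int M (\<lambda>\<omega>. blinfun_apply a (Z \<omega>)) \<and>
     has_bochner_integral M (\<lambda>\<omega>. exp (blinfun_apply a (Z \<omega>))) (exp (cov M Z a a / 2)))"

lemma gaussian_mapD:
  assumes "gaussian_map M Z"
  shows "Z \<in> borel_measurable M" "a \<in> eval_span \<Longrightarrow> sq_int M (\<lambda>\<omega>. blinfun_apply a (Z \<omega>))"
    "a \<in> eval_span \<Longrightarrow> has_bochner_integral M (\<lambda>\<omega>. exp (blinfun_apply a (Z \<omega>))) (exp (cov M Z a a / 2))"
  using assms by (auto simp: gaussian_map_def)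

lemma cov_commute: "cov M Z a b = cov M Z b a"
  by (simp add: cov_def mult.commute)

lemma cov_nonneg: "0 \<le> cov M Z a a"
  by (simp add: cov_def)

context
  fixes M :: "'a measure" and Z :: "'a \<Rightarrow> C01"
  assumes Z: "gaussian_map M Z"
begin

lemma cov_add_left:
  assumes "a \<in> eval_span" "a' \<in> eval_span" "b \<in> eval_span"
  shows "cov M Z (a + a') b = cov M Z a b + cov M Z a' b"
  using sq_int_mult[OF gaussian_mapD(2)[OF Z assms(1)] gaussian_mapD(2)[OF Z assms(3)]]
    sq_int_mult[OF gaussian_mapD(2)[OF Z assms(2)] gaussian_mapD(2)[OF Z assms(3)]]
  by (simp add: cov_def blinfun.add_left distrib_right)

lemma cov_scale_left: "cov M Z (x *\<^sub>R a) b = x * cov M Z a b"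
  by (simp add: cov_def blinfun.scaleR_left mult.assoc)

lemma cov_add_right:
  assumes "a \<in> eval_span" "b \<in> eval_span" "b' \<in> eval_span"
  shows "cov M Z a (b + b') = cov M Z a b + cov M Z a b'"
  using cov_add_left[OF assms(2,3,1)] by (simp add: cov_commute)

lemma cov_scale_right: "cov M Z a (x *\<^sub>R b) = x * cov M Z a b"
  using cov_scale_left[of x b a] by (simp add: cov_commute)

lemma cov_Cauchy_Schwarz:
  assumes "a \<in> eval_span" "b \<in> eval_span"
  shows "\<bar>cov M Z a b\<bar> \<le> sqrt (cov M Z a a) * sqrt (cov M Z b b)"
  using Cauchy_Schwarz_integral[OF gaussian_mapD(2)[OF Z assms(1)] gaussian_mapD(2)[OF Z assms(2)]]
  by (simp add: cov_def power2_eq_square)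

text \<open>The Cameron-Martin density: tilting along \<open>a\<close> shifts the functionals of
  \<open>Z\<close> by their covariance with \<open>a (Z \<omega>)\<close>.\<close>

definition tilted :: "(C01 \<Rightarrow>\<^sub>L real) \<Rightarrow> 'a measure" where
  "tilted a = density M (\<lambda>\<omega>. exp (a (Z \<omega>) - cov M Z a a / 2))"

text \<open>The density times the exponential is a constant times the exponential of the single
  functional \<open>a + c *\<^sub>R b\<close>, whose generating function is known. So the shifted
  mean and the unchanged variance are read off without identifying the tilted law.\<close>

lemma tilted_mgf:
  assumes a: "a \<in> eval_span" and b: "b \<in> eval_span"
  shows "has_bochner_integral (tilted a) (\<lambda>\<omega>. exp (c * (b (Z \<omega>) - cov M Z a b))) (exp (c\<^sup>2 * cov M Z b b / 2))"
proof -
  let ?q = "cov M Z"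
  have meas: "(\<lambda>\<omega>. blinfun_apply a (Z \<omega>)) \<in> borel_measurable M" "(\<lambda>\<omega>. blinfun_apply b (Z \<omega>)) \<in> borel_measurable M"
    using gaussian_mapD(2)[OF Z] a b by (auto intro: sq_int_measurable)
  have "has_bochner_integral M (\<lambda>\<omega>. exp (- ?q a a / 2 - c * ?q a b) *\<^sub>R exp ((a + c *\<^sub>R b) (Z \<omega>)))
     (exp (- ?q a a / 2 - c * ?q a b) *\<^sub>R exp (?q (a + c *\<^sub>R b) (a + c *\<^sub>R b) / 2))"
    by (intro has_bochner_integral_scaleR_right gaussian_mapD(3)[OF Z]) (simp add: a b)
  also have "(\<lambda>\<omega>. exp (- ?q a a / 2 - c * ?q a b) *\<^sub>R exp ((a + c *\<^sub>R b) (Z \<omega>)))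
      = (\<lambda>\<omega>. exp (a (Z \<omega>) - ?q a a / 2) *\<^sub>R exp (c * (b (Z \<omega>) - ?q a b)))"
    by (simp add: exp_add[symmetric] blinfun.add_left blinfun.scaleR_left algebra_simps)
  also have "?q (a + c *\<^sub>R b) (a + c *\<^sub>R b) = ?q a a + 2 * c * ?q a b + c\<^sup>2 * ?q b b"
    using a b by (simp add: cov_add_left cov_add_right cov_scale_left cov_scale_right power2_eq_square
        cov_commute[of M Z b a] algebra_simps)
  also have "exp (- ?q a a / 2 - c * ?q a b) *\<^sub>R exp ((?q a a + 2 * c * ?q a b + c\<^sup>2 * ?q b b) / 2) = exp (c\<^sup>2 * ?q b b / 2)"
    by (simp add: exp_add[symmetric] field_simps)
  finally show ?thesis
    unfolding tilted_def using meas by (intro has_bochner_integral_density) auto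
qed

lemma prob_space_tilted:
  assumes a: "a \<in> eval_span"
  shows "prob_space (tilted a)"
proof
  \<comment> \<open>At \<open>c = 0\<close> the generating function is the total mass.\<close>
  have "has_bochner_integral (tilted a) (\<lambda>\<omega>. 1 :: real) 1"
    using tilted_mgf[OF a a, of 0] by simp
  then have "integrable (tilted a) (\<lambda>\<omega>. 1 :: real)" "(\<integral>\<omega>. 1 \<partial>tilted a) = (1 :: real)"
    by (auto simp: has_bochner_integral_iff)
  then show "emeasure (tilted a) (space (tilted a)) = 1"
    using nn_integral_eq_integral[of "tilted a" "\<lambda>_. 1"] by simp
qed

lemma tilted_zero: "tilted 0 = M"
  by (simp add: tilted_def cov_def density_1)

lemma sets_tilted [simp]: "sets (tilted a) = sets M" "space (tilted a) = space M"
  by (simp_all add: tilted_def)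

text \<open>By Cauchy-Schwarz a tilt changes the mean of an increment by at most
  \<open>sqrt (cov M Z a a * C) * r ^ (2 * n)\<close>. Assumption \<open>m\<close> makes this fit
  into the half of the threshold reserved for means.\<close>

lemma tilted_hoelder_set_tail:
  assumes a: "a \<in> eval_span" and zero: "cov M Z (evl (to_unit 0)) (evl (to_unit 0)) = 0"
    and v: "\<And>n k. k < 2 ^ n \<Longrightarrow> cov M Z (dyadic_inc n k) (dyadic_inc n k) \<le> C * r ^ (4 * n)"
    and m: "4 * cov M Z a a * C \<le> R\<^sup>2"
    and r: "0 < r" "r < 1" and C: "0 < C" and R: "0 < R" "8 * C \<le> R\<^sup>2"
  shows "measure (tilted a) {\<omega>\<in>space M. Z \<omega> \<notin> hoelder_set r R} \<le> tail_const r * exp (- (R\<^sup>2 / (16 * C)))"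
proof -
  interpret prob_space "tilted a"
    by (rule prob_space_tilted[OF a])
  have "AE \<omega> in M. (evl (to_unit 0) (Z \<omega>))\<^sup>2 = 0"
    using zero integral_nonneg_eq_0_iff_AE[OF sq_int_square[OF gaussian_mapD(2)[OF Z evl_in_eval_span]]]
    by (auto simp: cov_def power2_eq_square)
  then have ae: "AE \<omega> in tilted a. evl (to_unit 0) (Z \<omega>) = 0"
    unfolding tilted_def using sq_int_measurable[OF gaussian_mapD(2)[OF Z a]] by (subst AE_density) auto
  have Zm: "Z \<in> borel_measurable (tilted a)"
    using gaussian_mapD(1)[OF Z] by (simp add: tilted_def)
  have "\<bar>cov M Z a (dyadic_inc n k)\<bar> \<le> R / 2 * r ^ n" if "k < 2 ^ n" for n k
  proof -
    have "\<bar>cov M Z a (dyadic_inc n k)\<bar> \<le> sqrt (cov M Z a a) * sqrt (cov M Z (dyadic_inc n k) (dyadic_inc n k))"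
      by (intro cov_Cauchy_Schwarz a) simp
    also have "\<dots> \<le> sqrt (cov M Z a a) * sqrt (C * r ^ (4 * n))"
      using v[OF that] by (intro mult_left_mono real_sqrt_le_mono) (auto simp: cov_nonneg)
    also have "r ^ (4 * n) = ((r ^ n)\<^sup>2)\<^sup>2"
      by (simp add: power_mult[symmetric] mult.commute)
    also have "sqrt (cov M Z a a) * sqrt (C * ((r ^ n)\<^sup>2)\<^sup>2) = sqrt (4 * cov M Z a a * C) / 2 * (r ^ n)\<^sup>2"
    proof -
      have "sqrt (C * y\<^sup>2) = sqrt C * y" if "0 \<le> y" for y
        by (simp add: real_sqrt_mult that)
      from this[of "(r ^ n)\<^sup>2"] have "sqrt (C * ((r ^ n)\<^sup>2)\<^sup>2) = sqrt C * (r ^ n)\<^sup>2"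
        using zero_le_power2 by blast
      then show ?thesis
        by (simp add: real_sqrt_mult)
    qed
    also have "\<dots> \<le> sqrt (R\<^sup>2) / 2 * (r ^ n)\<^sup>2"
      using m by (intro mult_right_mono divide_right_mono real_sqrt_le_mono) auto
    also have "\<dots> \<le> R / 2 * r ^ n"
      using r R by (simp add: power2_eq_square mult_left_le power_le_one)
    finally show ?thesis .
  qed
  from hoelder_set_tail[OF Zm ae tilted_mgf[OF a dyadic_inc_eval_span] v this r C R]
  show ?thesis
    by simp
qed

text \<open>The way back from the tilted law: the density is bounded on \<open>A\<close>, so mass
  under the tilt bounds the original mass from below.\<close>

lemma tilted_measure_le:
  assumes "prob_space M" and a: "a \<in> eval_span" and A: "A \<in> sets M" and t: "\<And>\<omega>. \<omega> \<in> A \<Longrightarrow> a (Z \<omega>) \<le> t"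
  shows "measure (tilted a) A \<le> exp (t - cov M Z a a / 2) * measure M A"
proof -
  interpret prob_space M by fact
  interpret Q: prob_space "tilted a"
    by (rule prob_space_tilted[OF a])
  have [measurable]: "(\<lambda>\<omega>. blinfun_apply a (Z \<omega>)) \<in> borel_measurable M"
    by (rule sq_int_measurable[OF gaussian_mapD(2)[OF Z a]])
  have "emeasure (tilted a) A = (\<integral>\<^sup>+\<omega>. ennreal (exp (a (Z \<omega>) - cov M Z a a / 2)) * indicator A \<omega> \<partial>M)"
    unfolding tilted_def using A by (intro emeasure_density) auto
  also have "\<dots> \<le> (\<integral>\<^sup>+\<omega>. ennreal (exp (t - cov M Z a a / 2)) * indicator A \<omega> \<partial>M)"
    using t by (intro nn_integral_mono) (auto split: split_indicator intro!: ennreal_leI)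
  also have "\<dots> = ennreal (exp (t - cov M Z a a / 2)) * emeasure M A"
    using A by (intro nn_integral_cmult_indicator)
  finally have "ennreal (measure (tilted a) A) \<le> ennreal (exp (t - cov M Z a a / 2) * measure M A)"
    by (simp add: Q.emeasure_eq_measure emeasure_eq_measure ennreal_mult)
  then show ?thesis
    by (subst (asm) ennreal_le_iff) auto
qed

text \<open>Markov's inequality for \<open>exp (a (Z \<omega>) / h)\<close>. With \<open>h\<close>
  the inverse speed and variances of order \<open>h\<close>, both terms of the exponent are of order
  \<open>1 / h\<close>.\<close>

lemma gaussian_half_space:
  assumes "prob_space M" and a: "a \<in> eval_span" and h: "0 < h"
  shows "measure M {\<omega>\<in>space M. t \<le> a (Z \<omega>)} \<le> exp (cov M Z a a / (2 * h\<^sup>2) - t / h)"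
proof -
  interpret prob_space M by fact
  have mgf: "has_bochner_integral M (\<lambda>\<omega>. exp (a (Z \<omega>) / h)) (exp (cov M Z a a / (2 * h\<^sup>2)))"
    using gaussian_mapD(3)[OF Z eval_span_closed(4)[OF a, of "1 / h"]] h
    by (simp add: blinfun.scaleR_left cov_scale_left cov_scale_right power2_eq_square mult.commute)
  have "{\<omega>\<in>space M. t \<le> a (Z \<omega>)} = {\<omega>\<in>space M. exp (t / h) \<le> exp (a (Z \<omega>) / h)}"
    using h by (simp add: divide_le_cancel)
  also have "measure M \<dots> \<le> exp (cov M Z a a / (2 * h\<^sup>2)) / exp (t / h)"
    using mgf integral_Markov_inequality_measure[of M "\<lambda>\<omega>. exp (a (Z \<omega>) / h)" "{}" "exp (t / h)"]
    by (simp add: has_bochner_integral_iff)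
  finally show ?thesis
    by (simp add: exp_diff)
qed

end

section \<open>Large deviations for Gaussian families\<close>

text \<open>The Legendre transform of the logarithmic generating function
  \<open>cov M Y a a / 2\<close>, tested on discrete functionals. As a supremum of continuous
  functions it is lower semicontinuous.\<close>

definition legendre :: "'a measure \<Rightarrow> ('a \<Rightarrow> C01) \<Rightarrow> C01 \<Rightarrow> ereal" where
  "legendre M Y f = (SUP a\<in>eval_span. ereal (blinfun_apply a f - cov M Y a a / 2))"

lemma legendre_upper: "a \<in> eval_span \<Longrightarrow> ereal (a f - cov M Y a a / 2) \<le> legendre M Y f"
  unfolding legendre_def by (rule SUP_upper)

lemma legendre_nonneg: "0 \<le> legendre M Y f"
  using legendre_upper[OF eval_span_closed(1), of f M Y] by (simp add: cov_def zero_ereal_def)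

text \<open>The supremum is tested on all multiples \<open>s *\<^sub>R b\<close> and optimized in
  \<open>s\<close>.\<close>

lemma legendre_bound:
  assumes le: "legendre M Y f \<le> ereal t" and Y: "gaussian_map M Y" and b: "b \<in> eval_span"
  shows "(b f)\<^sup>2 \<le> 2 * t * cov M Y b b"
proof -
  define q where "q = cov M Y b b"
  have *: "s * b f - s\<^sup>2 * q / 2 \<le> t" for s
    using order_trans[OF legendre_upper[OF eval_span_closed(4)[OF b, of s], of f M Y] le]
    by (simp add: blinfun.scaleR_left cov_scale_left[OF Y] cov_scale_right[OF Y] power2_eq_square mult.assoc q_def)
  have "0 \<le> q"
    by (simp add: q_def cov_nonneg)
  show ?thesis
  proof (cases "q = 0")
    case True
    have "b f = 0"
    proof (rule ccontr)
      assume "b f \<noteq> 0"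
      \<comment> \<open>With zero variance the tested quantity is linear in \<open>s\<close>; this
        multiple gives it the value \<open>t + 1\<close>.\<close>
      then show False
        using *[of "(t + 1) / b f"] True by simp
    qed
    then show ?thesis
      using True by (simp add: q_def)
  next
    case False
    then have "0 < q"
      using \<open>0 \<le> q\<close> by simp
    have "(b f)\<^sup>2 / (2 * q) = b f / q * b f - (b f / q)\<^sup>2 * q / 2"
      using \<open>0 < q\<close> by (simp add: field_simps power2_eq_square)
    also have "\<dots> \<le> t"
      by (rule *)
    finally show ?thesis
      using \<open>0 < q\<close> by (simp add: q_def[symmetric] field_simps)
  qed
qed

lemma open_legendre: "open {f. t < legendre M Y f}"
proof -
  have "{f. t < legendre M Y f} = (\<Union>a\<in>eval_span. {f. t < ereal (blinfun_apply a f - cov M Y a a / 2)})"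
    by (auto simp: legendre_def less_SUP_iff)
  also have "open \<dots>"
    by (intro open_UN ballI open_Collect_less continuous_on_const continuous_on_ereal continuous_intros)
  finally show ?thesis .
qed

text \<open>By \<open>legendre_bound\<close> a finite rate controls each dyadic increment by its
  standard deviation, so every level set lies in one of the compact sets.\<close>

lemma rate_function_legendre:
  assumes Y: "gaussian_map M Y" and zero: "cov M Y (evl (to_unit 0)) (evl (to_unit 0)) = 0"
    and v: "\<And>n k. k < 2 ^ n \<Longrightarrow> cov M Y (dyadic_inc n k) (dyadic_inc n k) \<le> C * r ^ (4 * n)"
    and r: "0 < r" "r < 1" and C: "0 < C"
  shows "rate_function (legendre M Y)"
  unfolding rate_function_def
proof (intro conjI allI)
  fix t :: real
  define R where "R = sqrt (2 * t * C)"
  have sub: "{f. legendre M Y f \<le> ereal t} \<subseteq> hoelder_set r R"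
  proof
    fix f assume "f \<in> {f. legendre M Y f \<le> ereal t}"
    then have f: "legendre M Y f \<le> ereal t"
      by simp
    have t: "0 \<le> t"
      using order_trans[OF legendre_nonneg f] by (simp add: zero_ereal_def)
    have "evl (to_unit 0) f = 0"
      using legendre_bound[OF f Y evl_in_eval_span[of "to_unit 0"]] zero by simp
    moreover have "\<bar>dyadic_inc n k f\<bar> \<le> R * r ^ n" if k: "k < 2 ^ n" for n k
    proof -
      have "(dyadic_inc n k f)\<^sup>2 \<le> 2 * t * cov M Y (dyadic_inc n k) (dyadic_inc n k)"
        by (rule legendre_bound[OF f Y dyadic_inc_eval_span])
      also have "\<dots> \<le> 2 * t * (C * r ^ (4 * n))"
        using t by (intro mult_left_mono v k) auto
      also have "\<dots> \<le> 2 * t * (C * (r ^ n)\<^sup>2)"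
        using t C r by (intro mult_left_mono) (auto simp: power_mult[symmetric] intro!: power_decreasing)
      also have "\<dots> = (R * r ^ n)\<^sup>2"
        using t C by (simp add: R_def power_mult_distrib)
      finally have "\<bar>dyadic_inc n k f\<bar> \<le> \<bar>R * r ^ n\<bar>"
        by (simp add: abs_le_square_iff)
      also have "\<dots> = R * r ^ n"
        using t C r by (simp add: R_def)
      finally show ?thesis .
    qed
    ultimately show "f \<in> hoelder_set r R"
      by (simp add: hoelder_set_dyadic_inc)
  qed
  show "compact {f. legendre M Y f \<le> ereal t}"
  \<comment> \<open>For negative \<open>t\<close> the level set is empty, and compactness of
    \<open>hoelder_set r R\<close> needs a nonnegative radius.\<close>
  proof (cases "0 \<le> t")
    case True
    have "closed {f. legendre M Y f \<le> ereal t}"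
      using open_legendre[of "ereal t" M Y] by (simp add: closed_def Compl_eq not_le)
    moreover have "compact (hoelder_set r R)"
      using True C by (intro compact_hoelder_set r) (simp add: R_def)
    ultimately have "compact ({f. legendre M Y f \<le> ereal t} \<inter> hoelder_set r R)"
      by (rule closed_Int_compact)
    also have "{f. legendre M Y f \<le> ereal t} \<inter> hoelder_set r R = {f. legendre M Y f \<le> ereal t}"
      using sub by blast
    finally show ?thesis .
  next
    case False
    then have "\<not> legendre M Y f \<le> ereal t" for f
      using order_trans[OF legendre_nonneg, of M Y f "ereal t"] by (auto simp: zero_ereal_def)
    then show ?thesis by simp
  qed
qed (simp_all add: legendre_nonneg open_legendre)

text \<open>\<open>N\<close> gathers the constants in front of the exponential. After multiplication
  by \<open>h\<close> they contribute \<open>h * ln N\<close>, which vanishes as \<open>h\<close>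
  tends to 0.\<close>

lemma elog_upper:
  assumes "0 < h" "0 \<le> p" "p \<le> N * exp (- m / h)" "0 < N"
  shows "ereal h * elog p \<le> ereal (h * ln N - m)"
proof (cases "p = 0")
  case True
  then show ?thesis
    using assms by (simp add: elog_def)
next
  case False
  then have "ln p \<le> ln (N * exp (- m / h))"
    using assms by (intro ln_mono) auto
  also have "\<dots> = ln N - m / h"
    using assms by (simp add: ln_mult)
  finally have "h * ln p \<le> h * (ln N - m / h)"
    using assms by (intro mult_left_mono) auto
  then show ?thesis
    using False assms by (simp add: elog_def algebra_simps)
qed

lemma elog_lower:
  assumes "0 < h" "N * exp (- m / h) \<le> p" "0 < N"
  shows "ereal (h * ln N - m) \<le> ereal h * elog p"
proof -
  have p: "0 < p"
    using assms(2,3) by (metis exp_gt_zero less_le_trans mult_pos_pos)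
  have "ln N - m / h = ln (N * exp (- m / h))"
    using assms by (simp add: ln_mult)
  also have "\<dots> \<le> ln p"
    using assms p by (intro ln_mono) auto
  finally have "h * (ln N - m / h) \<le> h * ln p"
    using assms by (intro mult_left_mono) auto
  then show ?thesis
    using p assms by (simp add: elog_def algebra_simps)
qed

text \<open>The interface between kernels and large deviations: convergence of normalized
  covariances and a variance bound for each level, uniform in \<open>e\<close>. The conditions on
  \<open>X\<close> hold for small \<open>e\<close>, as the kernel estimates do.\<close>

locale gaussian_family = prob_space M
  for M :: "'a measure" and X :: "real \<Rightarrow> 'a \<Rightarrow> C01" and Y :: "'a \<Rightarrow> C01" and H :: "real \<Rightarrow> real" and r C :: real +
  assumes r: "0 < r" "r < 1" and C: "0 < C"
    and H_pos: "\<forall>\<^sub>F e in at_right 0. 0 < H e" and H_lim: "(H \<longlongrightarrow> 0) (at_right 0)"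
    and X: "\<forall>\<^sub>F e in at_right 0. gaussian_map M (X e)"
    and X_zero: "\<forall>\<^sub>F e in at_right 0. cov M (X e) (evl (to_unit 0)) (evl (to_unit 0)) = 0"
    and X_inc: "\<forall>\<^sub>F e in at_right 0. \<forall>n. \<forall>k<2 ^ n. cov M (X e) (dyadic_inc n k) (dyadic_inc n k) \<le> H e * C * r ^ (4 * n)"
    and Y: "gaussian_map M Y"
    and conv: "\<And>a b. a \<in> eval_span \<Longrightarrow> b \<in> eval_span \<Longrightarrow>
      ((\<lambda>e. cov M (X e) a b / H e) \<longlongrightarrow> cov M Y a b) (at_right 0)"
begin

lemma Y_zero: "cov M Y (evl (to_unit 0)) (evl (to_unit 0)) = 0"
proof (rule tendsto_unique[OF _ conv])
  show "((\<lambda>e. cov M (X e) (evl (to_unit 0)) (evl (to_unit 0)) / H e) \<longlongrightarrow> 0) (at_right 0)"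
    by (rule tendsto_eventually) (use X_zero in eventually_elim, simp)
qed (simp_all add: trivial_limit_at_right_real)

text \<open>The uniform bound passes to the limit covariance, so the tail estimates of the family
  also hold for \<open>Y\<close>.\<close>

lemma Y_inc:
  assumes "k < 2 ^ n"
  shows "cov M Y (dyadic_inc n k) (dyadic_inc n k) \<le> C * r ^ (4 * n)"
proof (rule tendsto_upperbound[OF conv])
  show "\<forall>\<^sub>F e in at_right 0. cov M (X e) (dyadic_inc n k) (dyadic_inc n k) / H e \<le> C * r ^ (4 * n)"
    using X_inc H_pos by eventually_elim (use assms in \<open>simp add: divide_le_eq ac_simps\<close>)
qed (simp_all add: trivial_limit_at_right_real)

lemma exp_div_H_tendsto: "0 < c \<Longrightarrow> ((\<lambda>e. exp (- (c / H e))) \<longlongrightarrow> 0) (at_right 0)"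
proof -
  assume c: "0 < c"
  have "LIM e at_right 0. inverse (H e) :> at_top"
    using H_lim H_pos by (rule filterlim_inverse_at_top)
  then have "LIM e at_right 0. c / H e :> at_top"
    using c by (simp add: divide_inverse filterlim_tendsto_pos_mult_at_top[OF tendsto_const])
  then show ?thesis
    by (intro filterlim_compose[OF exp_at_bot] filterlim_compose[OF filterlim_uminus_at_bot_at_top])
qed

lemma eventually_const_le_div_H: "\<forall>\<^sub>F e in at_right 0. K \<le> 1 / H e"
proof -
  have "LIM e at_right 0. inverse (H e) :> at_top"
    using H_lim H_pos by (rule filterlim_inverse_at_top)
  then show ?thesis
    unfolding filterlim_at_top by (simp add: divide_inverse)
qed

text \<open>Covariances of \<open>X e\<close> are about \<open>H e\<close> times those of
  \<open>Y\<close>. Tilting along \<open>a\<close> divided by \<open>H e\<close> therefore gives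
  \<open>b (X e \<omega>)\<close> a mean close to \<open>cov M Y a b\<close>, while its variance
  remains of order \<open>H e\<close>.\<close>

abbreviation "tilt e a \<equiv> tilted M (X e) ((1 / H e) *\<^sub>R a)"

text \<open>For \<open>a = 0\<close> this is exponential tightness. In general the tilting
  functional has variance of order \<open>1 / H e\<close> and the increments have variance of order
  \<open>H e\<close>; the mean shift stays bounded, and one radius serves all small
  \<open>e\<close>.\<close>

lemma tilt_tail:
  assumes a: "a \<in> eval_span" and R: "0 < R" "4 * (cov M Y a a + 1) * C \<le> R\<^sup>2"
  shows "\<forall>\<^sub>F e in at_right 0. measure (tilt e a) {\<omega>\<in>space M. X e \<omega> \<notin> hoelder_set r R}
     \<le> tail_const r * exp (- (R\<^sup>2 / (16 * C) / H e))"
proof -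
  have "\<forall>\<^sub>F e in at_right 0. cov M (X e) a a / H e < cov M Y a a + 1"
    by (rule order_tendstoD[OF conv[OF a a]]) simp
  then show ?thesis
    \<comment> \<open>The last fact amounts to \<open>8 * (H e * C) \<le> R\<^sup>2\<close>.\<close>
    using X X_zero X_inc H_pos eventually_const_le_div_H[of "8 * C / R\<^sup>2"]
  proof eventually_elim
    case (elim e)
    note X = elim(2)
    have H: "0 < H e"
      by (rule elim)
    have "cov M (X e) ((1 / H e) *\<^sub>R a) ((1 / H e) *\<^sub>R a) * (H e * C) = cov M (X e) a a / H e * C"
      using H by (simp add: cov_scale_left[OF X] cov_scale_right[OF X])
    also have "\<dots> \<le> (cov M Y a a + 1) * C"
      using elim(1) C by (intro mult_right_mono) auto
    finally have *: "cov M (X e) ((1 / H e) *\<^sub>R a) ((1 / H e) *\<^sub>R a) * (H e * C) \<le> (cov M Y a a + 1) * C" .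
    have m: "4 * cov M (X e) ((1 / H e) *\<^sub>R a) ((1 / H e) *\<^sub>R a) * (H e * C) \<le> R\<^sup>2"
    proof -
      have "4 * cov M (X e) ((1 / H e) *\<^sub>R a) ((1 / H e) *\<^sub>R a) * (H e * C)
          = 4 * (cov M (X e) ((1 / H e) *\<^sub>R a) ((1 / H e) *\<^sub>R a) * (H e * C))"
        by (rule mult.assoc)
      also have "\<dots> \<le> 4 * ((cov M Y a a + 1) * C)"
        using * by simp
      also have "\<dots> = 4 * (cov M Y a a + 1) * C"
        by (rule mult.assoc[symmetric])
      finally show ?thesis
        using R(2) by (rule order_trans)
    qed
    have "8 * (H e * C) \<le> R\<^sup>2"
      using elim(6) H R by (simp add: field_simps)
    from tilted_hoelder_set_tail[OF X eval_span_closed(4)[OF a] elim(3) _ m r _ R(1) this]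
    have "measure (tilt e a) {\<omega>\<in>space M. X e \<omega> \<notin> hoelder_set r R}
       \<le> tail_const r * exp (- (R\<^sup>2 / (16 * (H e * C))))"
      using elim(4) H C by simp
    then show ?case
      by (simp add: ac_simps)
  qed
qed

text \<open>Both sides may be infinite, so the argument is by contradiction, with real numbers
  strictly between them.\<close>

lemma large_deviations_upper:
  assumes F: "closed F"
  shows "Limsup (at_right 0) (\<lambda>e. ereal (H e) * elog (measure M {\<omega>\<in>space M. X e \<omega> \<in> F})) \<le> - (INF f\<in>F. legendre M Y f)"
    (is "?L \<le> - ?I")
proof (rule ccontr)
  assume "\<not> ?L \<le> - ?I"
  then have "- ?L < ?I"
    by (simp add: not_le ereal_uminus_less_reorder)
  then obtain m where m: "- ?L < ereal m" "ereal m < ?I"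
    using ereal_dense2 by blast
  \<comment> \<open>The gap between \<open>m\<close> and \<open>m'\<close> absorbs the difference
    between the normalized covariances of \<open>X e\<close> and their limit.\<close>
  obtain m' where m': "ereal m < ereal m'" "ereal m' < ?I"
    using m(2) ereal_dense2 by blast
  then have mm: "m < m'"
    by simp
  \<comment> \<open>The first term makes the mass outside the compact set at most of order
    \<open>exp (- m / H e)\<close>; the second is what \<open>tilt_tail\<close> asks for at
    \<open>a = 0\<close>.\<close>
  define R where "R = sqrt (max (16 * C * (\<bar>m\<bar> + 1)) (4 * C))"
  have R: "0 < R" "16 * C * (\<bar>m\<bar> + 1) \<le> R\<^sup>2" "4 * C \<le> R\<^sup>2"
    using C by (auto simp: R_def)
  define U where "U a = {f. m' < a f - cov M Y a a / 2}" for a :: "C01 \<Rightarrow>\<^sub>L real"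
  have "compact (F \<inter> hoelder_set r R)"
    using F R by (intro closed_Int_compact compact_hoelder_set r) auto
  moreover have "open (U a)" for a
    unfolding U_def by (intro open_Collect_less continuous_intros)
  moreover have "F \<inter> hoelder_set r R \<subseteq> (\<Union>a\<in>eval_span. U a)"
  proof
    fix f assume "f \<in> F \<inter> hoelder_set r R"
    then have "ereal m' < legendre M Y f"
      using less_INF_D[OF m'(2)] by blast
    then show "f \<in> (\<Union>a\<in>eval_span. U a)"
      by (auto simp: legendre_def less_SUP_iff U_def)
  qed
  ultimately obtain T where T: "T \<subseteq> eval_span" "finite T" "F \<inter> hoelder_set r R \<subseteq> (\<Union>a\<in>T. U a)"
    by (rule compactE_image)
  define N where "N = real (card T) + tail_const r + 1"
  have N: "0 < N"
    using tail_const_nonneg[OF r] by (simp add: N_def)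
  have half: "\<forall>\<^sub>F e in at_right 0. measure M {\<omega>\<in>space M. m' + cov M Y a a / 2 \<le> a (X e \<omega>)} \<le> exp (- m / H e)"
    if a: "a \<in> T" for a
  proof -
    have aS: "a \<in> eval_span"
      using a T by auto
    have "\<forall>\<^sub>F e in at_right 0. cov M (X e) a a / H e < cov M Y a a + 2 * (m' - m)"
      using mm by (intro order_tendstoD[OF conv[OF aS aS]]) simp
    then show ?thesis
      using X H_pos
    proof eventually_elim
      case (elim e)
      have "measure M {\<omega>\<in>space M. m' + cov M Y a a / 2 \<le> a (X e \<omega>)}
         \<le> exp (cov M (X e) a a / (2 * (H e)\<^sup>2) - (m' + cov M Y a a / 2) / H e)"
        by (rule gaussian_half_space[OF elim(2) prob_space_axioms aS elim(3)])
      also have "cov M (X e) a a / (2 * (H e)\<^sup>2) - (m' + cov M Y a a / 2) / H e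
         = (cov M (X e) a a / H e / 2 - m' - cov M Y a a / 2) / H e"
        using elim(3) by (simp add: field_simps power2_eq_square)
      also have "\<dots> \<le> - m / H e"
        using elim by (intro divide_right_mono) auto
      finally show ?case by simp
    qed
  qed
  have "\<forall>\<^sub>F e in at_right 0. \<forall>a\<in>T. measure M {\<omega>\<in>space M. m' + cov M Y a a / 2 \<le> a (X e \<omega>)} \<le> exp (- m / H e)"
    using T(2) half by (intro eventually_ball_finite) auto
  moreover have "\<forall>\<^sub>F e in at_right 0. measure (tilt e 0) {\<omega>\<in>space M. X e \<omega> \<notin> hoelder_set r R}
     \<le> tail_const r * exp (- (R\<^sup>2 / (16 * C) / H e))"
    using R by (intro tilt_tail) (auto simp: cov_def)
  ultimately have bound: "\<forall>\<^sub>F e in at_right 0. measure M {\<omega>\<in>space M. X e \<omega> \<in> F} \<le> N * exp (- m / H e)"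
    using X H_pos
  proof eventually_elim
    case (elim e)
    have H: "0 < H e"
      by (rule elim)
    have Xm[measurable]: "X e \<in> borel_measurable M"
      by (rule gaussian_mapD(1)[OF elim(3)])
    have Xa[measurable]: "(\<lambda>\<omega>. blinfun_apply a (X e \<omega>)) \<in> borel_measurable M" for a :: "C01 \<Rightarrow>\<^sub>L real"
      using Xm by (intro borel_measurable_continuous_on[of "blinfun_apply a"] continuous_intros)
    define D where "D a = {\<omega>\<in>space M. m' + cov M Y a a / 2 \<le> a (X e \<omega>)}" for a :: "C01 \<Rightarrow>\<^sub>L real"
    define W where "W = {\<omega>\<in>space M. X e \<omega> \<notin> hoelder_set r R}"
    have D: "D a \<in> sets M" for a
      unfolding D_def by measurable
    have W: "W \<in> sets M"
    proof -
      have [measurable]: "hoelder_set r R \<in> sets borel"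
        using closed_hoelder_set[of r R] by simp
      show ?thesis
        unfolding W_def by measurable
    qed
    have "measure M {\<omega>\<in>space M. X e \<omega> \<in> F} \<le> measure M (W \<union> (\<Union>a\<in>T. D a))"
    proof (rule finite_measure_mono)
      show "{\<omega>\<in>space M. X e \<omega> \<in> F} \<subseteq> W \<union> (\<Union>a\<in>T. D a)"
      proof
        fix \<omega> assume \<omega>: "\<omega> \<in> {\<omega>\<in>space M. X e \<omega> \<in> F}"
        show "\<omega> \<in> W \<union> (\<Union>a\<in>T. D a)"
        proof (cases "X e \<omega> \<in> hoelder_set r R")
          case True
          then obtain a where "a \<in> T" "X e \<omega> \<in> U a"
            using T(3) \<omega> by blast
          then have "\<omega> \<in> D a"
            using \<omega> by (simp add: U_def D_def)
          then show ?thesis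
            using \<open>a \<in> T\<close> by blast
        next
          case False
          then show ?thesis
            using \<omega> by (simp add: W_def)
        qed
      qed
    qed (use D W T(2) in auto)
    also have "\<dots> \<le> measure M W + measure M (\<Union>a\<in>T. D a)"
      using D W T(2) by (intro measure_Un_le) auto
    also have "measure M (\<Union>a\<in>T. D a) \<le> (\<Sum>a\<in>T. measure M (D a))"
      using D T(2) by (intro finite_measure_subadditive_finite) auto
    also have "\<dots> \<le> (\<Sum>a\<in>T. exp (- m / H e))"
      unfolding D_def using elim(1) by (intro sum_mono) auto
    also have "measure M W \<le> tail_const r * exp (- (R\<^sup>2 / (16 * C) / H e))"
      using elim(2) by (simp add: W_def tilted_zero[OF elim(3)])
    also have "\<dots> \<le> tail_const r * exp (- m / H e)"
    proof -
      have "\<bar>m\<bar> + 1 \<le> R\<^sup>2 / (16 * C)"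
        using R(2) C by (simp add: pos_le_divide_eq mult.commute)
      then have "m \<le> R\<^sup>2 / (16 * C)"
        by linarith
      then have "m / H e \<le> R\<^sup>2 / (16 * C) / H e"
        using H by (intro divide_right_mono) auto
      then show ?thesis
        using tail_const_nonneg[OF r] by (intro mult_left_mono) auto
    qed
    finally have "measure M {\<omega>\<in>space M. X e \<omega> \<in> F} \<le> (tail_const r + real (card T)) * exp (- m / H e)"
      by (simp add: distrib_right)
    also have "\<dots> \<le> N * exp (- m / H e)"
      by (intro mult_right_mono) (auto simp: N_def)
    finally show ?case .
  qed
  \<comment> \<open>This leaves room for the vanishing term \<open>H e * ln N\<close>.\<close>
  obtain \<delta> where \<delta>: "0 < \<delta>" "ereal (\<delta> - m) < ?L"
  proof -
    have "ereal (- m) < ?L"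
      using m(1) by (simp add: ereal_uminus_less_reorder)
    then obtain z where "ereal (- m) < ereal z" "ereal z < ?L"
      using ereal_dense2 by blast
    then show ?thesis
      using that[of "z + m"] by simp
  qed
  have "((\<lambda>e. H e * ln N) \<longlongrightarrow> 0 * ln N) (at_right 0)"
    by (intro tendsto_intros H_lim)
  then have "\<forall>\<^sub>F e in at_right 0. H e * ln N < \<delta>"
    using \<delta> by (intro order_tendstoD) auto
  with bound have "\<forall>\<^sub>F e in at_right 0. ereal (H e) * elog (measure M {\<omega>\<in>space M. X e \<omega> \<in> F}) \<le> ereal (\<delta> - m)"
    using H_pos
  proof (eventually_elim)
    case (elim e)
    have "ereal (H e) * elog (measure M {\<omega>\<in>space M. X e \<omega> \<in> F}) \<le> ereal (H e * ln N - m)"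
      using elim N by (intro elog_upper) auto
    also have "\<dots> \<le> ereal (\<delta> - m)"
      using elim by simp
    finally show ?case .
  qed
  then have "?L \<le> ereal (\<delta> - m)"
    by (rule Limsup_bounded)
  then show False
    using \<delta>(2) by simp
qed


text \<open>Half of \<open>x\<close> pays for the difference between the mean at \<open>e\<close>
  and its limit, the other half for the fluctuation.\<close>

lemma tilt_point_tail:
  assumes a: "a \<in> eval_span" and b: "b \<in> eval_span" and x: "0 < x"
  shows "\<forall>\<^sub>F e in at_right 0. measure (tilt e a) {\<omega>\<in>space M. x < \<bar>b (X e \<omega>) - cov M Y a b\<bar>}
     \<le> 2 * exp (- ((x / 2)\<^sup>2 / (2 * (cov M Y b b + 1)) / H e))"
proof -
  have "\<forall>\<^sub>F e in at_right 0. cov M (X e) b b / H e < cov M Y b b + 1"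
    by (rule order_tendstoD[OF conv[OF b b]]) simp
  moreover have "\<forall>\<^sub>F e in at_right 0. dist (cov M (X e) a b / H e) (cov M Y a b) < x / 2"
    using x by (intro tendstoD[OF conv[OF a b]]) simp
  ultimately show ?thesis
    using X H_pos
  proof eventually_elim
    case (elim e)
    note X = elim(3)
    have H: "0 < H e"
      by (rule elim)
    have aH: "(1 / H e) *\<^sub>R a \<in> eval_span"
      by (intro eval_span_closed a)
    interpret Q: prob_space "tilt e a"
      by (rule prob_space_tilted[OF X aH])
    have mean: "cov M (X e) ((1 / H e) *\<^sub>R a) b = cov M (X e) a b / H e"
      by (simp add: cov_scale_left[OF X])
    have v: "cov M (X e) b b \<le> H e * (cov M Y b b + 1)"
      using elim(1) H by (simp add: divide_less_eq mult.commute)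
    have bm: "(\<lambda>\<omega>. b (X e \<omega>)) \<in> borel_measurable (tilt e a)"
      using sq_int_measurable[OF gaussian_mapD(2)[OF X b]] by (simp add: tilted_def[OF X])
    have "measure (tilt e a) {\<omega>\<in>space M. x < \<bar>b (X e \<omega>) - cov M Y a b\<bar>}
       \<le> measure (tilt e a) {\<omega>\<in>space (tilt e a). x / 2 \<le> \<bar>b (X e \<omega>) - cov M (X e) ((1 / H e) *\<^sub>R a) b\<bar>}"
    proof (rule Q.finite_measure_mono)
      show "{\<omega>\<in>space M. x < \<bar>b (X e \<omega>) - cov M Y a b\<bar>}
        \<subseteq> {\<omega>\<in>space (tilt e a). x / 2 \<le> \<bar>b (X e \<omega>) - cov M (X e) ((1 / H e) *\<^sub>R a) b\<bar>}"
      proof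
        fix \<omega> assume \<omega>: "\<omega> \<in> {\<omega>\<in>space M. x < \<bar>b (X e \<omega>) - cov M Y a b\<bar>}"
        then have "x < \<bar>b (X e \<omega>) - cov M Y a b\<bar>"
          by simp
        then have "x / 2 \<le> \<bar>b (X e \<omega>) - cov M (X e) ((1 / H e) *\<^sub>R a) b\<bar>"
          using elim(2) unfolding mean dist_real_def by linarith
        then show "\<omega> \<in> {\<omega>\<in>space (tilt e a). x / 2 \<le> \<bar>b (X e \<omega>) - cov M (X e) ((1 / H e) *\<^sub>R a) b\<bar>}"
          using \<omega> by (simp add: sets_tilted[OF X])
      qed
      show "{\<omega>\<in>space (tilt e a). x / 2 \<le> \<bar>b (X e \<omega>) - cov M (X e) ((1 / H e) *\<^sub>R a) b\<bar>} \<in> sets (tilt e a)"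
        using bm by measurable
    qed
    also have "\<dots> \<le> 2 * exp (- ((x / 2)\<^sup>2 / (2 * (H e * (cov M Y b b + 1)))))"
      using H x cov_nonneg[of M Y b] by (intro Q.chernoff_bound[OF tilted_mgf[OF X aH b] v]) (auto intro!: mult_pos_pos)
    finally show ?case
      by (simp add: ac_simps)
  qed
qed

text \<open>Under the tilt the mean of every discrete functional tends to its value at
  \<open>f\<close>. Compactness upgrades this to concentration: inside the Hoelder set but outside
  \<open>G'\<close>, finitely many evaluations detect the difference from \<open>f\<close>.\<close>

lemma large_deviations_lower:
  assumes a: "a \<in> eval_span" and f: "\<And>b. b \<in> eval_span \<Longrightarrow> b f = cov M Y a b"
    and G: "open G" "f \<in> G" and \<delta>: "0 < \<delta>"
  shows "ereal (- (cov M Y a a / 2) - \<delta>) \<le> Liminf (at_right 0) (\<lambda>e. ereal (H e) * elog (measure M {\<omega>\<in>space M. X e \<omega> \<in> G}))"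
proof -
  define q where "q = cov M Y a a"
  \<comment> \<open>The extra half space bounds the tilting density from above;
    \<open>\<delta> / 2\<close> is its price in the exponent.\<close>
  define G' where "G' = G \<inter> {g. a g < q + \<delta> / 2}"
  have af: "a f = q"
    using f[OF a] by (simp add: q_def)
  have G': "open G'" "f \<in> G'"
    unfolding G'_def using G \<delta> af by (auto intro!: open_Int open_Collect_less continuous_intros)
  define R where "R = sqrt (4 * (q + 1) * C)"
  have q0: "0 \<le> q"
    by (simp add: q_def cov_nonneg)
  have R: "0 < R" "4 * (cov M Y a a + 1) * C \<le> R\<^sup>2"
    using C q0 by (auto simp: R_def q_def[symmetric])
  \<comment> \<open>Since functions are separated by evaluations, these open sets with
    \<open>x > 0\<close> cover everything except \<open>f\<close> itself.\<close>
  define U where "U = (\<lambda>(t, x). {g :: C01. x < \<bar>evl t g - evl t f\<bar>})"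
  have "compact (- G' \<inter> hoelder_set r R)"
    using G' R by (intro closed_Int_compact compact_hoelder_set r) auto
  moreover have "open (U p)" if "p \<in> UNIV \<times> {0<..}" for p
    unfolding U_def by (cases p) (auto intro!: open_Collect_less continuous_intros simp del: evl_apply)
  moreover have "- G' \<inter> hoelder_set r R \<subseteq> (\<Union>p\<in>UNIV \<times> {0<..}. U p)"
  proof
    fix g assume "g \<in> - G' \<inter> hoelder_set r R"
    then have "g \<noteq> f"
      using G' by auto
    then obtain t where t: "apply_bcontfun g t \<noteq> apply_bcontfun f t"
      by (metis apply_bcontfun_inject ext)
    define x where "x = \<bar>apply_bcontfun g t - apply_bcontfun f t\<bar> / 2"
    have "0 < x" "x < \<bar>apply_bcontfun g t - apply_bcontfun f t\<bar>"
      using t by (auto simp: x_def)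
    then have "(t, x) \<in> UNIV \<times> {0<..}" "g \<in> U (t, x)"
      by (auto simp: U_def)
    then show "g \<in> (\<Union>p\<in>UNIV \<times> {0<..}. U p)"
      by blast
  qed
  ultimately obtain T where T: "T \<subseteq> UNIV \<times> {0<..}" "finite T" "- G' \<inter> hoelder_set r R \<subseteq> (\<Union>p\<in>T. U p)"
    by (rule compactE_image)
  define \<psi> where "\<psi> p e = 2 * exp (- ((snd p / 2)\<^sup>2 / (2 * (cov M Y (evl (fst p)) (evl (fst p)) + 1)) / H e))" for p e
  define \<phi> where "\<phi> e = tail_const r * exp (- (R\<^sup>2 / (16 * C) / H e)) + (\<Sum>p\<in>T. \<psi> p e)" for e
  have "(\<phi> \<longlongrightarrow> tail_const r * 0 + (\<Sum>p\<in>T. 2 * 0)) (at_right 0)"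
    unfolding \<phi>_def[abs_def] \<psi>_def
  proof (intro tendsto_intros exp_div_H_tendsto)
    show "0 < (snd p / 2)\<^sup>2 / (2 * (cov M Y (evl (fst p)) (evl (fst p)) + 1))" if "p \<in> T" for p
      using T(1) that cov_nonneg[of M Y "evl (fst p)"] by (intro divide_pos_pos zero_less_power) auto
  qed (use R C in auto)
  then have "\<forall>\<^sub>F e in at_right 0. \<phi> e < 1 / 2"
    by (intro order_tendstoD) auto
  moreover have "\<forall>\<^sub>F e in at_right 0. \<forall>p\<in>T. measure (tilt e a) {\<omega>\<in>space M. X e \<omega> \<in> U p} \<le> \<psi> p e"
    using T(2)
  proof (rule eventually_ball_finite, safe)
    fix t x assume "(t, x) \<in> T"
    then have "0 < x"
      using T(1) by auto
    from tilt_point_tail[OF a evl_in_eval_span[of t] this]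
    show "\<forall>\<^sub>F e in at_right 0. measure (tilt e a) {\<omega>\<in>space M. X e \<omega> \<in> U (t, x)} \<le> \<psi> (t, x) e"
      unfolding U_def \<psi>_def f[OF evl_in_eval_span, symmetric] by (simp del: evl_apply)
  qed
  moreover note tilt_tail[OF a R]
  ultimately have half: "\<forall>\<^sub>F e in at_right 0. 1 / 2 \<le> measure (tilt e a) {\<omega>\<in>space M. X e \<omega> \<in> G'}"
    using X H_pos
  proof eventually_elim
    case (elim e)
    note X = elim(4)
    have aH: "(1 / H e) *\<^sub>R a \<in> eval_span"
      by (intro eval_span_closed a)
    interpret Q: prob_space "tilt e a"
      by (rule prob_space_tilted[OF X aH])
    have Xm: "X e \<in> borel_measurable (tilt e a)"
      using gaussian_mapD(1)[OF X] by (simp add: tilted_def[OF X])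
    have meas: "{\<omega>\<in>space M. X e \<omega> \<in> A} \<in> sets (tilt e a)" if "A \<in> sets borel" for A
      using measurable_sets[OF Xm that] by (simp add: vimage_def Int_def conj_commute sets_tilted[OF X])
    define W where "W = {\<omega>\<in>space M. X e \<omega> \<notin> hoelder_set r R}"
    have W: "W \<in> sets (tilt e a)"
      using meas[of "- hoelder_set r R"] closed_hoelder_set[of r R] by (simp add: W_def)
    have D: "{\<omega>\<in>space M. X e \<omega> \<in> U p} \<in> sets (tilt e a)" if "p \<in> T" for p
    proof (rule meas)
      have "open (U p)"
        unfolding U_def by (cases p) (auto intro!: open_Collect_less continuous_intros simp del: evl_apply)
      then show "U p \<in> sets borel"
        by simp
    qed
    have "measure (tilt e a) {\<omega>\<in>space M. X e \<omega> \<notin> G'}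
       \<le> measure (tilt e a) (W \<union> (\<Union>p\<in>T. {\<omega>\<in>space M. X e \<omega> \<in> U p}))"
    proof (rule Q.finite_measure_mono)
      show "{\<omega>\<in>space M. X e \<omega> \<notin> G'} \<subseteq> W \<union> (\<Union>p\<in>T. {\<omega>\<in>space M. X e \<omega> \<in> U p})"
        using T(3) by (auto simp: W_def)
    qed (intro sets.Un sets.finite_UN W T(2) D)
    also have "\<dots> \<le> measure (tilt e a) W + measure (tilt e a) (\<Union>p\<in>T. {\<omega>\<in>space M. X e \<omega> \<in> U p})"
      by (intro measure_Un_le sets.finite_UN W D T(2))
    also have "measure (tilt e a) (\<Union>p\<in>T. {\<omega>\<in>space M. X e \<omega> \<in> U p}) \<le> (\<Sum>p\<in>T. measure (tilt e a) {\<omega>\<in>space M. X e \<omega> \<in> U p})"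
      using D T(2) by (intro Q.finite_measure_subadditive_finite) auto
    also have "\<dots> \<le> (\<Sum>p\<in>T. \<psi> p e)"
      using elim(2) by (intro sum_mono) auto
    also have "measure (tilt e a) W \<le> tail_const r * exp (- (R\<^sup>2 / (16 * C) / H e))"
      using elim(3) by (simp add: W_def)
    finally have "measure (tilt e a) {\<omega>\<in>space M. X e \<omega> \<notin> G'} \<le> 1 / 2"
      using elim(1) by (simp add: \<phi>_def)
    moreover have "space (tilt e a) - {\<omega>\<in>space M. X e \<omega> \<in> G'} = {\<omega>\<in>space M. X e \<omega> \<notin> G'}"
      by (auto simp: sets_tilted[OF X])
    moreover have "{\<omega>\<in>space M. X e \<omega> \<in> G'} \<in> sets (tilt e a)"
      using G' by (intro meas) simp
    ultimately show ?case
      using Q.prob_compl[of "{\<omega>\<in>space M. X e \<omega> \<in> G'}"] by simp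
  qed
  \<comment> \<open>\<open>m e / H e\<close> is the exponent of the density bound on
    \<open>G'\<close>. As \<open>m e\<close> tends to \<open>q / 2 + \<delta> / 2\<close>, another
    \<open>\<delta> / 2\<close> is left for the factor 1/2.\<close>
  define m where "m e = q + \<delta> / 2 - cov M (X e) a a / H e / 2" for e
  have "((\<lambda>e. H e * ln (1 / 2) - m e) \<longlongrightarrow> 0 * ln (1 / 2) - (q + \<delta> / 2 - q / 2)) (at_right 0)"
    unfolding m_def using conv[OF a a] by (intro tendsto_intros H_lim) (auto simp: q_def)
  then have "\<forall>\<^sub>F e in at_right 0. - (q / 2) - \<delta> < H e * ln (1 / 2) - m e"
    using \<delta> by (intro order_tendstoD) (auto simp: field_simps)
  with half have "\<forall>\<^sub>F e in at_right 0. ereal (- (q / 2) - \<delta>) \<le> ereal (H e) * elog (measure M {\<omega>\<in>space M. X e \<omega> \<in> G})"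
    using X H_pos
  proof eventually_elim
    case (elim e)
    note X = elim(3)
    have H: "0 < H e"
      by (rule elim)
    have aH: "(1 / H e) *\<^sub>R a \<in> eval_span"
      by (intro eval_span_closed a)
    have meas: "{\<omega>\<in>space M. X e \<omega> \<in> A} \<in> sets M" if "A \<in> sets borel" for A
      using measurable_sets[OF gaussian_mapD(1)[OF X] that] by (simp add: vimage_def Int_def conj_commute)
    have m: "m e / H e = (q + \<delta> / 2) / H e - cov M (X e) ((1 / H e) *\<^sub>R a) ((1 / H e) *\<^sub>R a) / 2"
      using H by (simp add: m_def cov_scale_left[OF X] cov_scale_right[OF X] field_simps)
    have "1 / 2 \<le> measure (tilt e a) {\<omega>\<in>space M. X e \<omega> \<in> G'}"
      by (rule elim)
    also have "\<dots> \<le> exp (m e / H e) * measure M {\<omega>\<in>space M. X e \<omega> \<in> G'}"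
      unfolding m using G' H
      by (intro tilted_measure_le[OF X prob_space_axioms aH] meas)
        (auto simp: G'_def blinfun.scaleR_left intro!: divide_right_mono)
    also have "\<dots> \<le> exp (m e / H e) * measure M {\<omega>\<in>space M. X e \<omega> \<in> G}"
      using G by (intro mult_left_mono finite_measure_mono meas) (auto simp: G'_def)
    finally have "1 / 2 * exp (- m e / H e) \<le> measure M {\<omega>\<in>space M. X e \<omega> \<in> G}"
      by (simp add: exp_minus field_simps)
    then have "ereal (H e * ln (1 / 2) - m e) \<le> ereal (H e) * elog (measure M {\<omega>\<in>space M. X e \<omega> \<in> G})"
      using H by (intro elog_lower) auto
    moreover have "ereal (- (q / 2) - \<delta>) \<le> ereal (H e * ln (1 / 2) - m e)"
      using elim(2) by simp
    ultimately show ?case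
      by (rule order_trans[rotated])
  qed
  then show ?thesis
    unfolding q_def by (intro Liminf_bounded)
qed

text \<open>The lower bound is available at points represented by a discrete functional. Assumption
  \<open>approx\<close> says that such points come near every \<open>f\<close> of finite rate, at
  hardly larger rate.\<close>

theorem large_deviations_legendre:
  assumes approx: "\<And>f G \<delta>. legendre M Y f < \<infinity> \<Longrightarrow> open G \<Longrightarrow> f \<in> G \<Longrightarrow> 0 < \<delta> \<Longrightarrow>
    \<exists>a\<in>eval_span. \<exists>g\<in>G. (\<forall>b\<in>eval_span. blinfun_apply b g = cov M Y a b) \<and> ereal (cov M Y a a / 2) \<le> legendre M Y f + ereal \<delta>"
  shows "large_deviations (\<lambda>e. distr M borel (X e)) (\<lambda>e. 1 / H e) (legendre M Y)"
  unfolding large_deviations_def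
proof (intro conjI allI impI)
  show "LIM e at_right 0. 1 / H e :> at_top"
    using filterlim_inverse_at_top[OF H_lim H_pos] by (simp add: divide_inverse)
  show "rate_function (legendre M Y)"
    by (rule rate_function_legendre[OF Y Y_zero Y_inc r C])
  have distr: "\<forall>\<^sub>F e in at_right 0. ereal (1 / (1 / H e)) * elog (measure (distr M borel (X e)) A)
     = ereal (H e) * elog (measure M {\<omega>\<in>space M. X e \<omega> \<in> A})" if A: "A \<in> sets borel" for A
    using X
  proof eventually_elim
    case (elim e)
    show ?case
      using measure_distr[OF gaussian_mapD(1)[OF elim] A] by (simp add: vimage_def Int_def conj_commute)
  qed
  show "Limsup (at_right 0) (\<lambda>e. ereal (1 / (1 / H e)) * elog (measure (distr M borel (X e)) F))
     \<le> - (INF f\<in>F. legendre M Y f)" if "closed F" for F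
    using large_deviations_upper[OF that] Limsup_eq[OF distr[of F]] that by simp
  show "- (INF f\<in>G. legendre M Y f)
     \<le> Liminf (at_right 0) (\<lambda>e. ereal (1 / (1 / H e)) * elog (measure (distr M borel (X e)) G))" if G: "open G" for G
  proof -
    have "- Liminf (at_right 0) (\<lambda>e. ereal (H e) * elog (measure M {\<omega>\<in>space M. X e \<omega> \<in> G})) \<le> legendre M Y f" (is "- ?L \<le> _") if f: "f \<in> G" for f
    proof (cases "legendre M Y f = \<infinity>")
      case False
      have "- ?L \<le> legendre M Y f + ereal \<delta>" if "0 < \<delta>" for \<delta>
      proof -
        have "0 < \<delta> / 2" "legendre M Y f < \<infinity>"
          using that False by auto
        from approx[OF this(2) G f this(1)] obtain a g where a: "a \<in> eval_span" "g \<in> G" "\<forall>b\<in>eval_span. blinfun_apply b g = cov M Y a b"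
          and le: "ereal (cov M Y a a / 2) \<le> legendre M Y f + ereal (\<delta> / 2)"
          by blast
        have "ereal (- (cov M Y a a / 2) - \<delta> / 2) \<le> ?L"
          using a G \<open>0 < \<delta> / 2\<close> by (intro large_deviations_lower) auto
        then have "- ?L \<le> ereal (cov M Y a a / 2) + ereal (\<delta> / 2)"
          by (simp add: ereal_uminus_le_reorder)
        also have "\<dots> \<le> legendre M Y f + ereal (\<delta> / 2) + ereal (\<delta> / 2)"
          by (rule add_right_mono[OF le])
        also have "\<dots> = legendre M Y f + ereal \<delta>"
          by (simp add: add.assoc)
        finally show ?thesis .
      qed
      then show ?thesis
        by (rule ereal_le_epsilon2)
    qed simp
    then have "- ?L \<le> (INF f\<in>G. legendre M Y f)" for L
      by (intro INF_greatest)
    then show ?thesis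
      using Liminf_eq[OF distr[of G]] G by (simp add: ereal_uminus_le_reorder)
  qed
qed

end

section \<open>The reproducing kernel Hilbert space\<close>

definition bernstein_C01 :: "nat \<Rightarrow> nat \<Rightarrow> C01" where
  "bernstein_C01 n k = path_of (\<lambda>x _. Bernstein n k x) ()"

lemma bernstein_C01_apply: "apply_bcontfun (bernstein_C01 n k) t = Bernstein n k (of_unit t)"
  unfolding bernstein_C01_def
  by (subst path_of_apply) (auto simp: Bernstein_def intro!: continuous_intros)

text \<open>Only finitely many values of \<open>f\<close> enter, so any continuous functional
  composed with this operator lies in \<open>eval_span\<close>. This reaches the whole dual without
  representing its elements by measures.\<close>

definition bernstein_op :: "nat \<Rightarrow> C01 \<Rightarrow> C01" where
  "bernstein_op n f = (\<Sum>k\<le>n. apply_bcontfun f (to_unit (real k / real n)) *\<^sub>R bernstein_C01 n k)"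

lemma bernstein_op_apply:
  "apply_bcontfun (bernstein_op n f) t = (\<Sum>k\<le>n. apply_bcontfun f (to_unit (real k / real n)) * Bernstein n k (of_unit t))"
proof -
  have "apply_bcontfun (bernstein_op n f) t = evl t (bernstein_op n f)"
    by simp
  also have "\<dots> = (\<Sum>k\<le>n. apply_bcontfun f (to_unit (real k / real n)) * evl t (bernstein_C01 n k))"
    unfolding bernstein_op_def by (simp add: blinfun.sum_right blinfun.scaleR_right del: evl_apply)
  finally show ?thesis
    by (simp add: bernstein_C01_apply)
qed

text \<open>The Bernstein basis is nonnegative and sums to 1. The bound provides the dominating
  function in \<open>eval_span_approx\<close>.\<close>

lemma norm_bernstein_op: "norm (bernstein_op n f) \<le> norm f"
proof (rule norm_bound)
  fix t
  have "norm (apply_bcontfun (bernstein_op n f) t)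
     \<le> (\<Sum>k\<le>n. norm (apply_bcontfun f (to_unit (real k / real n)) * Bernstein n k (of_unit t)))"
    unfolding bernstein_op_apply by (rule norm_sum)
  also have "\<dots> \<le> (\<Sum>k\<le>n. norm f * Bernstein n k (of_unit t))"
    using norm_bounded[of f] by (intro sum_mono) (auto simp: abs_mult Bernstein_nonneg intro!: mult_right_mono)
  also have "\<dots> = norm f"
    by (simp add: sum_distrib_left[symmetric])
  finally show "norm (apply_bcontfun (bernstein_op n f) t) \<le> norm f" .
qed

lemma bernstein_op_tendsto: "(\<lambda>n. bernstein_op n f) \<longlonglongrightarrow> f"
  unfolding tendsto_iff
proof safe
  fix e :: real assume "e > 0"
  have "continuous_on {0..1} to_unit"
    unfolding continuous_on_iff by (force simp: dist_unit_interval_def to_unit_inverse)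
  moreover have "continuous_on UNIV (apply_bcontfun f)"
    using apply_bcontfun[of f] by (auto simp: bcontfun_def)
  ultimately have "continuous_on {0..1} (\<lambda>x. apply_bcontfun f (to_unit x))"
    using continuous_on_compose2[of UNIV "apply_bcontfun f" "{0..1}" to_unit] by simp
  from Bernstein_Weierstrass[OF this, of "e / 2"] obtain N where
    N: "\<And>n x. N \<le> n \<Longrightarrow> x \<in> {0..1} \<Longrightarrow> \<bar>apply_bcontfun f (to_unit x) - (\<Sum>k\<le>n. apply_bcontfun f (to_unit (real k / real n)) * Bernstein n k x)\<bar> < e / 2"
    using \<open>e > 0\<close> by auto
  have "dist (bernstein_op n f) f < e" if "N \<le> n" for n
  proof -
    have "dist (bernstein_op n f) f \<le> e / 2"
    proof (rule dist_bound)
      fix t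
      show "dist (apply_bcontfun (bernstein_op n f) t) (apply_bcontfun f t) \<le> e / 2"
        using N[OF that, of "of_unit t"]
        by (simp add: bernstein_op_apply dist_real_def of_unit_inverse abs_minus_commute)
    qed
    then show ?thesis
      using \<open>e > 0\<close> by simp
  qed
  then show "\<forall>\<^sub>F n in sequentially. dist (bernstein_op n f) f < e"
    by (auto simp: eventually_sequentially)
qed

definition bernstein_functional :: "nat \<Rightarrow> (C01 \<Rightarrow>\<^sub>L real) \<Rightarrow> C01 \<Rightarrow>\<^sub>L real" where
  "bernstein_functional n a = (\<Sum>k\<le>n. a (bernstein_C01 n k) *\<^sub>R evl (to_unit (real k / real n)))"

lemma bernstein_functional_eval_span: "bernstein_functional n a \<in> eval_span"
  unfolding bernstein_functional_def eval_span_def by (intro span_sum span_scale span_base) auto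

lemma bernstein_functional_apply: "bernstein_functional n a f = a (bernstein_op n f)"
  by (simp add: bernstein_functional_def bernstein_op_def blinfun.sum_left blinfun.scaleR_left
      blinfun.sum_right blinfun.scaleR_right mult.commute)

context gaussian_family
begin

lemma Y_measurable [measurable]: "Y \<in> borel_measurable M"
  by (rule gaussian_mapD(1)[OF Y])

text \<open>A weak form of Fernique's theorem: a norm above \<open>c * real n\<close> puts
  \<open>Y \<omega>\<close> outside \<open>hoelder_set r (real n)\<close>, an event whose
  probability decays like a Gaussian tail.\<close>

lemma sq_int_norm_Y: "sq_int M (\<lambda>\<omega>. norm (Y \<omega>))"
proof -
  \<comment> \<open>The ratio between norm and radius in \<open>hoelder_set_norm\<close>.\<close>
  define c where "c = 1 + 1 / (1 - r)"
  have c: "0 < c"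
    using r by (simp add: c_def add_pos_pos)
  define E where "E n = {\<omega>\<in>space M. Y \<omega> \<notin> hoelder_set r (real n)}" for n
  have E[measurable]: "E n \<in> sets M" for n
  proof -
    have [measurable]: "hoelder_set r (real n) \<in> sets borel"
      using closed_hoelder_set[of r "real n"] by simp
    show ?thesis
      unfolding E_def by measurable
  qed
  have "\<forall>\<^sub>F n in sequentially. 8 * C \<le> (real n)\<^sup>2"
    by real_asymp
  then have tail: "\<forall>\<^sub>F n in sequentially. measure M (E n) \<le> tail_const r * exp (- ((real n)\<^sup>2 / (16 * C)))"
    using eventually_gt_at_top[of 0]
  proof eventually_elim
    case (elim n)
    have "measure (tilted M Y 0) (E n) \<le> tail_const r * exp (- ((real n)\<^sup>2 / (16 * C)))"
      unfolding E_def using elim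
      by (intro tilted_hoelder_set_tail[OF Y _ Y_zero Y_inc _ r C]) (auto simp: cov_def)
    then show ?case
      by (simp add: tilted_zero[OF Y])
  qed
  have "\<forall>\<^sub>F n in sequentially. c\<^sup>2 * (2 * real n + 1) * exp (- ((real n)\<^sup>2 / (16 * C))) \<le> (1 / 2) ^ n"
    using c C by real_asymp
  with tail have "\<forall>\<^sub>F n in sequentially. norm (c\<^sup>2 * (2 * real n + 1) * measure M (E n)) \<le> tail_const r * (1 / 2) ^ n"
  proof eventually_elim
    case (elim n)
    have "c\<^sup>2 * (2 * real n + 1) * measure M (E n) \<le> c\<^sup>2 * (2 * real n + 1) * (tail_const r * exp (- ((real n)\<^sup>2 / (16 * C))))"
      using elim(1) by (intro mult_left_mono) auto
    also have "\<dots> = tail_const r * (c\<^sup>2 * (2 * real n + 1) * exp (- ((real n)\<^sup>2 / (16 * C))))"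
      by (simp add: ac_simps)
    also have "\<dots> \<le> tail_const r * (1 / 2) ^ n"
      using elim(2) by (intro mult_left_mono tail_const_nonneg r)
    finally show ?case
      by simp
  qed
  then have "summable (\<lambda>n. c\<^sup>2 * (2 * real n + 1) * measure M (E n))"
    by (rule summable_comparison_test_ev) (intro summable_mult summable_geometric, simp)
  then have "(\<Sum>n. ennreal (c\<^sup>2 * (2 * real n + 1) * measure M (E n))) \<noteq> top"
    by (rule ennreal_suminf_neq_top) auto
  moreover have "(\<integral>\<^sup>+\<omega>. ennreal ((norm (Y \<omega>))\<^sup>2) \<partial>M) \<le> (\<Sum>n. ennreal (c\<^sup>2 * (2 * real n + 1) * measure M (E n)))"
  proof -
    have "(\<integral>\<^sup>+\<omega>. ennreal ((norm (Y \<omega>))\<^sup>2) \<partial>M) \<le> (\<integral>\<^sup>+\<omega>. (\<Sum>n. ennreal (c\<^sup>2 * (2 * real n + 1)) * indicator (E n) \<omega>) \<partial>M)"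
    proof (rule nn_integral_mono)
      fix \<omega> assume \<omega>: "\<omega> \<in> space M"
      define W where "W = norm (Y \<omega>) / c"
      define N where "N = nat \<lceil>W\<rceil>"
      have W0: "0 \<le> W"
        using c by (simp add: W_def)
      have WN: "W \<le> real N"
        by (simp add: N_def real_nat_ceiling_ge)
      have "(norm (Y \<omega>))\<^sup>2 = c\<^sup>2 * W\<^sup>2"
        using c by (simp add: W_def power_divide)
      also have "\<dots> \<le> c\<^sup>2 * (real N)\<^sup>2"
        using WN W0 by (intro mult_left_mono power_mono) auto
      \<comment> \<open>Writing the square as a sum of odd numbers turns the second moment into a
        sum of tail probabilities.\<close>
      also have "(real N)\<^sup>2 = (\<Sum>n<N. 2 * real n + 1)"
        by (induction N) (auto simp: power2_eq_square algebra_simps)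
      finally have "ennreal ((norm (Y \<omega>))\<^sup>2) \<le> ennreal (\<Sum>n<N. c\<^sup>2 * (2 * real n + 1))"
        by (intro ennreal_leI) (simp add: sum_distrib_left)
      also have "\<dots> = (\<Sum>n<N. ennreal (c\<^sup>2 * (2 * real n + 1)))"
        by (simp add: sum_ennreal)
      also have "\<dots> = (\<Sum>n<N. ennreal (c\<^sup>2 * (2 * real n + 1)) * indicator (E n) \<omega>)"
      proof (intro sum.cong refl)
        fix n assume "n \<in> {..<N}"
        then have "real n < W"
          unfolding N_def by (simp add: zless_nat_eq_int_zless less_ceiling_iff)
        then have "real n * c < norm (Y \<omega>)"
          using c by (simp add: W_def field_simps)
        then have "Y \<omega> \<notin> hoelder_set r (real n)"
          using hoelder_set_norm[of "Y \<omega>" r "real n"] r by (auto simp: c_def)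
        then show "ennreal (c\<^sup>2 * (2 * real n + 1)) = ennreal (c\<^sup>2 * (2 * real n + 1)) * indicator (E n) \<omega>"
          using \<omega> by (simp add: E_def)
      qed
      also have "\<dots> \<le> (\<Sum>n. ennreal (c\<^sup>2 * (2 * real n + 1)) * indicator (E n) \<omega>)"
        by (intro sum_le_suminf) auto
      finally show "ennreal ((norm (Y \<omega>))\<^sup>2) \<le> (\<Sum>n. ennreal (c\<^sup>2 * (2 * real n + 1)) * indicator (E n) \<omega>)" .
    qed
    also have "\<dots> = (\<Sum>n. \<integral>\<^sup>+\<omega>. ennreal (c\<^sup>2 * (2 * real n + 1)) * indicator (E n) \<omega> \<partial>M)"
      by (intro nn_integral_suminf) measurable
    also have "\<dots> = (\<Sum>n. ennreal (c\<^sup>2 * (2 * real n + 1) * measure M (E n)))"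
      by (intro suminf_cong) (simp add: nn_integral_cmult_indicator emeasure_eq_measure ennreal_mult)
    finally show ?thesis .
  qed
  ultimately have "(\<integral>\<^sup>+\<omega>. ennreal ((norm (Y \<omega>))\<^sup>2) \<partial>M) < \<infinity>"
    unfolding infinity_ennreal_def top.not_eq_extremum by (rule le_less_trans[rotated])
  then show ?thesis
    unfolding sq_int_def by (auto intro!: integrableI_bounded)
qed

lemma sq_int_blinfun:
  fixes a :: "C01 \<Rightarrow>\<^sub>L real"
  shows "sq_int M (\<lambda>\<omega>. blinfun_apply a (Y \<omega>))"
  unfolding sq_int_def
proof
  show m: "(\<lambda>\<omega>. blinfun_apply a (Y \<omega>)) \<in> borel_measurable M"
    by (intro borel_measurable_continuous_on[of "blinfun_apply a"] continuous_intros Y_measurable)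
  show "integrable M (\<lambda>\<omega>. (blinfun_apply a (Y \<omega>))\<^sup>2)"
  proof (rule Bochner_Integration.integrable_bound)
    show "integrable M (\<lambda>\<omega>. (norm a)\<^sup>2 * (norm (Y \<omega>))\<^sup>2)"
      using sq_int_square[OF sq_int_norm_Y] by simp
    show "AE \<omega> in M. norm ((blinfun_apply a (Y \<omega>))\<^sup>2) \<le> norm ((norm a)\<^sup>2 * (norm (Y \<omega>))\<^sup>2)"
    proof (rule AE_I2)
      fix \<omega>
      have "\<bar>blinfun_apply a (Y \<omega>)\<bar>\<^sup>2 \<le> (norm a * norm (Y \<omega>))\<^sup>2"
        using norm_blinfun[of a "Y \<omega>"] by (intro power_mono) auto
      then show "norm ((blinfun_apply a (Y \<omega>))\<^sup>2) \<le> norm ((norm a)\<^sup>2 * (norm (Y \<omega>))\<^sup>2)"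
        by (simp add: power_mult_distrib)
    qed
  qed (use m in measurable)
qed

lemma eval_span_approx:
  fixes a :: "C01 \<Rightarrow>\<^sub>L real"
  assumes "0 < e"
  shows "\<exists>b\<in>eval_span. (\<integral>\<omega>. (a (Y \<omega>) - blinfun_apply b (Y \<omega>))\<^sup>2 \<partial>M) \<le> e"
proof -
  have "(\<lambda>n. \<integral>\<omega>. (a (Y \<omega>) - bernstein_functional n a (Y \<omega>))\<^sup>2 \<partial>M) \<longlonglongrightarrow> (\<integral>\<omega>. 0 \<partial>M)"
  proof (rule integral_dominated_convergence)
    show "integrable M (\<lambda>\<omega>. (2 * norm a * norm (Y \<omega>))\<^sup>2)"
      using sq_int_square[OF sq_int_norm_Y] by (simp add: power_mult_distrib)
    show "(\<lambda>\<omega>. (a (Y \<omega>) - bernstein_functional n a (Y \<omega>))\<^sup>2) \<in> borel_measurable M" for n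
      by (intro borel_measurable_power borel_measurable_diff sq_int_measurable[OF sq_int_blinfun])
    show "AE \<omega> in M. (\<lambda>n. (a (Y \<omega>) - bernstein_functional n a (Y \<omega>))\<^sup>2) \<longlonglongrightarrow> 0"
    proof (rule AE_I2)
      fix \<omega>
      have "(\<lambda>n. (a (Y \<omega>) - a (bernstein_op n (Y \<omega>)))\<^sup>2) \<longlonglongrightarrow> (a (Y \<omega>) - a (Y \<omega>))\<^sup>2"
        by (intro tendsto_intros bernstein_op_tendsto)
      then show "(\<lambda>n. (a (Y \<omega>) - bernstein_functional n a (Y \<omega>))\<^sup>2) \<longlonglongrightarrow> 0"
        by (simp add: bernstein_functional_apply)
    qed
    show "AE \<omega> in M. norm ((a (Y \<omega>) - bernstein_functional n a (Y \<omega>))\<^sup>2) \<le> (2 * norm a * norm (Y \<omega>))\<^sup>2" for n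
    proof (rule AE_I2)
      fix \<omega>
      have "\<bar>a (Y \<omega>)\<bar> \<le> norm a * norm (Y \<omega>)"
        using norm_blinfun[of a "Y \<omega>"] by simp
      moreover have "\<bar>a (bernstein_op n (Y \<omega>))\<bar> \<le> norm a * norm (Y \<omega>)"
        using norm_blinfun[of a "bernstein_op n (Y \<omega>)"] mult_left_mono[OF norm_bernstein_op[of n "Y \<omega>"] norm_ge_zero[of a]]
        by simp
      ultimately have "\<bar>a (Y \<omega>) - bernstein_functional n a (Y \<omega>)\<bar> \<le> 2 * norm a * norm (Y \<omega>)"
        unfolding bernstein_functional_apply by (simp add: mult.assoc)
      then have "\<bar>a (Y \<omega>) - bernstein_functional n a (Y \<omega>)\<bar>\<^sup>2 \<le> (2 * norm a * norm (Y \<omega>))\<^sup>2"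
        by (intro power_mono) auto
      then show "norm ((a (Y \<omega>) - bernstein_functional n a (Y \<omega>))\<^sup>2) \<le> (2 * norm a * norm (Y \<omega>))\<^sup>2"
        by simp
    qed
  qed simp
  then have "\<forall>\<^sub>F n in sequentially. (\<integral>\<omega>. (a (Y \<omega>) - bernstein_functional n a (Y \<omega>))\<^sup>2 \<partial>M) < e"
    using assms by (intro order_tendstoD) auto
  then obtain n where "(\<integral>\<omega>. (a (Y \<omega>) - bernstein_functional n a (Y \<omega>))\<^sup>2 \<partial>M) < e"
    by (auto simp: eventually_sequentially)
  then show ?thesis
    using bernstein_functional_eval_span[of n a] by (intro bexI[of _ "bernstein_functional n a"]) auto
qed

text \<open>The definition of \<open>gaussian_space\<close> allows arbitrary functionals; each is
  replaced by a discrete one at squared distance at most \<open>1 / real (Suc n)\<close>.\<close>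

lemma gaussian_space_approx:
  assumes "\<xi> \<in> gaussian_space M Y"
  obtains a where "\<And>n. a n \<in> eval_span" "L2_lim M (\<lambda>n \<omega>. blinfun_apply (a n) (Y \<omega>)) \<xi>"
proof -
  obtain \<alpha> :: "nat \<Rightarrow> C01 \<Rightarrow>\<^sub>L real" where \<xi>: "\<xi> \<in> borel_measurable M"
    and lim: "(\<lambda>n. \<integral>\<^sup>+\<omega>. ennreal ((\<xi> \<omega> - blinfun_apply (\<alpha> n) (Y \<omega>))\<^sup>2) \<partial>M) \<longlonglongrightarrow> 0"
    using assms unfolding gaussian_space_def by blast
  have 1: "L2_lim M (\<lambda>n \<omega>. blinfun_apply (\<alpha> n) (Y \<omega>)) \<xi>"
    by (rule tendsto_nn_integral_imp_L2_lim[OF sq_int_blinfun \<xi> lim])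
  have "\<exists>b. b \<in> eval_span \<and> (\<integral>\<omega>. (\<alpha> n (Y \<omega>) - blinfun_apply b (Y \<omega>))\<^sup>2 \<partial>M) \<le> 1 / real (Suc n)" for n
    using eval_span_approx[of "1 / real (Suc n)" "\<alpha> n"] by auto
  then obtain a where a: "\<And>n. a n \<in> eval_span"
    "\<And>n. (\<integral>\<omega>. (\<alpha> n (Y \<omega>) - blinfun_apply (a n) (Y \<omega>))\<^sup>2 \<partial>M) \<le> 1 / real (Suc n)"
    by metis
  have "(\<lambda>n. \<integral>\<omega>. (\<alpha> n (Y \<omega>) - blinfun_apply (a n) (Y \<omega>))\<^sup>2 \<partial>M) \<longlonglongrightarrow> 0"
    by (rule tendsto_sandwich[OF always_eventually always_eventually tendsto_const LIMSEQ_Suc[OF lim_1_over_n]])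
      (use a(2) in auto)
  then have 2: "L2_lim M (\<lambda>n \<omega>. a n (Y \<omega>) - \<alpha> n (Y \<omega>)) (\<lambda>_. 0)"
    unfolding L2_lim_def using sq_int_diff[OF sq_int_blinfun sq_int_blinfun] by (simp add: sq_int_def power2_commute)
  from L2_lim_add[OF 1 2] have "L2_lim M (\<lambda>n \<omega>. blinfun_apply (a n) (Y \<omega>)) \<xi>"
    by simp
  with a(1) show ?thesis
    by (rule that)
qed

lemma integrable_scaleR_Y:
  fixes b :: "C01 \<Rightarrow>\<^sub>L real"
  assumes \<xi>: "sq_int M \<xi>"
  shows "integrable M (\<lambda>\<omega>. \<xi> \<omega> *\<^sub>R Y \<omega>)"
    and "blinfun_apply b (\<integral>\<omega>. \<xi> \<omega> *\<^sub>R Y \<omega> \<partial>M) = (\<integral>\<omega>. \<xi> \<omega> * blinfun_apply b (Y \<omega>) \<partial>M)"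
proof -
  have [measurable]: "\<xi> \<in> borel_measurable M"
    by (rule sq_int_measurable[OF \<xi>])
  show int: "integrable M (\<lambda>\<omega>. \<xi> \<omega> *\<^sub>R Y \<omega>)"
    by (rule Bochner_Integration.integrable_bound[OF sq_int_mult[OF \<xi> sq_int_norm_Y]]) auto
  show "blinfun_apply b (\<integral>\<omega>. \<xi> \<omega> *\<^sub>R Y \<omega> \<partial>M) = (\<integral>\<omega>. \<xi> \<omega> * blinfun_apply b (Y \<omega>) \<partial>M)"
    using integral_bounded_linear[OF blinfun.bounded_linear_right int, of b]
    by (simp add: blinfun.scaleR_right)
qed

lemma norm_integral_scaleR_Y:
  assumes \<xi>: "sq_int M \<xi>"
  shows "norm (\<integral>\<omega>. \<xi> \<omega> *\<^sub>R Y \<omega> \<partial>M) \<le> sqrt (\<integral>\<omega>. (\<xi> \<omega>)\<^sup>2 \<partial>M) * sqrt (\<integral>\<omega>. (norm (Y \<omega>))\<^sup>2 \<partial>M)"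
proof -
  have "norm (\<integral>\<omega>. \<xi> \<omega> *\<^sub>R Y \<omega> \<partial>M) \<le> (\<integral>\<omega>. norm (\<xi> \<omega> *\<^sub>R Y \<omega>) \<partial>M)"
    by (rule integral_norm_bound)
  also have "\<dots> = (\<integral>\<omega>. \<bar>\<xi> \<omega> * norm (Y \<omega>)\<bar> \<partial>M)"
    by (simp add: abs_mult)
  also have "\<dots> \<le> sqrt (\<integral>\<omega>. (\<xi> \<omega>)\<^sup>2 \<partial>M) * sqrt (\<integral>\<omega>. (norm (Y \<omega>))\<^sup>2 \<partial>M)"
    by (rule Cauchy_Schwarz_integral_abs[OF \<xi> sq_int_norm_Y])
  finally show ?thesis .
qed

lemma gaussian_space_sq_int: "\<xi> \<in> gaussian_space M Y \<Longrightarrow> sq_int M \<xi>"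
  by (auto simp: gaussian_space_def sq_int_def)

text \<open>The upper bound says that the second moment of
  \<open>\<xi> \<omega> - a (Y \<omega>)\<close> is nonnegative. For the lower bound, discrete
  functionals converging to \<open>\<xi>\<close> make this moment vanish in the limit.\<close>

lemma legendre_gaussian_space:
  assumes \<xi>: "\<xi> \<in> gaussian_space M Y"
  shows "legendre M Y (\<integral>\<omega>. \<xi> \<omega> *\<^sub>R Y \<omega> \<partial>M) = ereal ((\<integral>\<omega>. (\<xi> \<omega>)\<^sup>2 \<partial>M) / 2)"
proof (rule antisym)
  note sq = gaussian_space_sq_int[OF \<xi>]
  let ?f = "\<integral>\<omega>. \<xi> \<omega> *\<^sub>R Y \<omega> \<partial>M"
  show "legendre M Y ?f \<le> ereal ((\<integral>\<omega>. (\<xi> \<omega>)\<^sup>2 \<partial>M) / 2)"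
    unfolding legendre_def
  proof (rule SUP_least)
    fix a :: "C01 \<Rightarrow>\<^sub>L real" assume "a \<in> eval_span"
    have "0 \<le> (\<integral>\<omega>. (\<xi> \<omega> + (- 1) * a (Y \<omega>))\<^sup>2 \<partial>M)"
      by simp
    also have "\<dots> = (\<integral>\<omega>. (\<xi> \<omega>)\<^sup>2 \<partial>M) - 2 * (\<integral>\<omega>. \<xi> \<omega> * a (Y \<omega>) \<partial>M) + (\<integral>\<omega>. (a (Y \<omega>))\<^sup>2 \<partial>M)"
      using integral_square_add[OF sq sq_int_scale[OF sq_int_blinfun, of "- 1" a]] by simp
    finally show "ereal (blinfun_apply a ?f - cov M Y a a / 2) \<le> ereal ((\<integral>\<omega>. (\<xi> \<omega>)\<^sup>2 \<partial>M) / 2)"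
      by (simp add: integrable_scaleR_Y(2)[OF sq] cov_def power2_eq_square)
  qed
  obtain a where a: "\<And>n. a n \<in> eval_span" and lim: "L2_lim M (\<lambda>n \<omega>. blinfun_apply (a n) (Y \<omega>)) \<xi>"
    using gaussian_space_approx[OF \<xi>] by blast
  have "(\<lambda>n. (\<integral>\<omega>. \<xi> \<omega> * a n (Y \<omega>) \<partial>M) - (\<integral>\<omega>. (a n (Y \<omega>))\<^sup>2 \<partial>M) / 2)
     \<longlonglongrightarrow> (\<integral>\<omega>. \<xi> \<omega> * \<xi> \<omega> \<partial>M) - (\<integral>\<omega>. (\<xi> \<omega>)\<^sup>2 \<partial>M) / 2"
    by (intro tendsto_intros L2_lim_mult[OF L2_lim_const[OF sq] lim] L2_lim_square[OF lim]) simp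
  then have "(\<lambda>n. a n ?f - cov M Y (a n) (a n) / 2) \<longlonglongrightarrow> (\<integral>\<omega>. (\<xi> \<omega>)\<^sup>2 \<partial>M) / 2"
    by (simp add: integrable_scaleR_Y(2)[OF sq] cov_def power2_eq_square)
  then have "(\<lambda>n. ereal (a n ?f - cov M Y (a n) (a n) / 2)) \<longlonglongrightarrow> ereal ((\<integral>\<omega>. (\<xi> \<omega>)\<^sup>2 \<partial>M) / 2)"
    by simp
  then show "ereal ((\<integral>\<omega>. (\<xi> \<omega>)\<^sup>2 \<partial>M) / 2) \<le> legendre M Y ?f"
    by (rule LIMSEQ_le_const2) (use legendre_upper[OF a] in blast)
qed

text \<open>A maximizing sequence for the supremum defining the Legendre transform is Cauchy
  in \<open>L\<^sup>2\<close> by the parallelogram identity; this replaces the Riesz representation theorem.\<close>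

lemma legendre_finite_imp_gaussian_space:
  assumes fin: "legendre M Y f < \<infinity>"
  obtains \<xi> where "\<xi> \<in> gaussian_space M Y" "f = (\<integral>\<omega>. \<xi> \<omega> *\<^sub>R Y \<omega> \<partial>M)"
proof -
  obtain L where L: "legendre M Y f = ereal L"
    using fin legendre_nonneg[of M Y f] by (cases "legendre M Y f") auto
  let ?q = "cov M Y"
  have up: "a f - ?q a a / 2 \<le> L" if "a \<in> eval_span" for a
    using legendre_upper[OF that, of f M Y] L by simp
  have "\<exists>a. a \<in> eval_span \<and> L - 1 / real (Suc n) < a f - ?q a a / 2" for n
  proof -
    have "ereal (L - 1 / real (Suc n)) < legendre M Y f"
      by (simp add: L)
    then show ?thesis
      unfolding legendre_def less_SUP_iff by auto
  qed
  then obtain a where a: "\<And>n. a n \<in> eval_span" "\<And>n. L - 1 / real (Suc n) < a n f - ?q (a n) (a n) / 2"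
    by metis
  have quad: "?q (c + s *\<^sub>R b) (c + s *\<^sub>R b) = ?q c c + 2 * s * ?q c b + s\<^sup>2 * ?q b b"
    if "c \<in> eval_span" "b \<in> eval_span" for c b s
    using that by (simp add: cov_add_left[OF Y] cov_add_right[OF Y] cov_scale_left[OF Y] cov_scale_right[OF Y]
        cov_commute[of M Y b c] power2_eq_square algebra_simps)
  have cauchy: "?q (a m - a n) (a m - a n) \<le> 4 * (1 / real (Suc m) + 1 / real (Suc n))" for m n
  proof -
    have "?q ((1 / 2) *\<^sub>R (a m + a n)) ((1 / 2) *\<^sub>R (a m + a n)) = ?q (a m + a n) (a m + a n) / 4"
      unfolding cov_scale_left[OF Y] cov_scale_right[OF Y] by simp
    moreover have "?q (a m + a n) (a m + a n) = ?q (a m) (a m) + 2 * ?q (a m) (a n) + ?q (a n) (a n)"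
      using quad[OF a(1) a(1), of m 1 n] by simp
    moreover have "?q (a m - a n) (a m - a n) = ?q (a m) (a m) - 2 * ?q (a m) (a n) + ?q (a n) (a n)"
      using quad[OF a(1) a(1), of m "- 1" n] by simp
    moreover have "((1 / 2) *\<^sub>R (a m + a n)) f = (a m f + a n f) / 2"
      by (simp add: blinfun.scaleR_left blinfun.add_left)
    moreover have "((1 / 2) *\<^sub>R (a m + a n)) f - ?q ((1 / 2) *\<^sub>R (a m + a n)) ((1 / 2) *\<^sub>R (a m + a n)) / 2 \<le> L"
      by (intro up eval_span_closed a)
    moreover define x y where "x = 1 / real (Suc m)" and "y = 1 / real (Suc n)"
    ultimately show ?thesis
      using a(2)[of m] a(2)[of n] unfolding x_def[symmetric] y_def[symmetric] by (simp add: field_simps)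
  qed
  define u where "u n \<omega> = blinfun_apply (a n) (Y \<omega>)" for n \<omega>
  have "\<exists>\<xi>. L2_lim M u \<xi>"
  proof (rule L2_complete)
    show "sq_int M (u n)" for n
      unfolding u_def by (rule sq_int_blinfun)
    fix e :: real assume "0 < e"
    then obtain N where N: "1 / real (Suc N) < e / 8"
      using nat_approx_posE[of "e / 8"] by (auto simp: inverse_eq_divide)
    have "(\<integral>x. (u m x - u n x)\<^sup>2 \<partial>M) \<le> e" if "N \<le> m" "N \<le> n" for m n
    proof -
      have "(\<integral>x. (u m x - u n x)\<^sup>2 \<partial>M) \<le> 4 * (1 / real (Suc m) + 1 / real (Suc n))"
        using cauchy[of m n] by (simp add: cov_def u_def blinfun.diff_left power2_eq_square)
      also have "\<dots> \<le> 4 * (1 / real (Suc N) + 1 / real (Suc N))"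
        using that by (intro mult_left_mono add_mono divide_left_mono) auto
      also have "\<dots> \<le> e"
        using N by simp
      finally show ?thesis .
    qed
    then show "\<exists>N. \<forall>m\<ge>N. \<forall>n\<ge>N. (\<integral>x. (u m x - u n x)\<^sup>2 \<partial>M) \<le> e"
      by blast
  qed
  then obtain \<xi> where \<xi>: "L2_lim M u \<xi>"
    by blast
  then have sq: "sq_int M \<xi>"
    by (simp add: L2_lim_def)
  have gs: "\<xi> \<in> gaussian_space M Y"
    using L2_lim_imp_tendsto_nn_integral[OF \<xi>] sq
    unfolding gaussian_space_def u_def sq_int_def by auto
  \<comment> \<open>First-order condition: perturbing the maximizing sequence along \<open>b\<close>
    gains nothing in the limit, which forces \<open>b f\<close> to be the covariance of
    \<open>b (Y \<omega>)\<close> with \<open>\<xi>\<close>.\<close>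
  have opt: "b f = (\<integral>\<omega>. \<xi> \<omega> * b (Y \<omega>) \<partial>M)" if b: "b \<in> eval_span" for b
  proof -
    define d where "d = b f - (\<integral>\<omega>. \<xi> \<omega> * b (Y \<omega>) \<partial>M)"
    have ineq: "s * d \<le> s\<^sup>2 * ?q b b / 2" for s
    proof -
      have "s * (b f - ?q (a n) b) - s\<^sup>2 * ?q b b / 2 \<le> 1 / real (Suc n)" for n
      proof -
        have "(a n + s *\<^sub>R b) f - ?q (a n + s *\<^sub>R b) (a n + s *\<^sub>R b) / 2 \<le> L"
          by (intro up eval_span_closed a b)
        moreover have "?q (a n + s *\<^sub>R b) (a n + s *\<^sub>R b) = ?q (a n) (a n) + 2 * s * ?q (a n) b + s\<^sup>2 * ?q b b"
          by (rule quad[OF a(1) b])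
        moreover have "(a n + s *\<^sub>R b) f = a n f + s * b f"
          by (simp add: blinfun.add_left blinfun.scaleR_left)
        ultimately show ?thesis
          using a(2)[of n] by (simp add: algebra_simps add_divide_distrib)
      qed
      moreover have "(\<lambda>n. s * (b f - ?q (a n) b) - s\<^sup>2 * ?q b b / 2) \<longlonglongrightarrow> s * d - s\<^sup>2 * ?q b b / 2"
        unfolding d_def cov_def[of M Y "a n" b for n] u_def[symmetric]
        by (intro tendsto_intros L2_lim_mult[OF \<xi>] L2_lim_const sq_int_blinfun)
      moreover have "(\<lambda>n. 1 / real (Suc n)) \<longlonglongrightarrow> 0"
        by (rule LIMSEQ_Suc[OF lim_1_over_n])
      ultimately have "s * d - s\<^sup>2 * ?q b b / 2 \<le> 0"
        by (intro LIMSEQ_le) auto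
      then show ?thesis by simp
    qed
    have q0: "0 \<le> ?q b b"
      by (rule cov_nonneg)
    have "d = 0"
    proof (rule ccontr)
      assume "d \<noteq> 0"
      \<comment> \<open>The choice \<open>s = d / (?q b b + 1)\<close> replaces the maximizer
        \<open>d / ?q b b\<close>, whose denominator may be 0.\<close>
      have "d / (?q b b + 1) * d * (?q b b + 1)\<^sup>2 \<le> (d / (?q b b + 1))\<^sup>2 * ?q b b / 2 * (?q b b + 1)\<^sup>2"
        by (intro mult_right_mono ineq) simp
      then have "d\<^sup>2 * (?q b b + 1) \<le> d\<^sup>2 * (?q b b / 2)"
        using q0 by (simp add: power2_eq_square)
      then show False
        using \<open>d \<noteq> 0\<close> q0 by simp
    qed
    then show ?thesis
      by (simp add: d_def)
  qed
  have "f = (\<integral>\<omega>. \<xi> \<omega> *\<^sub>R Y \<omega> \<partial>M)"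
  proof (rule apply_bcontfun_inject[THEN iffD1], rule ext)
    fix t
    show "apply_bcontfun f t = apply_bcontfun (\<integral>\<omega>. \<xi> \<omega> *\<^sub>R Y \<omega> \<partial>M) t"
      using opt[OF evl_in_eval_span[of t]] integrable_scaleR_Y(2)[OF sq, of "evl t"] by simp
  qed
  with gs show ?thesis
    by (rule that)
qed

text \<open>Whatever variable represents \<open>f\<close>, its second moment is twice the Legendre
  transform at \<open>f\<close>. This makes the description in \<open>rkhs_norm\<close>
  definite.\<close>

theorem legendre_rkhs:
  "(if f \<in> rkhs M Y then ereal (1 / 2 * (rkhs_norm M Y f)\<^sup>2) else \<infinity>) = legendre M Y f"
proof (cases "f \<in> rkhs M Y")
  case True
  then obtain \<xi> where \<xi>: "\<xi> \<in> gaussian_space M Y" "f = (\<integral>\<omega>. \<xi> \<omega> *\<^sub>R Y \<omega> \<partial>M)"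
    unfolding rkhs_def by auto
  have "rkhs_norm M Y f = sqrt (\<integral>\<omega>. (\<xi> \<omega>)\<^sup>2 \<partial>M)"
    unfolding rkhs_norm_def
  proof (rule the_equality)
    show "\<exists>\<xi>'\<in>gaussian_space M Y. f = (\<integral>\<omega>. \<xi>' \<omega> *\<^sub>R Y \<omega> \<partial>M) \<and> sqrt (\<integral>\<omega>. (\<xi> \<omega>)\<^sup>2 \<partial>M) = sqrt (\<integral>\<omega>. (\<xi>' \<omega>)\<^sup>2 \<partial>M)"
      using \<xi> by blast
  next
    fix x assume "\<exists>\<xi>\<in>gaussian_space M Y. f = (\<integral>\<omega>. \<xi> \<omega> *\<^sub>R Y \<omega> \<partial>M) \<and> x = sqrt (\<integral>\<omega>. (\<xi> \<omega>)\<^sup>2 \<partial>M)"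
    then obtain \<xi>' where \<xi>': "\<xi>' \<in> gaussian_space M Y" "f = (\<integral>\<omega>. \<xi>' \<omega> *\<^sub>R Y \<omega> \<partial>M)" "x = sqrt (\<integral>\<omega>. (\<xi>' \<omega>)\<^sup>2 \<partial>M)"
      by blast
    have "ereal ((\<integral>\<omega>. (\<xi>' \<omega>)\<^sup>2 \<partial>M) / 2) = ereal ((\<integral>\<omega>. (\<xi> \<omega>)\<^sup>2 \<partial>M) / 2)"
      using legendre_gaussian_space[OF \<xi>(1)] legendre_gaussian_space[OF \<xi>'(1)] \<xi>(2) \<xi>'(2) by metis
    then show "x = sqrt (\<integral>\<omega>. (\<xi> \<omega>)\<^sup>2 \<partial>M)"
      using \<xi>'(3) by simp
  qed
  then show ?thesis
    using True legendre_gaussian_space[OF \<xi>(1)] \<xi>(2) by simp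
next
  case False
  then have "\<not> legendre M Y f < \<infinity>"
    using legendre_finite_imp_gaussian_space[of f] unfolding rkhs_def by blast
  then show ?thesis
    using False by simp
qed

text \<open>Discrete approximations of \<open>\<xi>\<close> in mean square give points
  \<open>g n\<close> that converge to \<open>f\<close> in norm, by Cauchy-Schwarz against the norm
  of \<open>Y\<close>, with convergent rates. This is the approximation needed for the lower
  bound.\<close>

theorem large_deviations_rkhs:
  "large_deviations (\<lambda>e. distr M borel (X e)) (\<lambda>e. 1 / H e)
     (\<lambda>f. if f \<in> rkhs M Y then ereal (1 / 2 * (rkhs_norm M Y f)\<^sup>2) else \<infinity>)"
  unfolding legendre_rkhs
proof (rule large_deviations_legendre)
  fix f G \<delta> assume fin: "legendre M Y f < \<infinity>" and G: "open G" "f \<in> G" and \<delta>: "(0::real) < \<delta>"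
  obtain \<xi> where \<xi>: "\<xi> \<in> gaussian_space M Y" "f = (\<integral>\<omega>. \<xi> \<omega> *\<^sub>R Y \<omega> \<partial>M)"
    using legendre_finite_imp_gaussian_space[OF fin] by blast
  note sq = gaussian_space_sq_int[OF \<xi>(1)]
  obtain a where a: "\<And>n. a n \<in> eval_span" and lim: "L2_lim M (\<lambda>n \<omega>. blinfun_apply (a n) (Y \<omega>)) \<xi>"
    using gaussian_space_approx[OF \<xi>(1)] by blast
  define g where "g n = (\<integral>\<omega>. a n (Y \<omega>) *\<^sub>R Y \<omega> \<partial>M)" for n
  have "(\<lambda>n. norm (f - g n)) \<longlonglongrightarrow> 0"
  proof (rule tendsto_sandwich[OF always_eventually always_eventually tendsto_const])
    have "f - g n = (\<integral>\<omega>. (\<xi> \<omega> - a n (Y \<omega>)) *\<^sub>R Y \<omega> \<partial>M)" for n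
      unfolding \<xi>(2) g_def scaleR_diff_left
      by (rule Bochner_Integration.integral_diff[symmetric]) (intro integrable_scaleR_Y sq sq_int_blinfun)+
    then show "\<forall>n. norm (f - g n) \<le> sqrt (\<integral>\<omega>. (\<xi> \<omega> - a n (Y \<omega>))\<^sup>2 \<partial>M) * sqrt (\<integral>\<omega>. (norm (Y \<omega>))\<^sup>2 \<partial>M)"
      using norm_integral_scaleR_Y[OF sq_int_diff[OF sq sq_int_blinfun]] by simp
    have "(\<lambda>n. sqrt (\<integral>\<omega>. (\<xi> \<omega> - a n (Y \<omega>))\<^sup>2 \<partial>M) * sqrt (\<integral>\<omega>. (norm (Y \<omega>))\<^sup>2 \<partial>M))
      \<longlonglongrightarrow> sqrt 0 * sqrt (\<integral>\<omega>. (norm (Y \<omega>))\<^sup>2 \<partial>M)"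
      using lim unfolding L2_lim_def by (intro tendsto_intros) blast
    then show "(\<lambda>n. sqrt (\<integral>\<omega>. (\<xi> \<omega> - a n (Y \<omega>))\<^sup>2 \<partial>M) * sqrt (\<integral>\<omega>. (norm (Y \<omega>))\<^sup>2 \<partial>M)) \<longlonglongrightarrow> 0"
      by simp
  qed simp
  then have "(\<lambda>n. dist (g n) f) \<longlonglongrightarrow> 0"
    by (simp add: dist_norm norm_minus_commute)
  then have "g \<longlonglongrightarrow> f"
    by (rule tendsto_dist_iff[THEN iffD2])
  then have "\<forall>\<^sub>F n in sequentially. g n \<in> G"
    using G by (rule topological_tendstoD)
  \<comment> \<open>Twice \<open>\<delta>\<close>, because the rate is half of the second
    moment.\<close>
  moreover have "\<forall>\<^sub>F n in sequentially. (\<integral>\<omega>. (a n (Y \<omega>))\<^sup>2 \<partial>M) < (\<integral>\<omega>. (\<xi> \<omega>)\<^sup>2 \<partial>M) + 2 * \<delta>"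
    using \<delta> by (intro order_tendstoD[OF L2_lim_square[OF lim]]) simp
  ultimately have "\<forall>\<^sub>F n in sequentially. g n \<in> G \<and> (\<integral>\<omega>. (a n (Y \<omega>))\<^sup>2 \<partial>M) < (\<integral>\<omega>. (\<xi> \<omega>)\<^sup>2 \<partial>M) + 2 * \<delta>"
    by (rule eventually_conj)
  then obtain n where n: "g n \<in> G" "(\<integral>\<omega>. (a n (Y \<omega>))\<^sup>2 \<partial>M) < (\<integral>\<omega>. (\<xi> \<omega>)\<^sup>2 \<partial>M) + 2 * \<delta>"
    by (auto simp: eventually_sequentially)
  show "\<exists>a\<in>eval_span. \<exists>g\<in>G. (\<forall>b\<in>eval_span. blinfun_apply b g = cov M Y a b) \<and> ereal (cov M Y a a / 2) \<le> legendre M Y f + ereal \<delta>"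
  proof (intro bexI[of _ "a n"] bexI[of _ "g n"] conjI ballI)
    show "blinfun_apply b (g n) = cov M Y (a n) b" for b
      unfolding g_def integrable_scaleR_Y(2)[OF sq_int_blinfun] cov_def ..
    show "ereal (cov M Y (a n) (a n) / 2) \<le> legendre M Y f + ereal \<delta>"
      unfolding \<xi>(2) legendre_gaussian_space[OF \<xi>(1)] using n(2) by (simp add: cov_def power2_eq_square)
  qed (use n a in auto)
qed

end

section \<open>Kernels of regular variation\<close>

lemma has_bochner_integral_powr_Ioc:
  assumes "-1 < a" "0 \<le> b"
  shows "has_bochner_integral lborel (\<lambda>x :: real. indicator {0<..b} x * x powr a) (b powr (a + 1) / (a + 1))"
proof -
  \<comment> \<open>At \<open>x = 0\<close> the value \<open>0 powr a\<close> is 0, so closing the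
    interval changes nothing.\<close>
  have "ennreal (x powr a) * indicator {0..b} x = ennreal (indicator {0<..b} x * x powr a)" for x :: real
    by (cases "x = 0") (auto split: split_indicator)
  moreover have "(\<integral>\<^sup>+x. ennreal (x powr a) * indicator {0..b} x \<partial>lborel) = ennreal (b powr (a + 1) / (a + 1))"
    using assms by (intro nn_integral_has_integral_lebesgue' has_integral_powr_from_0) auto
  ultimately show ?thesis
    using assms by (intro has_bochner_integral_nn_integral) auto
qed

text \<open>Reduction to sequences. The domination holds for small \<open>e\<close>, so an initial
  segment of each sequence is dropped.\<close>

lemma integral_dominated_convergence_at_right:
  fixes s :: "real \<Rightarrow> 'a \<Rightarrow> real"
  assumes f: "f \<in> borel_measurable M" and w: "integrable M w"
    and s: "\<forall>\<^sub>F e in at_right 0. s e \<in> borel_measurable M \<and> (\<forall>x. \<bar>s e x\<bar> \<le> w x)"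
    and lim: "\<And>x. ((\<lambda>e. s e x) \<longlongrightarrow> f x) (at_right 0)"
  shows "((\<lambda>e. \<integral>x. s e x \<partial>M) \<longlongrightarrow> (\<integral>x. f x \<partial>M)) (at_right 0)"
  unfolding tendsto_at_iff_sequentially comp_def
proof (intro allI impI)
  fix X :: "nat \<Rightarrow> real" assume X: "\<forall>i. X i \<in> {0<..} - {0}" "X \<longlonglongrightarrow> 0"
  have X': "filterlim X (at_right 0) sequentially"
    using X by (auto simp: filterlim_at less_le intro!: always_eventually)
  obtain N where N: "\<And>n. n \<ge> N \<Longrightarrow> s (X n) \<in> borel_measurable M \<and> (\<forall>x. \<bar>s (X n) x\<bar> \<le> w x)"
    using filterlim_iff[THEN iffD1, OF X', rule_format, OF s] by (auto simp: eventually_sequentially)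
  have "(\<lambda>n. \<integral>x. s (X (n + N)) x \<partial>M) \<longlonglongrightarrow> (\<integral>x. f x \<partial>M)"
  proof (rule integral_dominated_convergence[OF f _ w])
    show "s (X (n + N)) \<in> borel_measurable M" for n
      using N by simp
    show "AE x in M. (\<lambda>n. s (X (n + N)) x) \<longlonglongrightarrow> f x"
    proof (rule AE_I2)
      fix x
      have "(\<lambda>n. s (X n) x) \<longlonglongrightarrow> f x"
        by (rule filterlim_compose[OF lim X'])
      then show "(\<lambda>n. s (X (n + N)) x) \<longlonglongrightarrow> f x"
        by (rule LIMSEQ_ignore_initial_segment)
    qed
    show "AE x in M. norm (s (X (n + N)) x) \<le> w x" for n
      using N[of "n + N"] by simp
  qed
  then show "(\<lambda>n. \<integral>x. s (X n) x \<partial>M) \<longlonglongrightarrow> (\<integral>x. f x \<partial>M)"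
    by (rule LIMSEQ_offset)
qed

locale regular_kernel =
  fixes h c c' \<rho> :: "real \<Rightarrow> real" and \<alpha> c0 t0 :: real
  assumes \<alpha>: "\<alpha> > -1/2"
    and h_nonneg: "\<forall>t\<in>{0<..1}. 0 \<le> h t"
    and h_sq: "set_integrable lborel {0<..1} (\<lambda>t. (h t)\<^sup>2)"
    and h_RV: "h \<in> RV \<alpha>"
    and t0: "t0 \<in> {0<..1}"
    and repr: "\<forall>t\<in>{0<..1}. (h t)\<^sup>2 =
                 c t * t powr (2 * \<alpha>) * exp (LBINT u=ereal t..ereal t0. \<rho> u / u)"
    and c_lim: "(c \<longlongrightarrow> c0) (at_right 0)" "c0 > 0"
    and \<rho>_lim: "(\<rho> \<longlongrightarrow> 0) (at_right 0)"
    and c_deriv: "\<forall>t\<in>{0<..1}. (c has_real_derivative c' t) (at t within {0<..1})"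
    and c'_bdd: "bounded (c' ` {0<..1})"
    and \<rho>_cont: "continuous_on {0<..1} \<rho>"
begin

text \<open>Half of the slack in \<open>2 * \<alpha> > -1\<close>: even
  \<open>2 * \<alpha> - \<eta>\<close> exceeds -1, so perturbed powers remain integrable at
  0.\<close>

definition \<eta> :: real where "\<eta> = (2 * \<alpha> + 1) / 2"

lemma \<eta>_pos: "0 < \<eta>"
  using \<alpha> by (simp add: \<eta>_def)

definition H :: "real \<Rightarrow> real" where "H e = (LBINT s:{0<..e}. (h s)\<^sup>2)"

text \<open>The kernel after the substitution \<open>u = e * w\<close>, normalized to have unit
  square integral for small \<open>e\<close>. The indicator also vanishes at arguments below 0,
  which encodes that only the past of the Brownian motion contributes.\<close>

definition kern :: "real \<Rightarrow> real \<Rightarrow> real" where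
  "kern e x = indicator {0<..1} x * (h (e * x) * sqrt (e / H e))"

definition kern_lim :: "real \<Rightarrow> real" where
  "kern_lim x = indicator {0<..1} x * (sqrt (2 * \<alpha> + 1) * x powr \<alpha>)"

lemma h_measurable: "(\<lambda>x. indicator {0<..1} x * h x) \<in> borel_measurable borel"
proof -
  have "(\<lambda>x. indicator {0<..1} x * (h x)\<^sup>2) \<in> borel_measurable borel"
    using h_sq by (auto simp: set_integrable_def dest: borel_measurable_integrable)
  then have "(\<lambda>x. sqrt (indicator {0<..1} x * (h x)\<^sup>2)) \<in> borel_measurable borel"
    by measurable
  also have "(\<lambda>x. sqrt (indicator {0<..1} x * (h x)\<^sup>2)) = (\<lambda>x. indicator {0<..1} x * h x)"
    using h_nonneg by (auto simp: fun_eq_iff split: split_indicator)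
  finally show ?thesis .
qed

lemma h_scaled_measurable:
  assumes "0 < e" "e \<le> 1"
  shows "(\<lambda>x. indicator {0<..1} x * h (e * x)) \<in> borel_measurable borel"
proof -
  have "(\<lambda>x. indicator {0<..1} x * (indicator {0<..1} (e * x) * h (e * x))) \<in> borel_measurable borel"
    by (intro borel_measurable_times measurable_compose[OF _ h_measurable]) measurable
  also have "(\<lambda>x. indicator {0<..1} x * (indicator {0<..1} (e * x) * h (e * x))) = (\<lambda>x. indicator {0<..1} x * h (e * x))"
    using assms by (auto simp: fun_eq_iff mult_le_one split: split_indicator)
  finally show ?thesis .
qed

lemma kern_measurable: "0 < e \<Longrightarrow> e \<le> 1 \<Longrightarrow> kern e \<in> borel_measurable borel"
  unfolding kern_def[abs_def] mult.assoc[symmetric]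
  by (intro borel_measurable_times h_scaled_measurable) auto

lemma kern_lim_measurable [measurable]: "kern_lim \<in> borel_measurable borel"
  unfolding kern_lim_def[abs_def] by measurable

text \<open>A small \<open>\<rho>\<close> makes the exponential factor vary at most like a power
  with exponent \<open>\<eta>\<close>, since the integrand is dominated by
  \<open>\<eta> / x\<close>.\<close>

lemma rho_integral_bound:
  assumes e1: "e1 \<le> 1" and \<rho>: "\<And>t. 0 < t \<Longrightarrow> t \<le> e1 \<Longrightarrow> \<bar>\<rho> t\<bar> \<le> \<eta>"
    and uv: "0 < u" "u \<le> v" "v \<le> e1"
  shows "\<bar>(LBINT x=ereal u..ereal t0. \<rho> x / x) - (LBINT x=ereal v..ereal t0. \<rho> x / x)\<bar> \<le> \<eta> * (ln v - ln u)"
proof -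
  define f where "f x = \<rho> x / x" for x
  have cont: "continuous_on {a..b} f" if "0 < a" "b \<le> 1" for a b
    unfolding f_def using that by (intro continuous_intros continuous_on_subset[OF \<rho>_cont]) auto
  have "interval_lebesgue_integrable lborel (ereal (min u (min v t0))) (ereal (max u (max v t0))) f"
    using uv e1 t0 by (intro interval_integrable_continuous_on cont) auto
  then have "(LBINT x=ereal u..ereal v. f x) + (LBINT x=ereal v..ereal t0. f x) = (LBINT x=ereal u..ereal t0. f x)"
    by (intro interval_integral_sum) simp
  then have eq: "(LBINT x=ereal u..ereal t0. f x) - (LBINT x=ereal v..ereal t0. f x) = (LBINT x=ereal u..ereal v. f x)"
    by simp
  have cont': "continuous_on {u..v} (\<lambda>x. \<eta> / x)"
    using uv by (intro continuous_intros) auto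
  have int: "interval_lebesgue_integrable lborel (ereal u) (ereal v) f"
    "interval_lebesgue_integrable lborel (ereal u) (ereal v) (\<lambda>x. \<eta> / x)"
    using uv e1 by (auto intro!: interval_integrable_continuous_on cont cont')
  have "(LBINT x=ereal u..ereal v. \<eta> / x) = \<eta> * ln v - \<eta> * ln u"
  proof (rule interval_integral_FTC_finite)
    show "continuous_on {min u v..max u v} (\<lambda>x. \<eta> / x)"
      using cont' uv by simp
    fix x assume "min u v \<le> x" "x \<le> max u v"
    then have "0 < x"
      using uv by simp
    then have "((\<lambda>x. \<eta> * ln x) has_real_derivative \<eta> / x) (at x within {min u v..max u v})"
      by (auto intro!: derivative_eq_intros)
    then show "((\<lambda>x. \<eta> * ln x) has_vector_derivative \<eta> / x) (at x within {min u v..max u v})"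
      by (rule has_real_derivative_iff_has_vector_derivative[THEN iffD1])
  qed
  moreover have "\<bar>LBINT x=ereal u..ereal v. f x\<bar> \<le> (LBINT x=ereal u..ereal v. \<eta> / x)"
  proof -
    have e: "einterval (ereal u) (ereal v) = {u<..<v}"
      by (auto simp: einterval_def)
    have i: "set_integrable lborel {u<..<v} f" "set_integrable lborel {u<..<v} (\<lambda>x. \<eta> / x)"
      using int uv by (simp_all add: interval_lebesgue_integrable_def e)
    have "\<bar>LBINT x:{u<..<v}. f x\<bar> \<le> (LBINT x:{u<..<v}. \<bar>f x\<bar>)"
      using set_integral_norm_bound[OF i(1)] by simp
    also have "\<dots> \<le> (LBINT x:{u<..<v}. \<eta> / x)"
    proof (rule set_integral_mono)
      show "set_integrable lborel {u<..<v} (\<lambda>x. \<bar>f x\<bar>)"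
        using set_integrable_abs[OF i(1)] .
      fix x assume "x \<in> {u<..<v}"
      then show "\<bar>f x\<bar> \<le> \<eta> / x"
        using \<rho>[of x] uv by (simp add: f_def abs_divide divide_right_mono)
    qed (rule i)
    finally show ?thesis
      using uv by (simp add: interval_lebesgue_integral_def e)
  qed
  ultimately show ?thesis
    unfolding f_def[symmetric] eq by (simp add: right_diff_distrib)
qed

text \<open>The factors of \<open>h\<close> become summands of its logarithm. The first estimate is
  a Potter bound, from \<open>c\<close> being near \<open>c0\<close> and \<open>\<rho>\<close> being
  small; the second is a Lipschitz bound on the relative scale, where the bounded derivative of
  \<open>c\<close> enters.\<close>

lemma log_kernel_bounds:
  obtains e0 D where "0 < e0" "e0 \<le> 1" "0 \<le> D" "\<And>t. 0 < t \<Longrightarrow> t \<le> e0 \<Longrightarrow> 0 < h t"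
    "\<And>u v. 0 < u \<Longrightarrow> u \<le> v \<Longrightarrow> v \<le> e0 \<Longrightarrow>
       \<bar>ln (h u) - ln (h v) - \<alpha> * (ln u - ln v)\<bar> \<le> ln 2 + \<eta> / 2 * (ln v - ln u)"
    "\<And>u v. 0 < u \<Longrightarrow> u \<le> v \<Longrightarrow> v \<le> e0 \<Longrightarrow> \<bar>ln (h v) - ln (h u)\<bar> \<le> D * ((v - u) / u)"
proof -
  have "\<forall>\<^sub>F t in at_right 0. c0 / 2 < c t"
    using c_lim by (intro order_tendstoD[OF c_lim(1)]) auto
  moreover have "\<forall>\<^sub>F t in at_right 0. c t < 2 * c0"
    using c_lim by (intro order_tendstoD[OF c_lim(1)]) auto
  moreover have "\<forall>\<^sub>F t in at_right 0. dist (\<rho> t) 0 < \<eta>"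
    by (intro tendstoD[OF \<rho>_lim] \<eta>_pos)
  ultimately have "\<forall>\<^sub>F t in at_right 0. c0 / 2 < c t \<and> c t < 2 * c0 \<and> \<bar>\<rho> t\<bar> \<le> \<eta>"
    by eventually_elim auto
  then obtain b where b: "0 < b" "\<And>t. 0 < t \<Longrightarrow> t < b \<Longrightarrow> c0 / 2 < c t \<and> c t < 2 * c0 \<and> \<bar>\<rho> t\<bar> \<le> \<eta>"
    by (auto simp: eventually_at_right_field)
  define e0 where "e0 = min 1 (b / 2)"
  have e0: "0 < e0" "e0 \<le> 1" "e0 < b"
    using b(1) by (auto simp: e0_def)
  obtain L where "\<forall>t\<in>{0<..1}. \<bar>c' t\<bar> \<le> L"
    using c'_bdd by (auto simp: bounded_iff)
  then have L: "\<And>t. t \<in> {0<..1} \<Longrightarrow> \<bar>c' t\<bar> \<le> L"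
    by blast
  have L0: "0 \<le> L"
    using L[of 1] by simp
  define G where "G t = (LBINT x=ereal t..ereal t0. \<rho> x / x)" for t
  have cb: "c0 / 2 < c t" "c t < 2 * c0" if "0 < t" "t \<le> e0" for t
    using b(2)[of t] that e0 by auto
  have h2: "(h t)\<^sup>2 = c t * t powr (2 * \<alpha>) * exp (G t)" if "0 < t" "t \<le> e0" for t
    using repr that e0 by (simp add: G_def)
  have h_pos: "0 < h t" if "0 < t" "t \<le> e0" for t
  proof -
    have "0 < (h t)\<^sup>2"
      unfolding h2[OF that] using cb[OF that] c_lim that by simp
    moreover have "0 \<le> h t"
      using h_nonneg that e0 by auto
    ultimately show ?thesis
      by (metis less_eq_real_def power_zero_numeral less_irrefl)
  qed
  have ln_h: "ln (h t) = (ln (c t) + 2 * \<alpha> * ln t + G t) / 2" if "0 < t" "t \<le> e0" for t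
  proof -
    have "2 * ln (h t) = ln ((h t)\<^sup>2)"
      using h_pos[OF that] by (simp add: ln_realpow)
    also have "\<dots> = ln (c t) + 2 * \<alpha> * ln t + G t"
      unfolding h2[OF that] using cb[OF that] c_lim that by (simp add: ln_mult ln_powr)
    finally show ?thesis by simp
  qed
  have G: "\<bar>G u - G v\<bar> \<le> \<eta> * (ln v - ln u)" if "0 < u" "u \<le> v" "v \<le> e0" for u v
    unfolding G_def using that e0 b(2) by (intro rho_integral_bound[of e0]) auto
  \<comment> \<open>Both values lie between \<open>c0 / 2\<close> and \<open>2 * c0\<close>, a
    factor 4 apart at most. Passing from the square of \<open>h\<close> to \<open>h\<close> turns
    this into the \<open>ln 2\<close> of the claim.\<close>
  have lnc: "\<bar>ln (c u) - ln (c v)\<bar> \<le> 2 * ln 2" if "0 < u" "u \<le> e0" "0 < v" "v \<le> e0" for u v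
  proof -
    have *: "ln (c0 / 2) \<le> ln (c t)" "ln (c t) \<le> ln (2 * c0)" if "0 < t" "t \<le> e0" for t
      using cb[OF that] c_lim by (auto intro!: ln_mono)
    have "ln (c0 / 2) = ln c0 - ln 2" "ln (2 * c0) = ln c0 + ln 2"
      using c_lim by (auto simp: ln_div ln_mult)
    then show ?thesis
      using *[OF that(1,2)] *[OF that(3,4)] by (simp add: abs_le_iff)
  qed
  \<comment> \<open>One summand for each factor of \<open>h\<close>: the function \<open>c\<close>,
    the power and the exponential.\<close>
  define D where "D = L / c0 + \<bar>\<alpha>\<bar> + \<eta> / 2"
  have "\<bar>ln (h u) - ln (h v) - \<alpha> * (ln u - ln v)\<bar> \<le> ln 2 + \<eta> / 2 * (ln v - ln u)"
    if "0 < u" "u \<le> v" "v \<le> e0" for u v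
  proof -
    have uv: "u \<le> e0" "0 < v"
      using that by auto
    have "ln (h u) - ln (h v) - \<alpha> * (ln u - ln v) = (ln (c u) - ln (c v)) / 2 + (G u - G v) / 2"
      by (simp add: ln_h that uv algebra_simps add_divide_distrib diff_divide_distrib)
    then have "\<bar>ln (h u) - ln (h v) - \<alpha> * (ln u - ln v)\<bar> \<le> \<bar>(ln (c u) - ln (c v)) / 2\<bar> + \<bar>(G u - G v) / 2\<bar>"
      by (simp only: abs_triangle_ineq)
    also have "\<dots> \<le> ln 2 + \<eta> * (ln v - ln u) / 2"
      using G[OF that] lnc[OF that(1) uv(1) uv(2) that(3)] by (intro add_mono) auto
    finally show ?thesis
      by simp
  qed
  moreover have "\<bar>ln (h v) - ln (h u)\<bar> \<le> D * ((v - u) / u)" if "0 < u" "u \<le> v" "v \<le> e0" for u v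
  proof -
    have uv: "u \<le> e0" "0 < v"
      using that by auto
    have tri: "\<bar>a / 2 + b - g / 2\<bar> \<le> x + y + z / 2" if "\<bar>a\<bar> \<le> 2 * x" "\<bar>b\<bar> \<le> y" "\<bar>g\<bar> \<le> z"
      for a b g x y z :: real
      using that by linarith
    have ln_uv: "0 \<le> ln v - ln u" "ln v - ln u \<le> (v - u) / u"
      using that ln_le_minus_one[of "v / u"] by (auto simp: ln_div field_simps)
    have "\<bar>c v - c u\<bar> \<le> L * \<bar>v - u\<bar>"
      using field_differentiable_bound[of "{0<..1}" c c' L v u] c_deriv L that e0 by auto
    \<comment> \<open>Since \<open>u \<le> 1\<close>, division by \<open>u\<close> enlarges the
      bound and brings it to the relative scale of the other terms.\<close>
    also have "\<dots> \<le> L * ((v - u) / u)"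
      using that e0 L0 mult_left_le[of u "v - u"] by (intro mult_left_mono) (auto simp: pos_le_divide_eq)
    finally have cuv: "\<bar>c v - c u\<bar> \<le> L * ((v - u) / u)" .
    have ln_le: "ln y - ln x \<le> 2 / c0 * \<bar>y - x\<bar>" if "c0 / 2 < x" "0 < y" for x y
    proof -
      have "0 < x"
        using that c_lim by simp
      then have "ln y - ln x \<le> (y - x) / x"
        using that ln_le_minus_one[of "y / x"] by (simp add: ln_div field_simps)
      also have "\<dots> \<le> \<bar>y - x\<bar> / x"
        using \<open>0 < x\<close> by (intro divide_right_mono) auto
      also have "\<dots> \<le> \<bar>y - x\<bar> / (c0 / 2)"
        using that c_lim by (intro divide_left_mono) auto
      finally show ?thesis by (simp add: field_simps)
    qed
    have "\<bar>ln (c v) - ln (c u)\<bar> \<le> 2 / c0 * \<bar>c v - c u\<bar>"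
      using ln_le[of "c u" "c v"] ln_le[of "c v" "c u"] cb[of u] cb[of v] that uv c_lim
      by (simp add: abs_le_iff abs_minus_commute)
    also have "\<dots> \<le> 2 / c0 * (L * ((v - u) / u))"
      using cuv c_lim by (intro mult_left_mono) auto
    finally have 1: "\<bar>ln (c v) - ln (c u)\<bar> \<le> 2 * (L / c0 * ((v - u) / u))"
      by simp
    have 2: "\<bar>\<alpha> * (ln v - ln u)\<bar> \<le> \<bar>\<alpha>\<bar> * ((v - u) / u)"
      unfolding abs_mult using ln_uv by (intro mult_left_mono) auto
    have 3: "\<bar>G u - G v\<bar> \<le> \<eta> * ((v - u) / u)"
      using G[OF that] mult_left_mono[OF ln_uv(2), of \<eta>] \<eta>_pos by simp
    have "ln (h v) - ln (h u) = (ln (c v) - ln (c u)) / 2 + \<alpha> * (ln v - ln u) - (G u - G v) / 2"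
      by (simp add: ln_h that uv algebra_simps add_divide_distrib diff_divide_distrib)
    then have "\<bar>ln (h v) - ln (h u)\<bar> \<le> L / c0 * ((v - u) / u) + \<bar>\<alpha>\<bar> * ((v - u) / u) + \<eta> * ((v - u) / u) / 2"
      using tri[OF 1 2 3] by simp
    also have "\<dots> = D * ((v - u) / u)"
      by (simp add: D_def algebra_simps)
    finally show ?thesis .
  qed
  moreover have "0 \<le> D"
    using L0 c_lim \<eta>_pos by (simp add: D_def)
  ultimately show ?thesis
    using that[OF e0(1,2)] h_pos by blast
qed


section \<open>Limits and uniform estimates for the rescaled kernels\<close>

lemma H_tendsto: "(H \<longlongrightarrow> 0) (at_right 0)"
proof -
  have "((\<lambda>e. \<integral>s. indicator {0<..e} s * (h s)\<^sup>2 \<partial>lborel) \<longlongrightarrow> (\<integral>s. 0 \<partial>(lborel :: real measure))) (at_right 0)"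
  proof (rule integral_dominated_convergence_at_right[where w = "\<lambda>s. indicator {0<..1} s * (h s)\<^sup>2"])
    show int: "integrable lborel (\<lambda>s. indicator {0<..1} s * (h s)\<^sup>2)"
      using h_sq by (simp add: set_integrable_def)
    have "\<forall>\<^sub>F e in at_right 0. e < (1::real)"
      by (intro eventually_at_right_less[THEN eventually_mono] order_tendstoD[OF tendsto_ident_at]) auto
    then show "\<forall>\<^sub>F e in at_right 0. (\<lambda>s. indicator {0<..e} s * (h s)\<^sup>2) \<in> borel_measurable lborel \<and>
        (\<forall>x. \<bar>indicator {0<..e} x * (h x)\<^sup>2\<bar> \<le> indicator {0<..1} x * (h x)\<^sup>2)"
    proof eventually_elim
      case (elim e)
      have "(\<lambda>s. indicator {0<..e} s * (indicator {0<..1} s * (h s)\<^sup>2)) \<in> borel_measurable lborel"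
        using borel_measurable_integrable[OF int] by measurable
      also have "(\<lambda>s. indicator {0<..e} s * (indicator {0<..1} s * (h s)\<^sup>2)) = (\<lambda>s. indicator {0<..e} s * (h s)\<^sup>2)"
        using elim by (auto simp: fun_eq_iff split: split_indicator)
      finally show ?case
        using elim by (auto split: split_indicator)
    qed
    show "((\<lambda>e. indicator {0<..e} s * (h s)\<^sup>2) \<longlongrightarrow> 0) (at_right 0)" for s
    proof (cases "0 < s")
      case True
      have "\<forall>\<^sub>F e in at_right 0. e < s"
        using True by (intro order_tendstoD[OF tendsto_ident_at])
      then have "\<forall>\<^sub>F e in at_right 0. indicator {0<..e} s * (h s)\<^sup>2 = 0"
        by eventually_elim (simp split: split_indicator)
      then show ?thesis
        by (rule tendsto_eventually)
    qed simp
  qed simp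
  then show ?thesis
    by (simp add: H_def[abs_def] set_lebesgue_integral_def)
qed

text \<open>Size and regularity, uniformly in \<open>e\<close>. The difference bound is confined to
  \<open>y \<le> 2 * x\<close>, where the relative increment is at most 1 and so the logarithmic
  difference is bounded.\<close>

definition kern_bounds :: "real \<Rightarrow> real \<Rightarrow> real \<Rightarrow> bool" where
  "kern_bounds e0 A \<beta> \<longleftrightarrow> (\<forall>e. 0 < e \<longrightarrow> e \<le> e0 \<longrightarrow> 0 < H e \<and>
     (\<forall>x. 0 < x \<longrightarrow> x \<le> 1 \<longrightarrow> 0 \<le> kern e x \<and> kern e x \<le> A * x powr (- \<beta> / 2)) \<and>
     (\<forall>x y. 0 < x \<longrightarrow> x \<le> y \<longrightarrow> y \<le> 2 * x \<longrightarrow> y \<le> 1 \<longrightarrow>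
       \<bar>kern e y - kern e x\<bar> \<le> A * ((y - x) / x) * x powr (- \<beta> / 2)))"

text \<open>Substituting \<open>s = e * x\<close> gives
  \<open>H e = e * (h e)\<^sup>2 * J e\<close>, so \<open>kern e x\<close> on \<open>{0<..1}\<close>
  is \<open>h (e * x) / h e\<close> divided by \<open>sqrt (J e)\<close>. Potter bounds control the
  ratio and keep \<open>J e\<close> away from 0. Dominated convergence gives the limit
  \<open>1 / (2 * \<alpha> + 1)\<close> of \<open>J\<close>, the Karamata theorem of this
  setting.\<close>

lemma kern_estimates:
  obtains e0 A \<beta> where "0 < e0" "e0 \<le> 1" "0 < A" "0 < \<beta>" "\<beta> < 1" "kern_bounds e0 A \<beta>"
    "\<And>x. ((\<lambda>e. kern e x) \<longlongrightarrow> kern_lim x) (at_right 0)"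
proof -
  obtain e0 D where e0: "0 < e0" "e0 \<le> 1" and D: "0 \<le> D" and h_pos: "\<And>t. 0 < t \<Longrightarrow> t \<le> e0 \<Longrightarrow> 0 < h t"
    and potter: "\<And>u v. 0 < u \<Longrightarrow> u \<le> v \<Longrightarrow> v \<le> e0 \<Longrightarrow>
       \<bar>ln (h u) - ln (h v) - \<alpha> * (ln u - ln v)\<bar> \<le> ln 2 + \<eta> / 2 * (ln v - ln u)"
    and lip: "\<And>u v. 0 < u \<Longrightarrow> u \<le> v \<Longrightarrow> v \<le> e0 \<Longrightarrow> \<bar>ln (h v) - ln (h u)\<bar> \<le> D * ((v - u) / u)"
    using log_kernel_bounds by blast
  \<comment> \<open>At least \<open>\<eta> - 2 * \<alpha>\<close>, so that
    \<open>x powr (- \<beta> / 2)\<close> dominates the upper Potter power on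
    \<open>{0<..1}\<close>. The 1/2 ensures positivity, and both terms are below 1.\<close>
  define \<beta> where "\<beta> = max (\<eta> - 2 * \<alpha>) (1 / 2)"
  have \<beta>: "0 < \<beta>" "\<beta> < 1" "- \<beta> / 2 \<le> \<alpha> - \<eta> / 2"
  proof -
    have "\<eta> - 2 * \<alpha> \<le> \<beta>"
      by (simp add: \<beta>_def)
    then show "- \<beta> / 2 \<le> \<alpha> - \<eta> / 2"
      by simp
  qed (use \<alpha> in \<open>auto simp: \<beta>_def \<eta>_def field_simps\<close>)
  \<comment> \<open>The integral of the squared lower Potter bound.\<close>
  define \<kappa> where "\<kappa> = 1 / (4 * (2 * \<alpha> + \<eta> + 1))"
  have \<kappa>: "0 < \<kappa>"
    using \<alpha> \<eta>_pos by (simp add: \<kappa>_def)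
  define q where "q e x = indicator {0<..1} x * (h (e * x) / h e)\<^sup>2" for e x
  define J where "J e = (\<integral>x. q e x \<partial>lborel)" for e
  have ratio: "h (e * x) / h e \<le> 2 * x powr (\<alpha> - \<eta> / 2)" "1 / 2 * x powr (\<alpha> + \<eta> / 2) \<le> h (e * x) / h e"
    if e: "0 < e" "e \<le> e0" and x: "0 < x" "x \<le> 1" for e x
  proof -
    have ex: "0 < e * x" "e * x \<le> e"
      using e x by (auto simp: mult_left_le)
    have hh: "h (e * x) / h e = exp (ln (h (e * x)) - ln (h e))"
      using h_pos[of "e * x"] h_pos[of e] ex e by (simp add: exp_diff)
    have "\<bar>ln (h (e * x)) - ln (h e) - \<alpha> * ln x\<bar> \<le> ln 2 - \<eta> / 2 * ln x"
      using potter[OF ex e(2)] e x by (simp add: ln_mult)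
    then have "ln (h (e * x)) - ln (h e) \<le> ln 2 + (\<alpha> - \<eta> / 2) * ln x"
      "- ln 2 + (\<alpha> + \<eta> / 2) * ln x \<le> ln (h (e * x)) - ln (h e)"
      by (simp_all only: abs_le_iff left_diff_distrib distrib_right) linarith+
    then have "h (e * x) / h e \<le> exp (ln 2 + (\<alpha> - \<eta> / 2) * ln x)"
      "exp (- ln 2 + (\<alpha> + \<eta> / 2) * ln x) \<le> h (e * x) / h e"
      unfolding hh by simp_all
    then show "h (e * x) / h e \<le> 2 * x powr (\<alpha> - \<eta> / 2)" "1 / 2 * x powr (\<alpha> + \<eta> / 2) \<le> h (e * x) / h e"
      using x by (simp_all add: exp_add exp_diff powr_def)
  qed
  have ratio_nonneg: "0 \<le> h (e * x) / h e" if "0 < e" "e \<le> e0" "0 < x" "x \<le> 1" for e x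
    using ratio(2)[OF that] by (rule order_trans[rotated]) simp
  have int_up: "integrable lborel (\<lambda>x :: real. indicator {0<..1} x * x powr (2 * \<alpha> - \<eta>))"
  proof -
    have "-1 < 2 * \<alpha> - \<eta>"
      using \<alpha> by (simp add: \<eta>_def field_simps)
    then show ?thesis
      using has_bochner_integral_powr_Ioc[of "2 * \<alpha> - \<eta>" 1] by (simp add: has_bochner_integral_iff)
  qed
  have q_meas: "q e \<in> borel_measurable borel" if "0 < e" "e \<le> e0" for e
  proof -
    have "(\<lambda>x. (indicator {0<..1} x * h (e * x) / h e)\<^sup>2) \<in> borel_measurable borel"
      using h_scaled_measurable[of e] that e0 by (intro borel_measurable_power borel_measurable_divide) auto
    also have "(\<lambda>x. (indicator {0<..1} x * h (e * x) / h e)\<^sup>2) = q e"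
      by (auto simp: fun_eq_iff q_def split: split_indicator)
    finally show ?thesis .
  qed
  have q_le: "\<bar>q e x\<bar> \<le> 4 * (indicator {0<..1} x * x powr (2 * \<alpha> - \<eta>))" if e: "0 < e" "e \<le> e0" for e x
  proof (cases "x \<in> {0<..1}")
    case True
    then have x: "0 < x" "x \<le> 1"
      by auto
    have "(h (e * x) / h e)\<^sup>2 \<le> (2 * x powr (\<alpha> - \<eta> / 2))\<^sup>2"
      by (intro power_mono ratio ratio_nonneg e x)
    also have "\<dots> = 4 * x powr (2 * \<alpha> - \<eta>)"
      by (simp add: power_mult_distrib power2_eq_square[of "x powr _"] flip: powr_add)
    finally show ?thesis
      using True by (simp add: q_def)
  qed (simp add: q_def)
  have q_int: "integrable lborel (q e)" if e: "0 < e" "e \<le> e0" for e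
    by (rule Bochner_Integration.integrable_bound[OF integrable_mult_right[OF int_up, of 4]])
      (use q_meas[OF e] q_le[OF e] in \<open>auto simp: abs_mult\<close>)
  have J_ge: "\<kappa> \<le> J e" if e: "0 < e" "e \<le> e0" for e
  proof -
    have hb: "has_bochner_integral lborel (\<lambda>x :: real. indicator {0<..1} x * x powr (2 * \<alpha> + \<eta>)) (1 / (2 * \<alpha> + \<eta> + 1))"
      using has_bochner_integral_powr_Ioc[of "2 * \<alpha> + \<eta>" 1] \<alpha> \<eta>_pos by simp
    have "\<kappa> = (\<integral>x. 1 / 4 * (indicator {0<..1} x * x powr (2 * \<alpha> + \<eta>)) \<partial>lborel)"
      using hb by (simp add: \<kappa>_def has_bochner_integral_iff)
    also have "\<dots> \<le> J e"
      unfolding J_def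
    proof (rule integral_mono)
      show "integrable lborel (\<lambda>x :: real. 1 / 4 * (indicator {0<..1} x * x powr (2 * \<alpha> + \<eta>)))"
        using hb by (intro integrable_mult_right) (simp add: has_bochner_integral_iff)
      show "integrable lborel (q e)"
        by (rule q_int[OF e])
      fix x :: real
      show "1 / 4 * (indicator {0<..1} x * x powr (2 * \<alpha> + \<eta>)) \<le> q e x"
      proof (cases "x \<in> {0<..1}")
        case True
        then have x: "0 < x" "x \<le> 1"
          by auto
        have "1 / 4 * x powr (2 * \<alpha> + \<eta>) = (1 / 2 * x powr (\<alpha> + \<eta> / 2))\<^sup>2"
          by (simp add: power_mult_distrib power_divide power2_eq_square[of "x powr _"] flip: powr_add)
        also have "\<dots> \<le> (h (e * x) / h e)\<^sup>2"
          by (intro power_mono ratio e x) simp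
        finally show ?thesis
          using True by (simp add: q_def)
      qed (simp add: q_def)
    qed
    finally show ?thesis .
  qed
  have H_eq: "H e = e * (h e)\<^sup>2 * J e" if e: "0 < e" "e \<le> e0" for e
  proof -
    have he: "h e \<noteq> 0"
      using h_pos[of e] e by simp
    have "H e = (\<integral>s. indicator {0<..e} s * (h s)\<^sup>2 \<partial>lborel)"
      by (simp add: H_def set_lebesgue_integral_def)
    also have "\<dots> = e * (\<integral>x. indicator {0<..e} (0 + e * x) * (h (0 + e * x))\<^sup>2 \<partial>lborel)"
      using e lborel_integral_real_affine[of e "\<lambda>s. indicator {0<..e} s * (h s)\<^sup>2" 0] by simp
    also have "(\<lambda>x. indicator {0<..e} (0 + e * x) * (h (0 + e * x))\<^sup>2) = (\<lambda>x. (h e)\<^sup>2 * q e x)"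
      using e he by (auto simp: fun_eq_iff q_def power_divide zero_less_mult_iff split: split_indicator)
    finally show ?thesis
      by (simp add: J_def)
  qed
  have J_pos: "0 < J e" if "0 < e" "e \<le> e0" for e
    using J_ge[OF that] \<kappa> by simp
  have kern_eq: "kern e x = indicator {0<..1} x * (h (e * x) / h e / sqrt (J e))" if e: "0 < e" "e \<le> e0" for e x
  proof -
    have "e / H e = 1 / ((h e)\<^sup>2 * J e)"
      unfolding H_eq[OF e] using e by simp
    then have "sqrt (e / H e) = 1 / (h e * sqrt (J e))"
      using h_pos[of e] e by (simp add: real_sqrt_divide real_sqrt_mult)
    then show ?thesis
      by (simp add: kern_def)
  qed
  \<comment> \<open>The 2 comes from the upper Potter bound, \<open>sqrt \<kappa>\<close> from the
    lower bound on \<open>J e\<close>.\<close>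
  define A0 where "A0 = 2 / sqrt \<kappa>"
  have A0: "0 < A0"
    using \<kappa> by (simp add: A0_def)
  have kern_bound: "0 \<le> kern e x \<and> kern e x \<le> A0 * x powr (- \<beta> / 2)"
    if e: "0 < e" "e \<le> e0" and x: "0 < x" "x \<le> 1" for e x
  proof
    have k: "kern e x = h (e * x) / h e / sqrt (J e)"
      using x by (simp add: kern_eq[OF e])
    show "0 \<le> kern e x"
      unfolding k using J_pos[OF e] by (intro divide_nonneg_pos ratio_nonneg e x) simp
    have "kern e x \<le> 2 * x powr (\<alpha> - \<eta> / 2) / sqrt \<kappa>"
      unfolding k using J_ge[OF e] \<kappa> by (intro frac_le ratio e x) auto
    also have "\<dots> = A0 * x powr (\<alpha> - \<eta> / 2)"
      by (simp add: A0_def)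
    also have "\<dots> \<le> A0 * x powr (- \<beta> / 2)"
      using A0 x \<beta>(3) by (intro mult_left_mono powr_mono') auto
    finally show "kern e x \<le> A0 * x powr (- \<beta> / 2)" .
  qed
  define A where "A = A0 * (1 + D * (exp D + 1))"
  have A: "0 < A" "A0 \<le> A" "A0 * (D * (exp D + 1)) \<le> A"
    using A0 D by (auto simp: A_def algebra_simps intro!: add_pos_nonneg)
  have kern_diff: "\<bar>kern e y - kern e x\<bar> \<le> A * ((y - x) / x) * x powr (- \<beta> / 2)"
    if e: "0 < e" "e \<le> e0" and x: "0 < x" "x \<le> y" "y \<le> 2 * x" "y \<le> 1" for e x y
  proof -
    \<comment> \<open>The difference of kernels becomes \<open>kern e x * (exp z - 1)\<close>, and
      \<open>z\<close> is at most \<open>D\<close> times the relative increment.\<close>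
    define z where "z = ln (h (e * y)) - ln (h (e * x))"
    have ex: "0 < e * x" "e * x \<le> e0" "e * x \<le> e * y" "e * y \<le> e0"
    proof -
      show "e * y \<le> e0"
        using mult_left_mono[OF x(4), of e] e by linarith
      moreover show "e * x \<le> e * y"
        using x e by simp
      ultimately show "e * x \<le> e0"
        by simp
    qed (use e x in simp)
    have h: "0 < h (e * x)" "0 < h (e * y)"
      using ex by (auto intro!: h_pos)
    have "(e * y - e * x) / (e * x) = (y - x) / x"
      using e by (simp flip: right_diff_distrib)
    then have z: "\<bar>z\<bar> \<le> D * ((y - x) / x)"
      unfolding z_def using lip[OF ex(1,3,4)] by simp
    also have "\<dots> \<le> D * 1"
      using D x by (intro mult_left_mono) auto
    finally have "z \<le> D"
      by simp
    then have "\<bar>exp z - 1\<bar> \<le> \<bar>z\<bar> * (exp D + 1)"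
      using abs_exp_diff_le[of z 0] mult_left_mono[of "exp z + 1" "exp D + 1" "\<bar>z\<bar>"] by simp
    also have "\<dots> \<le> D * ((y - x) / x) * (exp D + 1)"
      using z by (intro mult_right_mono) (auto simp: add_nonneg_nonneg)
    finally have ez: "\<bar>exp z - 1\<bar> \<le> D * (exp D + 1) * ((y - x) / x)"
      by (simp add: ac_simps)
    have "h (e * y) = h (e * x) * exp z"
      using h by (simp add: z_def exp_diff)
    then have "kern e y - kern e x = kern e x * (exp z - 1)"
      using x by (simp add: kern_eq[OF e] algebra_simps diff_divide_distrib)
    then have "\<bar>kern e y - kern e x\<bar> = kern e x * \<bar>exp z - 1\<bar>"
      using kern_bound[OF e x(1)] x by (simp add: abs_mult)
    also have "\<dots> \<le> (A0 * x powr (- \<beta> / 2)) * (D * (exp D + 1) * ((y - x) / x))"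
      using kern_bound[OF e x(1)] x ez A0 by (intro mult_mono) auto
    also have "\<dots> = (A0 * (D * (exp D + 1))) * (((y - x) / x) * x powr (- \<beta> / 2))"
      by (simp add: ac_simps)
    also have "\<dots> \<le> A * (((y - x) / x) * x powr (- \<beta> / 2))"
      using A x by (intro mult_right_mono mult_nonneg_nonneg) auto
    finally show ?thesis
      by (simp add: ac_simps)
  qed
  have ev: "\<forall>\<^sub>F e in at_right 0. 0 < e \<and> e \<le> e0"
    using e0 by (auto simp: eventually_at_right_field intro!: exI[of _ e0])
  have ratio_lim: "((\<lambda>e. h (e * x) / h e) \<longlongrightarrow> x powr \<alpha>) (at_right 0)" if "0 < x" for x
    using h_RV that by (simp add: RV_def)
  have "(J \<longlongrightarrow> (\<integral>x. indicator {0<..1} x * x powr (2 * \<alpha>) \<partial>lborel)) (at_right 0)"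
    unfolding J_def[abs_def]
  proof (rule integral_dominated_convergence_at_right[OF _ integrable_mult_right[OF int_up, of 4]])
    show "\<forall>\<^sub>F e in at_right 0. q e \<in> borel_measurable lborel \<and> (\<forall>x. \<bar>q e x\<bar> \<le> 4 * (indicator {0<..1} x * x powr (2 * \<alpha> - \<eta>)))"
      using ev by eventually_elim (simp add: q_meas q_le)
    show "((\<lambda>e. q e x) \<longlongrightarrow> indicator {0<..1} x * x powr (2 * \<alpha>)) (at_right 0)" for x
    proof (cases "x \<in> {0<..1}")
      case True
      then have "((\<lambda>e. (h (e * x) / h e)\<^sup>2) \<longlongrightarrow> (x powr \<alpha>)\<^sup>2) (at_right 0)"
        by (intro tendsto_intros ratio_lim) simp
      then show ?thesis
        using True by (simp add: q_def power2_eq_square[of "x powr _"] flip: powr_add)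
    qed (simp add: q_def)
  qed measurable
  then have J_lim: "(J \<longlongrightarrow> 1 / (2 * \<alpha> + 1)) (at_right 0)"
    using has_bochner_integral_powr_Ioc[of "2 * \<alpha>" 1] \<alpha> by (simp add: has_bochner_integral_iff)
  have kern_tendsto: "((\<lambda>e. kern e x) \<longlongrightarrow> kern_lim x) (at_right 0)" for x
  proof (cases "x \<in> {0<..1}")
    case True
    have "((\<lambda>e. h (e * x) / h e / sqrt (J e)) \<longlongrightarrow> x powr \<alpha> / sqrt (1 / (2 * \<alpha> + 1))) (at_right 0)"
      using True \<alpha> by (intro tendsto_intros ratio_lim J_lim) auto
    moreover have "x powr \<alpha> / sqrt (1 / (2 * \<alpha> + 1)) = kern_lim x"
      using True by (simp add: kern_lim_def real_sqrt_divide)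
    moreover have "\<forall>\<^sub>F e in at_right 0. h (e * x) / h e / sqrt (J e) = kern e x"
      using ev by eventually_elim (use True in \<open>simp add: kern_eq\<close>)
    ultimately show ?thesis
      using tendsto_cong by fastforce
  next
    case False
    then have "kern e x = 0" "kern_lim x = 0" for e
      by (simp_all add: kern_def kern_lim_def)
    then show ?thesis
      by simp
  qed
  show ?thesis
  proof (rule that[OF e0 A(1) \<beta>(1,2) _ kern_tendsto])
    have "0 < H e" if "0 < e" "e \<le> e0" for e
      unfolding H_eq[OF that] using J_pos[OF that] h_pos[of e] that by simp
    moreover have "0 \<le> kern e x \<and> kern e x \<le> A * x powr (- \<beta> / 2)" if "0 < e" "e \<le> e0" "0 < x" "x \<le> 1" for e x
      using kern_bound[OF that] mult_right_mono[OF A(2), of "x powr (- \<beta> / 2)"] by auto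
    ultimately show "kern_bounds e0 A \<beta>"
      using kern_diff unfolding kern_bounds_def by blast
  qed
qed

text \<open>A common majorant, up to a constant, of the squares of the kernels.\<close>

definition "kern_dominator \<beta> x = (indicator {0<..1} x * x powr (- \<beta>) :: real)"

lemma integrable_kern_dominator:
  assumes "\<beta> < 1"
  shows "integrable lborel (\<lambda>w. kern_dominator \<beta> (s - w))"
proof -
  have "integrable lborel (kern_dominator \<beta>)"
    using has_bochner_integral_powr_Ioc[of "- \<beta>" 1] assms
    by (simp add: has_bochner_integral_iff kern_dominator_def[abs_def])
  from lborel_integrable_real_affine[OF this, of "- 1" s] show ?thesis
    by simp
qed

text \<open>The singularities at \<open>w = s\<close> and \<open>w = t\<close> are separated by
  bounding the product by a sum of squares, so translates of one integrable function
  dominate.\<close>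

lemma kern_product_tendsto:
  "((\<lambda>e. \<integral>w. indicator {0..} w * (kern e (s - w) * kern e (t - w)) \<partial>lborel) \<longlongrightarrow>
     (\<integral>w. indicator {0..} w * (kern_lim (s - w) * kern_lim (t - w)) \<partial>lborel)) (at_right 0)"
proof -
  obtain e0 A \<beta> where e0: "0 < e0" "e0 \<le> 1" and A: "0 < A" and \<beta>: "0 < \<beta>" "\<beta> < 1" and bounds: "kern_bounds e0 A \<beta>"
    and lim: "\<And>x. ((\<lambda>e. kern e x) \<longlongrightarrow> kern_lim x) (at_right 0)"
    using kern_estimates by blast
  have kb: "0 \<le> kern e x \<and> kern e x \<le> A * x powr (- \<beta> / 2)" if "0 < e" "e \<le> e0" "0 < x" "x \<le> 1" for e x
    using bounds that by (simp add: kern_bounds_def)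
  have sq: "(kern e x)\<^sup>2 \<le> A\<^sup>2 * kern_dominator \<beta> x" if e: "0 < e" "e \<le> e0" for e x
  proof (cases "x \<in> {0<..1}")
    case True
    then have "(kern e x)\<^sup>2 \<le> (A * x powr (- \<beta> / 2))\<^sup>2"
      using kb[OF e, of x] by (intro power_mono) auto
    also have "\<dots> = A\<^sup>2 * x powr (- \<beta>)"
      by (simp add: power_mult_distrib power2_eq_square[of "x powr _"] flip: powr_add)
    finally show ?thesis
      using True by (simp add: kern_dominator_def)
  qed (simp add: kern_def kern_dominator_def)
  have ev: "\<forall>\<^sub>F e in at_right 0. 0 < e \<and> e \<le> e0"
    using e0 by (auto simp: eventually_at_right_field intro!: exI[of _ e0])
  show ?thesis
  proof (rule integral_dominated_convergence_at_right)
    show "(\<lambda>w. indicator {0..} w * (kern_lim (s - w) * kern_lim (t - w))) \<in> borel_measurable lborel"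
      by measurable
    show "integrable lborel (\<lambda>w. A\<^sup>2 * kern_dominator \<beta> (s - w) + A\<^sup>2 * kern_dominator \<beta> (t - w))"
      by (intro Bochner_Integration.integrable_add integrable_mult_right integrable_kern_dominator \<beta>)
    show "\<forall>\<^sub>F e in at_right 0. (\<lambda>w. indicator {0..} w * (kern e (s - w) * kern e (t - w))) \<in> borel_measurable lborel \<and>
       (\<forall>w. \<bar>indicator {0..} w * (kern e (s - w) * kern e (t - w))\<bar> \<le> A\<^sup>2 * kern_dominator \<beta> (s - w) + A\<^sup>2 * kern_dominator \<beta> (t - w))"
      using ev
    proof eventually_elim
      case (elim e)
      have [measurable]: "kern e \<in> borel_measurable borel"
        using elim e0 by (intro kern_measurable) auto
      have "\<bar>indicator {0..} w * (kern e (s - w) * kern e (t - w))\<bar> \<le> A\<^sup>2 * kern_dominator \<beta> (s - w) + A\<^sup>2 * kern_dominator \<beta> (t - w)" for w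
      proof -
        have "\<bar>indicator {0..} w * (kern e (s - w) * kern e (t - w))\<bar> \<le> \<bar>kern e (s - w)\<bar> * \<bar>kern e (t - w)\<bar>"
          by (auto simp: abs_mult split: split_indicator)
        also have "\<dots> \<le> (kern e (s - w))\<^sup>2 + (kern e (t - w))\<^sup>2"
          using sum_squares_bound[of "\<bar>kern e (s - w)\<bar>" "\<bar>kern e (t - w)\<bar>"]
            mult_nonneg_nonneg[OF abs_ge_zero[of "kern e (s - w)"] abs_ge_zero[of "kern e (t - w)"]]
          unfolding power2_abs by linarith
        also have "\<dots> \<le> A\<^sup>2 * kern_dominator \<beta> (s - w) + A\<^sup>2 * kern_dominator \<beta> (t - w)"
          using elim by (intro add_mono sq) auto
        finally show ?thesis .
      qed
      moreover have "(\<lambda>w. indicator {0..} w * (kern e (s - w) * kern e (t - w))) \<in> borel_measurable lborel"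
        by measurable
      ultimately show ?case
        by blast
    qed
    show "((\<lambda>e. indicator {0..} w * (kern e (s - w) * kern e (t - w))) \<longlongrightarrow>
       indicator {0..} w * (kern_lim (s - w) * kern_lim (t - w))) (at_right 0)" for w
      by (intro tendsto_intros lim)
  qed
qed

text \<open>Let \<open>\<delta> = t - s\<close> and \<open>x = s - w\<close>. For
  \<open>0 < x\<close> the difference estimate gives a factor \<open>(\<delta> / x)\<^sup>2\<close>
  if \<open>\<delta> \<le> x\<close>, the size estimate a factor 1 otherwise, and both are at most
  \<open>(\<delta> / x) powr \<gamma>\<close>. Where the kernel at \<open>x\<close> vanishes, only
  arguments of the other one in \<open>{0<..\<delta>}\<close> contribute.\<close>

lemma kern_increments:
  obtains e0 C \<gamma> where "0 < e0" "e0 \<le> 1" "0 < C" "0 < \<gamma>" "\<And>e. 0 < e \<Longrightarrow> e \<le> e0 \<Longrightarrow> 0 < H e"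
    "\<And>e s t. 0 < e \<Longrightarrow> e \<le> e0 \<Longrightarrow> 0 \<le> s \<Longrightarrow> s \<le> t \<Longrightarrow> t \<le> 1 \<Longrightarrow>
      (\<integral>w. indicator {0..} w * (kern e (t - w) - kern e (s - w))\<^sup>2 \<partial>lborel) \<le> C * (t - s) powr \<gamma>"
proof -
  obtain e0 A \<beta> where e0: "0 < e0" "e0 \<le> 1" and A: "0 < A" and \<beta>: "0 < \<beta>" "\<beta> < 1" and bounds: "kern_bounds e0 A \<beta>"
    and lim: "\<And>x. ((\<lambda>e. kern e x) \<longlongrightarrow> kern_lim x) (at_right 0)"
    using kern_estimates by blast
  have H: "0 < H e" if "0 < e" "e \<le> e0" for e
    using bounds that by (simp add: kern_bounds_def)
  have kb: "0 \<le> kern e x \<and> kern e x \<le> A * x powr (- \<beta> / 2)" if "0 < e" "e \<le> e0" "0 < x" "x \<le> 1" for e x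
    using bounds that by (simp add: kern_bounds_def)
  have kd: "\<bar>kern e y - kern e x\<bar> \<le> A * ((y - x) / x) * x powr (- \<beta> / 2)"
    if "0 < e" "e \<le> e0" "0 < x" "x \<le> y" "y \<le> 2 * x" "y \<le> 1" for e x y
    using bounds that unfolding kern_bounds_def by blast
  \<comment> \<open>Half of the slack \<open>1 - \<beta>\<close>, so that
    \<open>x powr (- \<beta> - \<gamma>)\<close> is still integrable at 0.\<close>
  define \<gamma> where "\<gamma> = (1 - \<beta>) / 2"
  have \<gamma>: "0 < \<gamma>" "\<gamma> \<le> 2" "\<beta> + \<gamma> < 1" "\<gamma> \<le> 1 - \<beta>"
    using \<beta> by (auto simp: \<gamma>_def field_simps)
  \<comment> \<open>The terms come from the integrals of \<open>b1\<close> and \<open>b2\<close>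
    below, the second after
    \<open>\<delta> powr (1 - \<beta>) \<le> \<delta> powr \<gamma>\<close>.\<close>
  define C where "C = A\<^sup>2 * (1 / (1 - \<beta> - \<gamma>) + 1 / (1 - \<beta>))"
  have C: "0 < C"
    using A \<beta> \<gamma> by (auto simp: C_def intro!: mult_pos_pos add_pos_pos)
  have halfsq: "(x powr (- (\<beta> / 2)))\<^sup>2 = x powr (- \<beta>)" for x :: real
    by (simp add: power2_eq_square flip: powr_add)
  have "(\<integral>w. indicator {0..} w * (kern e (t - w) - kern e (s - w))\<^sup>2 \<partial>lborel) \<le> C * (t - s) powr \<gamma>"
    if e: "0 < e" "e \<le> e0" and st: "0 \<le> s" "s \<le> t" "t \<le> 1" for e s t
  proof -
    define \<delta> where "\<delta> = t - s"
    have \<delta>: "0 \<le> \<delta>" "\<delta> \<le> 1"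
      using st by (auto simp: \<delta>_def)
    define b1 where "b1 x = indicator {0<..1} x * x powr (- \<beta> - \<gamma>)" for x :: real
    define b2 where "b2 x = indicator {0<..\<delta>} x * x powr (- \<beta>)" for x :: real
    have b1: "has_bochner_integral lborel b1 (1 / (1 - \<beta> - \<gamma>))"
      unfolding b1_def[abs_def] using has_bochner_integral_powr_Ioc[of "- \<beta> - \<gamma>" 1] \<gamma> by (simp add: algebra_simps)
    have b2: "has_bochner_integral lborel b2 (\<delta> powr (1 - \<beta>) / (1 - \<beta>))"
      unfolding b2_def[abs_def] using has_bochner_integral_powr_Ioc[of "- \<beta>" \<delta>] \<beta> \<delta> by (simp add: algebra_simps)
    have b1': "integrable lborel (\<lambda>w. b1 (s - w))" "(\<integral>w. b1 (s - w) \<partial>lborel) = 1 / (1 - \<beta> - \<gamma>)"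
      using lborel_integrable_real_affine[of b1 "- 1" s] lborel_integral_real_affine[of "- 1" b1 s] b1
      by (simp_all add: has_bochner_integral_iff)
    have b2': "integrable lborel (\<lambda>w. b2 (t - w))" "(\<integral>w. b2 (t - w) \<partial>lborel) = \<delta> powr (1 - \<beta>) / (1 - \<beta>)"
      using lborel_integrable_real_affine[of b2 "- 1" t] lborel_integral_real_affine[of "- 1" b2 t] b2
      by (simp_all add: has_bochner_integral_iff)
    have nn: "0 \<le> b1 x" "0 \<le> b2 x" for x
      by (simp_all add: b1_def b2_def)
    define b where "b w = A\<^sup>2 * \<delta> powr \<gamma> * b1 (s - w) + A\<^sup>2 * b2 (t - w)" for w
    have bound: "indicator {0..} w * (kern e (t - w) - kern e (s - w))\<^sup>2 \<le> b w" for w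
    proof (cases "0 \<le> w")
      case False
      then show ?thesis
        using nn by (simp add: b_def)
    next
      case w: True
      define x where "x = s - w"
      have tx: "t - w = x + \<delta>" and x1: "x \<le> 1" "x + \<delta> \<le> 1"
        using w st by (auto simp: x_def \<delta>_def)
      show ?thesis
      proof (cases "0 < x")
        case True
        have "(kern e (x + \<delta>) - kern e x)\<^sup>2 \<le> A\<^sup>2 * \<delta> powr \<gamma> * x powr (- \<beta> - \<gamma>)"
        proof -
          have eq: "A\<^sup>2 * \<delta> powr \<gamma> * x powr (- \<beta> - \<gamma>) = (\<delta> / x) powr \<gamma> * (A * x powr (- \<beta> / 2))\<^sup>2"
            using True \<delta> by (simp add: power_mult_distrib halfsq powr_divide powr_diff)
          show ?thesis
          proof (cases "\<delta> \<le> x")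
            case dx: True
            have "\<bar>kern e (x + \<delta>) - kern e x\<bar> \<le> A * (\<delta> / x) * x powr (- \<beta> / 2)"
              using kd[OF e True, of "x + \<delta>"] dx \<delta> x1 by simp
            then have "\<bar>kern e (x + \<delta>) - kern e x\<bar>\<^sup>2 \<le> (A * (\<delta> / x) * x powr (- \<beta> / 2))\<^sup>2"
              by (intro power_mono) auto
            also have "\<dots> = (\<delta> / x)\<^sup>2 * (A * x powr (- \<beta> / 2))\<^sup>2"
              by (simp only: power_mult_distrib ac_simps)
            also have "(\<delta> / x)\<^sup>2 \<le> (\<delta> / x) powr \<gamma>"
            proof (cases "\<delta> = 0")
              case False
              then have "0 < \<delta> / x" "\<delta> / x \<le> 1"
                using True dx \<delta> by auto
              then have "(\<delta> / x) powr 2 \<le> (\<delta> / x) powr \<gamma>"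
                using \<gamma> by (intro powr_mono') auto
              then show ?thesis
                using \<open>0 < \<delta> / x\<close> by (simp add: powr_numeral)
            qed simp
            finally show ?thesis
              unfolding eq by (simp add: mult_right_mono)
          next
            case dx: False
            have "0 \<le> kern e x" "kern e x \<le> A * x powr (- \<beta> / 2)"
              using kb[OF e True] x1 by auto
            moreover have "0 \<le> kern e (x + \<delta>)" "kern e (x + \<delta>) \<le> A * (x + \<delta>) powr (- \<beta> / 2)"
              using kb[OF e, of "x + \<delta>"] x1 True \<delta> by auto
            moreover have "A * (x + \<delta>) powr (- \<beta> / 2) \<le> A * x powr (- \<beta> / 2)"
              using A True \<delta> \<beta> by (intro mult_left_mono powr_mono2') auto
            ultimately have "\<bar>kern e (x + \<delta>) - kern e x\<bar> \<le> A * x powr (- \<beta> / 2)"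
              by linarith
            then have "\<bar>kern e (x + \<delta>) - kern e x\<bar>\<^sup>2 \<le> (A * x powr (- \<beta> / 2))\<^sup>2"
              by (intro power_mono) auto
            also have "\<dots> = 1 * (A * x powr (- \<beta> / 2))\<^sup>2"
              by simp
            also have "\<dots> \<le> (\<delta> / x) powr \<gamma> * (A * x powr (- \<beta> / 2))\<^sup>2"
              using True dx \<gamma> by (intro mult_right_mono ge_one_powr_ge_zero) auto
            finally show ?thesis
              unfolding eq by simp
          qed
        qed
        also have "\<dots> \<le> b w"
          using True x1 nn by (simp add: b_def x_def[symmetric] b1_def)
        finally show ?thesis
          using w by (simp add: tx x_def[symmetric])
      next
        case False
        then have k0: "kern e x = 0"
          by (simp add: kern_def)
        show ?thesis
        proof (cases "0 < x + \<delta>")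
          case True
          have "(kern e (x + \<delta>))\<^sup>2 \<le> (A * (x + \<delta>) powr (- \<beta> / 2))\<^sup>2"
            using kb[OF e True x1(2)] by (intro power_mono) auto
          also have "\<dots> = A\<^sup>2 * b2 (t - w)"
            using True False by (simp add: power_mult_distrib halfsq b2_def tx)
          also have "\<dots> \<le> b w"
            using nn by (simp add: b_def)
          finally show ?thesis
            using w by (simp add: tx x_def[symmetric] k0)
        next
          case False
          then have "kern e (x + \<delta>) = 0"
            by (simp add: kern_def)
          then show ?thesis
            using nn by (simp add: tx x_def[symmetric] k0 b_def)
        qed
      qed
    qed
    have "(\<integral>w. indicator {0..} w * (kern e (t - w) - kern e (s - w))\<^sup>2 \<partial>lborel) \<le> (\<integral>w. b w \<partial>lborel)"
    proof (rule integral_mono')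
      show "integrable lborel b"
        unfolding b_def[abs_def] using b1' b2' by auto
    qed (use bound nn in \<open>auto simp: b_def\<close>)
    also have "\<dots> = A\<^sup>2 * \<delta> powr \<gamma> * (1 / (1 - \<beta> - \<gamma>)) + A\<^sup>2 * (\<delta> powr (1 - \<beta>) / (1 - \<beta>))"
      unfolding b_def using b1' b2' by simp
    also have "\<dots> \<le> A\<^sup>2 * \<delta> powr \<gamma> * (1 / (1 - \<beta> - \<gamma>)) + A\<^sup>2 * (\<delta> powr \<gamma> / (1 - \<beta>))"
      using \<delta> \<beta> \<gamma> by (intro add_left_mono mult_left_mono divide_right_mono powr_mono') auto
    also have "\<dots> = C * (t - s) powr \<gamma>"
      by (simp add: C_def \<delta>_def algebra_simps)
    finally show ?thesis .
  qed
  with H show ?thesis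
    by (intro that[OF e0 C \<gamma>(1)])
qed

end

section \<open>Volterra processes\<close>

lemma sq_int_cong: "(\<And>x. x \<in> space M \<Longrightarrow> f x = g x) \<Longrightarrow> sq_int M f \<longleftrightarrow> sq_int M g"
  unfolding sq_int_def
  by (intro conj_cong measurable_cong Bochner_Integration.integrable_cong) auto

lemma L2_lim_cong:
  assumes "\<And>x. x \<in> space M \<Longrightarrow> v x = v' x"
  shows "L2_lim M u v \<longleftrightarrow> L2_lim M u v'"
proof -
  have "(\<integral>x. (v x - u n x)\<^sup>2 \<partial>M) = (\<integral>x. (v' x - u n x)\<^sup>2 \<partial>M)" for n
    by (intro Bochner_Integration.integral_cong) (simp_all add: assms)
  moreover have "sq_int M v \<longleftrightarrow> sq_int M v'"
    by (rule sq_int_cong[OF assms])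
  ultimately show ?thesis
    by (simp add: L2_lim_def)
qed

text \<open>Paths are continuous on \<open>space M\<close>, so only there is \<open>path_of\<close>
  known to agree with the process.\<close>

lemma wiener_cong:
  assumes "\<And>\<omega>. \<omega> \<in> space M \<Longrightarrow> \<zeta> \<omega> = \<zeta>' \<omega>"
  shows "wiener M B g \<zeta> \<longleftrightarrow> wiener M B g \<zeta>'"
proof -
  have "L2_lim M u \<zeta> \<longleftrightarrow> L2_lim M u \<zeta>'" for u
    by (rule L2_lim_cong[OF assms])
  then show ?thesis
    by (simp add: wiener_def)
qed

text \<open>By the isometry the second moment of the difference is the integral of the squared
  difference of the integrands, which vanishes off a null set.\<close>

lemma wiener_AE_unique:
  assumes B: "brownian_motion_on {0..} M B" and W: "wiener M B g \<zeta>" "wiener M B g' \<zeta>'"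
    and eq: "\<And>u. u \<notin> N \<Longrightarrow> g u = g' u" and N: "finite N"
  shows "AE \<omega> in M. \<zeta> \<omega> = \<zeta>' \<omega>"
proof -
  have W': "wiener M B (\<lambda>u. g u + - 1 * g' u) (\<lambda>\<omega>. \<zeta> \<omega> + - 1 * \<zeta>' \<omega>)"
    by (intro wiener_add wiener_scale W)
  have "(\<integral>u. (g u + - 1 * g' u)\<^sup>2 \<partial>lborel) = (\<integral>u. 0 \<partial>(lborel :: real measure))"
    using N eq by (intro integral_discrete_difference[of N]) (auto simp: countable_finite)
  then have "(\<integral>\<omega>. (\<zeta> \<omega> + - 1 * \<zeta>' \<omega>)\<^sup>2 \<partial>M) = 0"
    unfolding wiener_isometry(1)[OF B W'] by simp
  then have "AE \<omega> in M. (\<zeta> \<omega> + - 1 * \<zeta>' \<omega>)\<^sup>2 = 0"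
    using integral_nonneg_eq_0_iff_AE[OF sq_int_square[OF wiener_sq_int(2)[OF W']]] by simp
  then show ?thesis
    by eventually_elim simp
qed

lemma volterra_wiener:
  assumes B: "brownian_motion_on {0..} M B" and X: "volterra_process M B k X" and t: "t \<in> {0..1}"
  shows "wiener M B (\<lambda>u. indicator {0..t} u * k (t - u)) (X t)"
  using X t by (intro has_wiener_integral_imp_wiener[OF B]) (auto simp: volterra_process_def)

text \<open>Closed balls are described by the values at dyadic points, hence by countably many
  measurable conditions, and every open set is a countable union of balls.\<close>

lemma borel_measurable_C01:
  fixes Z :: "'a \<Rightarrow> C01"
  assumes Z: "\<And>t. (\<lambda>\<omega>. apply_bcontfun (Z \<omega>) t) \<in> borel_measurable M"
  shows "Z \<in> borel_measurable M"
proof (rule borel_measurableI)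
  have dist_le: "dist f g \<le> e \<longleftrightarrow> (\<forall>n. \<forall>k\<le>2 ^ n. \<bar>apply_bcontfun f (dyadic n k) - apply_bcontfun g (dyadic n k)\<bar> \<le> e)"
    for f g :: C01 and e
  proof
    assume "dist f g \<le> e"
    then show "\<forall>n. \<forall>k\<le>2 ^ n. \<bar>apply_bcontfun f (dyadic n k) - apply_bcontfun g (dyadic n k)\<bar> \<le> e"
      using dist_bounded[of f _ g] by (auto simp: dist_real_def intro: order_trans)
  next
    assume *: "\<forall>n. \<forall>k\<le>2 ^ n. \<bar>apply_bcontfun f (dyadic n k) - apply_bcontfun g (dyadic n k)\<bar> \<le> e"
    show "dist f g \<le> e"
    proof (rule dist_bound)
      fix t
      have c: "isCont (apply_bcontfun f) t" "isCont (apply_bcontfun g) t"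
        using apply_bcontfun[of f] apply_bcontfun[of g] by (auto simp: bcontfun_def continuous_on_eq_continuous_at)
      have "(\<lambda>n. \<bar>apply_bcontfun f (dyadic n (dyadic_below n t)) - apply_bcontfun g (dyadic n (dyadic_below n t))\<bar>)
         \<longlonglongrightarrow> \<bar>apply_bcontfun f t - apply_bcontfun g t\<bar>"
        by (intro tendsto_intros isCont_tendsto_compose[OF c(1) dyadic_below_tendsto]
            isCont_tendsto_compose[OF c(2) dyadic_below_tendsto])
      then have "\<bar>apply_bcontfun f t - apply_bcontfun g t\<bar> \<le> e"
        by (rule LIMSEQ_le_const2) (use * dyadic_below_le in blast)
      then show "dist (apply_bcontfun f t) (apply_bcontfun g t) \<le> e"
        by (simp add: dist_real_def)
    qed
  qed
  have cball: "{\<omega> \<in> space M. dist (Z \<omega>) g \<le> e} \<in> sets M" for g e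
    unfolding dist_le using Z by measurable
  have ball: "{\<omega> \<in> space M. Z \<omega> \<in> ball g e} \<in> sets M" for g e
  proof -
    have "{\<omega> \<in> space M. Z \<omega> \<in> ball g e} = (\<Union>n. {\<omega> \<in> space M. dist (Z \<omega>) g \<le> e - 1 / real (Suc n)})"
    proof safe
      fix \<omega> assume "\<omega> \<in> space M" "Z \<omega> \<in> ball g e"
      then have "0 < e - dist (Z \<omega>) g"
        by (simp add: dist_commute)
      then obtain n where "inverse (real (Suc n)) < e - dist (Z \<omega>) g"
        using reals_Archimedean by blast
      then have "dist (Z \<omega>) g \<le> e - 1 / real (Suc n)"
        by (simp add: inverse_eq_divide)
      then show "\<omega> \<in> (\<Union>n. {\<omega> \<in> space M. dist (Z \<omega>) g \<le> e - 1 / real (Suc n)})"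
        using \<open>\<omega> \<in> space M\<close> by blast
    next
      fix \<omega> n assume "dist (Z \<omega>) g \<le> e - 1 / real (Suc n)"
      moreover have "0 < 1 / real (Suc n)"
        by simp
      ultimately have "dist (Z \<omega>) g < e"
        by linarith
      then show "Z \<omega> \<in> ball g e"
        by (simp add: dist_commute)
    qed
    then show ?thesis
      using cball by simp
  qed
  fix S :: "C01 set" assume "open S"
  define \<F> where "\<F> = {ball g e |g e. ball g e \<subseteq> S}"
  have "\<Union> \<F> = S"
  proof
    show "S \<subseteq> \<Union> \<F>"
    proof
      fix f assume "f \<in> S"
      then obtain e where "0 < e" "ball f e \<subseteq> S"
        using \<open>open S\<close> open_contains_ball by blast
      then show "f \<in> \<Union> \<F>"
        unfolding \<F>_def using centre_in_ball by blast
    qed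
  qed (auto simp: \<F>_def)
  moreover obtain \<F>' where \<F>': "\<F>' \<subseteq> \<F>" "countable \<F>'" "\<Union> \<F>' = \<Union> \<F>"
    using Lindelof[of \<F>] by (auto simp: \<F>_def)
  ultimately have "Z -` S \<inter> space M = (\<Union>U\<in>\<F>'. {\<omega> \<in> space M. Z \<omega> \<in> U})"
    by auto
  also have "\<dots> \<in> sets M"
    using \<F>' ball by (intro sets.countable_UN') (auto simp: \<F>_def)
  finally show "Z -` S \<inter> space M \<in> sets M" .
qed

text \<open>By induction over \<open>eval_span\<close>, every discrete functional of the path is
  again a Wiener integral, so its generating function comes from the isometry.\<close>

lemma gaussian_map_path_of:
  assumes B: "brownian_motion_on {0..} M B"
    and cont: "\<And>\<omega>. \<omega> \<in> space M \<Longrightarrow> continuous_on {0..1} (\<lambda>t. Z t \<omega>)"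
    and W: "\<And>t. t \<in> {0..1} \<Longrightarrow> \<exists>g. wiener M B g (Z t)"
  shows "gaussian_map M (path_of Z)"
proof -
  have app: "apply_bcontfun (path_of Z \<omega>) t = Z (of_unit t) \<omega>" if "\<omega> \<in> space M" for \<omega> t
    by (rule path_of_apply[where X = Z and \<omega> = \<omega>, OF cont[OF that]])
  have We: "\<exists>g. wiener M B g (\<lambda>\<omega>. apply_bcontfun (path_of Z \<omega>) t)" for t
  proof -
    obtain g where "wiener M B g (Z (of_unit t))"
      using W[of "of_unit t"] by auto
    then have "wiener M B g (\<lambda>\<omega>. apply_bcontfun (path_of Z \<omega>) t)"
      by (subst wiener_cong[OF app])
    then show ?thesis
      by blast
  qed
  have "\<exists>g. wiener M B g (\<lambda>\<omega>. blinfun_apply a (path_of Z \<omega>))" if "a \<in> eval_span" for a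
    using that
  proof (induction rule: eval_span_induct)
    case zero
    show ?case
      using wiener_zero[of M B] by auto
  next
    case (add x t a)
    obtain g g' where "wiener M B g (\<lambda>\<omega>. blinfun_apply a (path_of Z \<omega>))"
      "wiener M B g' (\<lambda>\<omega>. apply_bcontfun (path_of Z \<omega>) t)"
      using add(2) We[of t] by blast
    from wiener_add[OF wiener_scale[OF this(2), of x] this(1)]
    show ?case
      by (auto simp: blinfun.add_left blinfun.scaleR_left)
  qed
  then obtain g where g: "\<And>a. a \<in> eval_span \<Longrightarrow> wiener M B (g a) (\<lambda>\<omega>. blinfun_apply a (path_of Z \<omega>))"
    by metis
  show ?thesis
    unfolding gaussian_map_def
  proof (intro conjI ballI)
    show "path_of Z \<in> borel_measurable M"
    proof (rule borel_measurable_C01)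
      fix t
      show "(\<lambda>\<omega>. apply_bcontfun (path_of Z \<omega>) t) \<in> borel_measurable M"
        using We[of t] wiener_sq_int(2) sq_int_measurable by blast
    qed
    fix a assume a: "a \<in> eval_span"
    show "sq_int M (\<lambda>\<omega>. blinfun_apply a (path_of Z \<omega>))"
      by (rule wiener_sq_int(2)[OF g[OF a]])
    show "has_bochner_integral M (\<lambda>\<omega>. exp (blinfun_apply a (path_of Z \<omega>))) (exp (cov M (path_of Z) a a / 2))"
      using wiener_isometry[OF B g[OF a]] by (simp add: cov_def power2_eq_square)
  qed
qed

lemma cov_path_of:
  assumes cont: "\<And>\<omega>. \<omega> \<in> space M \<Longrightarrow> continuous_on {0..1} (\<lambda>t. Z t \<omega>)"
  shows "cov M (path_of Z) (evl s) (evl t) = (\<integral>\<omega>. Z (of_unit s) \<omega> * Z (of_unit t) \<omega> \<partial>M)"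
    and "cov M (path_of Z) (evl t - evl s) (evl t - evl s) = (\<integral>\<omega>. (Z (of_unit t) \<omega> - Z (of_unit s) \<omega>)\<^sup>2 \<partial>M)"
proof -
  have app: "apply_bcontfun (path_of Z \<omega>) t = Z (of_unit t) \<omega>" if "\<omega> \<in> space M" for \<omega> t
    by (rule path_of_apply[where X = Z and \<omega> = \<omega>, OF cont[OF that]])
  show "cov M (path_of Z) (evl s) (evl t) = (\<integral>\<omega>. Z (of_unit s) \<omega> * Z (of_unit t) \<omega> \<partial>M)"
    unfolding cov_def by (intro Bochner_Integration.integral_cong) (simp_all add: app)
  show "cov M (path_of Z) (evl t - evl s) (evl t - evl s) = (\<integral>\<omega>. (Z (of_unit t) \<omega> - Z (of_unit s) \<omega>)\<^sup>2 \<partial>M)"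
    unfolding cov_def by (intro Bochner_Integration.integral_cong) (simp_all add: app blinfun.diff_left power2_eq_square)
qed

text \<open>Bilinearity reduces the claim to pairs of evaluations. The induction runs once in each
  argument, one of them reached through the symmetry of \<open>cov\<close>.\<close>

lemma cov_tendsto_eval_span:
  assumes X: "\<forall>\<^sub>F e in F. gaussian_map M (X e)" and Y: "gaussian_map M Y"
    and lim: "\<And>s t. ((\<lambda>e. cov M (X e) (evl s) (evl t) / H e) \<longlongrightarrow> cov M Y (evl s) (evl t)) F"
    and ab: "a \<in> eval_span" "b \<in> eval_span"
  shows "((\<lambda>e. cov M (X e) a b / H e) \<longlongrightarrow> cov M Y a b) F"
proof -
  have step: "((\<lambda>e. cov M (X e) (x *\<^sub>R evl t + a) b / H e) \<longlongrightarrow> cov M Y (x *\<^sub>R evl t + a) b) F"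
    if a: "a \<in> eval_span" and b: "b \<in> eval_span"
      and t: "((\<lambda>e. cov M (X e) (evl t) b / H e) \<longlongrightarrow> cov M Y (evl t) b) F"
      and IH: "((\<lambda>e. cov M (X e) a b / H e) \<longlongrightarrow> cov M Y a b) F" for x t a b
  proof -
    have "((\<lambda>e. x * (cov M (X e) (evl t) b / H e) + cov M (X e) a b / H e) \<longlongrightarrow> x * cov M Y (evl t) b + cov M Y a b) F"
      by (intro tendsto_intros t IH)
    moreover have "x * cov M Y (evl t) b + cov M Y a b = cov M Y (x *\<^sub>R evl t + a) b"
      using a b by (simp add: cov_add_left[OF Y] cov_scale_left[OF Y])
    moreover have "\<forall>\<^sub>F e in F. x * (cov M (X e) (evl t) b / H e) + cov M (X e) a b / H e = cov M (X e) (x *\<^sub>R evl t + a) b / H e"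
      using X by eventually_elim (use a b in \<open>simp add: cov_add_left cov_scale_left add_divide_distrib\<close>)
    ultimately show ?thesis
      using Lim_transform_eventually by fastforce
  qed
  have zero: "((\<lambda>e. cov M (X e) 0 b / H e) \<longlongrightarrow> cov M Y 0 b) F" for b
    by (simp add: cov_def)
  have evl: "((\<lambda>e. cov M (X e) (evl s) b / H e) \<longlongrightarrow> cov M Y (evl s) b) F" if "b \<in> eval_span" for s b
    unfolding cov_commute[of M _ "evl s" b] using that
  proof (induction rule: eval_span_induct)
    case (add x t a)
    then show ?case
      using lim[of t s] by (intro step) auto
  qed (rule zero)
  show ?thesis
    using ab(1)
  proof (induction rule: eval_span_induct)
    case (add x t a)
    then show ?case
      using ab(2) evl by (intro step) auto
  qed (rule zero)
qed

section \<open>Change of variables to the rescaled kernels\<close>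

context regular_kernel
begin

text \<open>At \<open>w = s\<close> the left side would involve the arbitrary value
  \<open>h 0\<close>. For \<open>w \<ge> 0\<close> the cutoff at 1 in \<open>kern\<close> is
  automatic, as \<open>s \<le> 1\<close>.\<close>

lemma scaled_kernel_eq:
  assumes e: "0 < e" "0 < H e" and s: "s \<in> {0..1}" and w: "w \<noteq> s"
  shows "indicator {0..e * s} (e * w) * h (e * s - e * w) = sqrt (H e / e) * (indicator {0..} w * kern e (s - w))"
proof -
  have "sqrt (H e / e) * sqrt (e / H e) = 1"
    using e by (simp flip: real_sqrt_mult)
  then have "sqrt (H e / e) * (x * sqrt (e / H e)) = x" for x
    by (metis mult.left_commute mult.right_neutral)
  then show ?thesis
    using e s w by (auto simp: kern_def zero_le_mult_iff algebra_simps split: split_indicator)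
qed

lemma scaled_integral_eq:
  assumes e: "0 < e" "0 < H e" and st: "s \<in> {0..1}" "t \<in> {0..1}"
  shows "(\<integral>u. (indicator {0..e * s} u * h (e * s - u)) * (indicator {0..e * t} u * h (e * t - u)) \<partial>lborel)
      = H e * (\<integral>w. indicator {0..} w * (kern e (s - w) * kern e (t - w)) \<partial>lborel)" (is "?A = H e * ?B")
    and "(\<integral>u. (indicator {0..e * t} u * h (e * t - u) - indicator {0..e * s} u * h (e * s - u))\<^sup>2 \<partial>lborel)
      = H e * (\<integral>w. indicator {0..} w * (kern e (t - w) - kern e (s - w))\<^sup>2 \<partial>lborel)" (is "?C = H e * ?D")
proof -
  have sq: "(sqrt (H e / e))\<^sup>2 = H e / e"
    using e by simp
  note eq = scaled_kernel_eq[OF e st(1)] scaled_kernel_eq[OF e st(2)]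
  have ind: "(indicator {0..} w :: real) * indicator {0..} w = indicator {0..} w" for w :: real
    by (simp split: split_indicator)
  have "?A = e * (\<integral>w. (indicator {0..e * s} (e * w) * h (e * s - e * w)) * (indicator {0..e * t} (e * w) * h (e * t - e * w)) \<partial>lborel)"
    using e lborel_integral_real_affine[of e "\<lambda>u. (indicator {0..e * s} u * h (e * s - u)) * (indicator {0..e * t} u * h (e * t - u))" 0]
    by simp
  also have "(\<integral>w. (indicator {0..e * s} (e * w) * h (e * s - e * w)) * (indicator {0..e * t} (e * w) * h (e * t - e * w)) \<partial>lborel)
    = (\<integral>w. H e / e * (indicator {0..} w * (kern e (s - w) * kern e (t - w))) \<partial>lborel)"
  proof (rule integral_discrete_difference[of "{s, t}"])
    fix w assume "w \<notin> {s, t}"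
    then have ws: "w \<noteq> s" "w \<noteq> t"
      by auto
    have "sqrt (H e / e) * (i * x) * (sqrt (H e / e) * (i * y)) = (sqrt (H e / e))\<^sup>2 * (i * i * (x * y))" for i x y
      by (simp only: power2_eq_square ac_simps)
    then show "(indicator {0..e * s} (e * w) * h (e * s - e * w)) * (indicator {0..e * t} (e * w) * h (e * t - e * w))
      = H e / e * (indicator {0..} w * (kern e (s - w) * kern e (t - w)))"
      unfolding eq(1)[OF ws(1)] eq(2)[OF ws(2)] by (simp only: sq ind)
  qed auto
  finally show "?A = H e * ?B"
    using e by simp
  have "?C = e * (\<integral>w. (indicator {0..e * t} (e * w) * h (e * t - e * w) - indicator {0..e * s} (e * w) * h (e * s - e * w))\<^sup>2 \<partial>lborel)"
    using e lborel_integral_real_affine[of e "\<lambda>u. (indicator {0..e * t} u * h (e * t - u) - indicator {0..e * s} u * h (e * s - u))\<^sup>2" 0]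
    by simp
  also have "(\<integral>w. (indicator {0..e * t} (e * w) * h (e * t - e * w) - indicator {0..e * s} (e * w) * h (e * s - e * w))\<^sup>2 \<partial>lborel)
    = (\<integral>w. H e / e * (indicator {0..} w * (kern e (t - w) - kern e (s - w))\<^sup>2) \<partial>lborel)"
  proof (rule integral_discrete_difference[of "{s, t}"])
    fix w assume "w \<notin> {s, t}"
    then have ws: "w \<noteq> s" "w \<noteq> t"
      by auto
    have "(sqrt (H e / e) * (i * x) - sqrt (H e / e) * (i * y))\<^sup>2 = (sqrt (H e / e))\<^sup>2 * (i * i * (x - y)\<^sup>2)" for i x y
      unfolding right_diff_distrib[symmetric] by (simp only: power_mult_distrib power2_eq_square[of i])
    then show "(indicator {0..e * t} (e * w) * h (e * t - e * w) - indicator {0..e * s} (e * w) * h (e * s - e * w))\<^sup>2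
      = H e / e * (indicator {0..} w * (kern e (t - w) - kern e (s - w))\<^sup>2)"
      unfolding eq(1)[OF ws(1)] eq(2)[OF ws(2)] by (simp only: sq ind)
  qed auto
  finally show "?C = H e * ?D"
    using e by simp
qed

end

text \<open>Almost sure equality preserves the joint law of finitely many increments, and
  independence is a property of that law.\<close>

lemma brownian_motion_on_modification:
  assumes B: "brownian_motion_on {0..} M B"
    and meas: "\<And>t. t \<in> {0..1} \<Longrightarrow> Z t \<in> borel_measurable M"
    and ae: "\<And>t. t \<in> {0..1} \<Longrightarrow> AE \<omega> in M. Z t \<omega> = B t \<omega>"
    and cont: "\<And>\<omega>. \<omega> \<in> space M \<Longrightarrow> continuous_on {0..1} (\<lambda>t. Z t \<omega>)"
  shows "brownian_motion_on {0..1} M Z"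
proof -
  interpret prob_space M
    using B by (rule brownian_motion_prob_space)
  have Bm: "B t \<in> borel_measurable M" if "0 \<le> t" for t
    using B that by (auto simp: brownian_motion_on_def)
  show ?thesis
    unfolding brownian_motion_on_def
  proof (intro conjI ballI allI impI)
    show "prob_space M"
      by (rule prob_space_axioms)
    show "Z t \<in> borel_measurable M" if "t \<in> {0..1}" for t
      by (rule meas[OF that])
    have "AE \<omega> in M. B 0 \<omega> = 0"
      using B by (simp add: brownian_motion_on_def)
    moreover have "AE \<omega> in M. Z 0 \<omega> = B 0 \<omega>"
      by (rule ae) simp
    ultimately show "AE \<omega> in M. Z 0 \<omega> = 0"
      by eventually_elim simp
    show "AE \<omega> in M. continuous_on {0..1} (\<lambda>t. Z t \<omega>)"
      using cont by (intro AE_I2)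
  next
    fix s t :: real assume st: "s \<in> {0..1}" "t \<in> {0..1}" "s < t"
    have D: "distributed M lborel (\<lambda>\<omega>. B t \<omega> - B s \<omega>) (normal_density 0 (sqrt (t - s)))"
      using B st unfolding brownian_motion_on_def by auto
    have "distr M lborel (\<lambda>\<omega>. Z t \<omega> - Z s \<omega>) = distr M lborel (\<lambda>\<omega>. B t \<omega> - B s \<omega>)"
    proof (rule distr_cong_AE)
      show "AE \<omega> in M. Z t \<omega> - Z s \<omega> = B t \<omega> - B s \<omega>"
        using ae[OF st(1)] ae[OF st(2)] by eventually_elim simp
    qed (use meas st Bm in auto)
    with D show "distributed M lborel (\<lambda>\<omega>. Z t \<omega> - Z s \<omega>) (normal_density 0 (sqrt (t - s)))"
      using meas st unfolding distributed_def by auto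
  next
    fix n and \<tau> :: "nat \<Rightarrow> real"
    assume \<tau>: "(\<forall>i\<le>n. \<tau> i \<in> {0..1}) \<and> (\<forall>i<n. \<tau> i < \<tau> (Suc i))"
    define b where "b i \<omega> = B (\<tau> (Suc i)) \<omega> - B (\<tau> i) \<omega>" for i \<omega>
    define z where "z i \<omega> = Z (\<tau> (Suc i)) \<omega> - Z (\<tau> i) \<omega>" for i \<omega>
    have ind: "indep_vars (\<lambda>_. borel) b {..<n}"
      using B \<tau> unfolding brownian_motion_on_def b_def[abs_def] by auto
    have bm: "b i \<in> borel_measurable M" and zm: "z i \<in> borel_measurable M" if "i < n" for i
      using that \<tau> Bm meas unfolding b_def z_def by (auto intro!: borel_measurable_diff)
    have eq: "AE \<omega> in M. z i \<omega> = b i \<omega>" if "i < n" for i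
    proof -
      have "\<tau> (Suc i) \<in> {0..1}" "\<tau> i \<in> {0..1}"
        using \<tau> that by auto
      from ae[OF this(1)] ae[OF this(2)] show ?thesis
        by eventually_elim (simp add: b_def z_def)
    qed
    have "indep_vars (\<lambda>_. borel) z {..<n}"
    \<comment> \<open>The characterization of independence by product measures is applied to a
      nonempty index set.\<close>
    proof (cases "n = 0")
      case True
      then show ?thesis
        using indep_vars_cong[of "{..<n}" "{..<n}" z b] ind by auto
    next
      case False
      then have ne: "{..<n} \<noteq> {}"
        by auto
      have "AE \<omega> in M. \<forall>i\<in>{..<n}. z i \<omega> = b i \<omega>"
        using eq by (intro AE_finite_allI) auto
      then have "AE \<omega> in M. (\<lambda>i\<in>{..<n}. z i \<omega>) = (\<lambda>i\<in>{..<n}. b i \<omega>)"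
        by eventually_elim (auto simp: restrict_def fun_eq_iff)
      then have "distr M (\<Pi>\<^sub>M i\<in>{..<n}. borel) (\<lambda>\<omega>. \<lambda>i\<in>{..<n}. z i \<omega>) = distr M (\<Pi>\<^sub>M i\<in>{..<n}. borel) (\<lambda>\<omega>. \<lambda>i\<in>{..<n}. b i \<omega>)"
        using bm zm by (intro distr_cong_AE measurable_restrict) auto
      also have "\<dots> = (\<Pi>\<^sub>M i\<in>{..<n}. distr M borel (b i))"
        using ind bm by (subst (asm) indep_vars_iff_distr_eq_PiM'[OF ne]) auto
      also have "\<dots> = (\<Pi>\<^sub>M i\<in>{..<n}. distr M borel (z i))"
      proof (intro PiM_cong refl distr_cong_AE)
        fix i assume "i \<in> {..<n}"
        then have i: "i < n"
          by simp
        show "AE \<omega> in M. b i \<omega> = z i \<omega>"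
          using eq[OF i] by eventually_elim simp
        show "b i \<in> borel_measurable M" "z i \<in> borel_measurable M"
          by (rule bm[OF i], rule zm[OF i])
      qed
      finally show ?thesis
        using zm by (subst indep_vars_iff_distr_eq_PiM'[OF ne]) auto
    qed
    then show "indep_vars (\<lambda>_. borel) (\<lambda>i \<omega>. Z (\<tau> (Suc i)) \<omega> - Z (\<tau> i) \<omega>) {..<n}"
      by (simp add: z_def[abs_def])
  qed
qed

theorem corollary5p10:
  fixes M :: "'a measure" and B X V Y :: "real \<Rightarrow> 'a \<Rightarrow> real"
    and h c c' \<rho> :: "real \<Rightarrow> real" and \<alpha> c0 t0 :: real
  assumes B: "brownian_motion_on {0..} M B"
    and \<alpha>: "\<alpha> > -1/2"
    and h_nonneg: "\<forall>t\<in>{0<..1}. 0 \<le> h t"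
    and h_sq: "set_integrable lborel {0<..1} (\<lambda>t. (h t)\<^sup>2)"
    and h_RV: "h \<in> RV \<alpha>"
    and X: "volterra_process M B h X"
    and t0: "t0 \<in> {0<..1}"
    and repr: "\<forall>t\<in>{0<..1}. (h t)\<^sup>2 =
                 c t * t powr (2 * \<alpha>) * exp (LBINT u=ereal t..ereal t0. \<rho> u / u)"
    and c_lim: "(c \<longlongrightarrow> c0) (at_right 0)" "c0 > 0"
    and \<rho>_lim: "(\<rho> \<longlongrightarrow> 0) (at_right 0)"
    and c_deriv: "\<forall>t\<in>{0<..1}. (c has_real_derivative c' t) (at t within {0<..1})"
    and c'_bdd: "bounded (c' ` {0<..1})"
    and \<rho>_cont: "continuous_on {0<..1} \<rho>"
    and \<alpha>0: "\<alpha> = 0 \<Longrightarrow>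
               (\<forall>\<^sub>F t in at_right 0. \<rho> t > 0)
             \<or> (\<forall>\<^sub>F t in at_right 0. \<rho> t < 0)
             \<or> (\<forall>\<^sub>F t in at_right 0. \<rho> t = 0 \<and> c' t \<le> 0)
             \<or> (\<forall>\<^sub>F t in at_right 0. \<rho> t = 0 \<and> c' t \<ge> 0)"
    and V: "volterra_process M B (\<lambda>u. u powr \<alpha>) V"
    and Y: "Y = (\<lambda>t \<omega>. sqrt (2 * \<alpha> + 1) * V t \<omega>)"
  shows "large_deviations
           (\<lambda>\<epsilon>. distr M borel (path_of (\<lambda>t. X (\<epsilon> * t))))
           (\<lambda>\<epsilon>. 1 / (LBINT s:{0<..\<epsilon>}. (h s)\<^sup>2))
           (\<lambda>f. if f \<in> rkhs M (path_of Y)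
                then ereal (1 / 2 * (rkhs_norm M (path_of Y) f)\<^sup>2) else \<infinity>)
       \<and> (\<alpha> = 0 \<longrightarrow> brownian_motion_on {0..1} M Y)"
proof (intro conjI impI)
  interpret K: regular_kernel h c c' \<rho> \<alpha> c0 t0
    by (rule regular_kernel.intro; fact)
  interpret prob_space M
    using B by (rule brownian_motion_prob_space)
  have X_cont: "continuous_on {0..1} (\<lambda>t. X t \<omega>)" and V_cont: "continuous_on {0..1} (\<lambda>t. V t \<omega>)"
    if "\<omega> \<in> space M" for \<omega>
    using X V that by (auto simp: volterra_process_def)
  have Y_cont: "continuous_on {0..1} (\<lambda>t. Y t \<omega>)" if "\<omega> \<in> space M" for \<omega>
    unfolding Y by (intro continuous_intros V_cont that)
  have W_Y: "wiener M B (\<lambda>u. sqrt (2 * \<alpha> + 1) * (indicator {0..t} u * (t - u) powr \<alpha>)) (Y t)" if "t \<in> {0..1}" for t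
    unfolding Y by (intro wiener_scale volterra_wiener[OF B V that])
  {
    obtain e0 C \<gamma> where e0: "0 < e0" "e0 \<le> 1" and C: "0 < C" and \<gamma>: "0 < \<gamma>"
      and H_pos: "\<And>e. 0 < e \<Longrightarrow> e \<le> e0 \<Longrightarrow> 0 < K.H e"
      and inc: "\<And>e s t. 0 < e \<Longrightarrow> e \<le> e0 \<Longrightarrow> 0 \<le> s \<Longrightarrow> s \<le> t \<Longrightarrow> t \<le> 1 \<Longrightarrow>
        (\<integral>w. indicator {0..} w * (K.kern e (t - w) - K.kern e (s - w))\<^sup>2 \<partial>lborel) \<le> C * (t - s) powr \<gamma>"
      using K.kern_increments by blast
    \<comment> \<open>Chosen so that the variance rate \<open>(1 / 2 ^ n) powr \<gamma>\<close> of a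
      dyadic increment becomes \<open>r ^ (4 * n)\<close>.\<close>
    define r where "r = 2 powr (- \<gamma> / 4)"
    have r: "0 < r" "r < 1"
      using \<gamma> powr_less_mono[of "- \<gamma> / 4" 0 2] by (auto simp: r_def)
    have r_pow: "(1 / 2 ^ n) powr \<gamma> = r ^ (4 * n)" for n
    proof -
      have "(1 / 2 ^ n) powr \<gamma> = (2 powr (- real n)) powr \<gamma>"
        by (simp add: powr_minus powr_realpow divide_inverse)
      also have "\<dots> = 2 powr (- \<gamma> / 4 * real (4 * n))"
        by (simp add: powr_powr mult.commute)
      also have "\<dots> = r ^ (4 * n)"
        unfolding r_def by (subst powr_power) (auto simp: mult.commute)
      finally show ?thesis .
    qed
    define XX where "XX e = path_of (\<lambda>t. X (e * t))" for e
    have XX_cont: "continuous_on {0..1} (\<lambda>t. X (e * t) \<omega>)" if "0 < e" "e \<le> e0" "\<omega> \<in> space M" for e \<omega>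
      using that e0 by (intro continuous_on_compose2[OF X_cont[OF that(3)]] continuous_intros) (auto simp: mult_le_one)
    have W_X: "wiener M B (\<lambda>u. indicator {0..e * t} u * h (e * t - u)) (X (e * t))"
      if "0 < e" "e \<le> e0" "t \<in> {0..1}" for e t
      using that e0 by (intro volterra_wiener[OF B X]) (auto simp: mult_le_one)
    have gX: "gaussian_map M (XX e)" if e: "0 < e" "e \<le> e0" for e
      unfolding XX_def
    proof (rule gaussian_map_path_of[OF B])
      show "continuous_on {0..1} (\<lambda>t. X (e * t) \<omega>)" if "\<omega> \<in> space M" for \<omega>
        by (rule XX_cont[OF e that])
      show "\<exists>g. wiener M B g (X (e * t))" if "t \<in> {0..1}" for t
        by (rule exI, rule W_X[OF e that])
    qed
    have gY: "gaussian_map M (path_of Y)"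
    proof (rule gaussian_map_path_of[OF B Y_cont])
      show "\<exists>g. wiener M B g (Y t)" if "t \<in> {0..1}" for t
        by (rule exI, rule W_Y[OF that])
    qed
    have cov_X: "cov M (XX e) (evl s) (evl t) = K.H e *
        (\<integral>w. indicator {0..} w * (K.kern e (of_unit s - w) * K.kern e (of_unit t - w)) \<partial>lborel)"
      if e: "0 < e" "e \<le> e0" for e s t
    proof -
      have "cov M (XX e) (evl s) (evl t) = (\<integral>\<omega>. X (e * of_unit s) \<omega> * X (e * of_unit t) \<omega> \<partial>M)"
        unfolding XX_def by (rule cov_path_of(1)[OF XX_cont[OF e]])
      also have "\<dots> = (\<integral>u. (indicator {0..e * of_unit s} u * h (e * of_unit s - u)) * (indicator {0..e * of_unit t} u * h (e * of_unit t - u)) \<partial>lborel)"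
        by (rule wiener_covariance[OF B W_X[OF e] W_X[OF e]]) simp_all
      also have "\<dots> = K.H e * (\<integral>w. indicator {0..} w * (K.kern e (of_unit s - w) * K.kern e (of_unit t - w)) \<partial>lborel)"
        using e H_pos[OF e] by (intro K.scaled_integral_eq) auto
      finally show ?thesis .
    qed
    have cov_Y: "cov M (path_of Y) (evl s) (evl t) =
        (\<integral>w. indicator {0..} w * (K.kern_lim (of_unit s - w) * K.kern_lim (of_unit t - w)) \<partial>lborel)" for s t
    proof -
      have "cov M (path_of Y) (evl s) (evl t) = (\<integral>\<omega>. Y (of_unit s) \<omega> * Y (of_unit t) \<omega> \<partial>M)"
        by (rule cov_path_of(1)[OF Y_cont])
      also have "\<dots> = (\<integral>u. sqrt (2 * \<alpha> + 1) * (indicator {0..of_unit s} u * (of_unit s - u) powr \<alpha>) *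
          (sqrt (2 * \<alpha> + 1) * (indicator {0..of_unit t} u * (of_unit t - u) powr \<alpha>)) \<partial>lborel)"
        by (rule wiener_covariance[OF B W_Y W_Y]) simp_all
      also have "\<dots> = (\<integral>w. indicator {0..} w * (K.kern_lim (of_unit s - w) * K.kern_lim (of_unit t - w)) \<partial>lborel)"
      proof (rule integral_discrete_difference[of "{of_unit s, of_unit t}"])
        fix u assume u: "u \<notin> {of_unit s, of_unit t}"
        have eq: "sqrt (2 * \<alpha> + 1) * (indicator {0..of_unit x} u * (of_unit x - u) powr \<alpha>) = indicator {0..} u * K.kern_lim (of_unit x - u)"
          if "x = s \<or> x = t" for x
        proof -
          have "0 \<le> u \<Longrightarrow> of_unit x - u \<le> 1"
            using of_unit_bounds(2)[of x] by linarith
          then show ?thesis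
            using u that by (auto simp: K.kern_lim_def split: split_indicator)
        qed
        show "sqrt (2 * \<alpha> + 1) * (indicator {0..of_unit s} u * (of_unit s - u) powr \<alpha>) *
          (sqrt (2 * \<alpha> + 1) * (indicator {0..of_unit t} u * (of_unit t - u) powr \<alpha>)) =
          indicator {0..} u * (K.kern_lim (of_unit s - u) * K.kern_lim (of_unit t - u))"
          unfolding eq[of s, simplified] eq[of t, simplified] by (simp split: split_indicator)
      qed auto
      finally show ?thesis .
    qed
    have ev: "\<forall>\<^sub>F e in at_right 0. 0 < e \<and> e \<le> e0"
      using e0 by (auto simp: eventually_at_right_field intro!: exI[of _ e0])
    interpret G: gaussian_family M XX "path_of Y" K.H r C
    proof
      show "\<forall>\<^sub>F e in at_right 0. 0 < K.H e"
        using ev by eventually_elim (simp add: H_pos)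
      show ev_gX: "\<forall>\<^sub>F e in at_right 0. gaussian_map M (XX e)"
        using ev by eventually_elim (simp add: gX)
      show "\<forall>\<^sub>F e in at_right 0. cov M (XX e) (evl (to_unit 0)) (evl (to_unit 0)) = 0"
        using ev
      proof eventually_elim
        case (elim e)
        \<comment> \<open>For \<open>w \<ge> 0\<close> the argument \<open>0 - w\<close> is not
          positive, and \<open>kern\<close> vanishes there.\<close>
        have "(\<integral>w. indicator {0..} w * (K.kern e (0 - w) * K.kern e (0 - w)) \<partial>lborel) = (\<integral>w. 0 \<partial>(lborel :: real measure))"
          by (intro Bochner_Integration.integral_cong refl) (auto simp: K.kern_def split: split_indicator)
        then show ?case
          using elim by (simp add: cov_X to_unit_inverse)
      qed
      show "\<forall>\<^sub>F e in at_right 0. \<forall>n. \<forall>k<2 ^ n. cov M (XX e) (dyadic_inc n k) (dyadic_inc n k) \<le> K.H e * C * r ^ (4 * n)"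
        using ev
      proof eventually_elim
        case (elim e)
        then have e: "0 < e" "e \<le> e0"
          by auto
        show ?case
        proof (intro allI impI)
          fix n k :: nat assume k: "k < 2 ^ n"
          define s t where "s = of_unit (dyadic n k)" and "t = of_unit (dyadic n (Suc k))"
          have ts: "t - s = 1 / 2 ^ n"
            using k by (simp add: s_def t_def of_unit_dyadic flip: diff_divide_distrib)
          moreover have "0 < 1 / (2 :: real) ^ n"
            by simp
          ultimately have st: "0 \<le> s" "s \<le> t" "t \<le> 1"
            by (simp add: s_def, linarith, simp add: t_def)
          have "cov M (XX e) (dyadic_inc n k) (dyadic_inc n k) = (\<integral>\<omega>. (X (e * t) \<omega> - X (e * s) \<omega>)\<^sup>2 \<partial>M)"
            unfolding XX_def dyadic_inc_def s_def t_def by (rule cov_path_of(2)[OF XX_cont[OF e]])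
          also have "\<dots> = (\<integral>u. (indicator {0..e * t} u * h (e * t - u) - indicator {0..e * s} u * h (e * s - u))\<^sup>2 \<partial>lborel)"
            using wiener_isometry(1)[OF B wiener_add[OF W_X[OF e, of t] wiener_scale[OF W_X[OF e, of s], of "- 1"]]] st
            by simp
          also have "\<dots> = K.H e * (\<integral>w. indicator {0..} w * (K.kern e (t - w) - K.kern e (s - w))\<^sup>2 \<partial>lborel)"
            using e H_pos[OF e] st by (intro K.scaled_integral_eq) auto
          also have "\<dots> \<le> K.H e * (C * (t - s) powr \<gamma>)"
            using H_pos[OF e] st by (intro mult_left_mono inc e) auto
          also have "\<dots> = K.H e * C * r ^ (4 * n)"
            by (simp only: ts r_pow mult.assoc)
          finally show "cov M (XX e) (dyadic_inc n k) (dyadic_inc n k) \<le> K.H e * C * r ^ (4 * n)" .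
        qed
      qed
      show "((\<lambda>e. cov M (XX e) a b / K.H e) \<longlongrightarrow> cov M (path_of Y) a b) (at_right 0)"
        if "a \<in> eval_span" "b \<in> eval_span" for a b
      proof (rule cov_tendsto_eval_span[OF ev_gX gY _ that])
        fix s t
        show "((\<lambda>e. cov M (XX e) (evl s) (evl t) / K.H e) \<longlongrightarrow> cov M (path_of Y) (evl s) (evl t)) (at_right 0)"
          unfolding cov_Y
        proof (rule Lim_transform_eventually[OF K.kern_product_tendsto])
          show "\<forall>\<^sub>F e in at_right 0. (\<integral>w. indicator {0..} w * (K.kern e (of_unit s - w) * K.kern e (of_unit t - w)) \<partial>lborel)
              = cov M (XX e) (evl s) (evl t) / K.H e"
            using ev
          proof eventually_elim
            case (elim e)
            then show ?case
              using H_pos[of e] by (simp add: cov_X)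
          qed
        qed
      qed
    qed (use r C gY K.H_tendsto in auto)
    show "large_deviations
           (\<lambda>\<epsilon>. distr M borel (path_of (\<lambda>t. X (\<epsilon> * t))))
           (\<lambda>\<epsilon>. 1 / (LBINT s:{0<..\<epsilon>}. (h s)\<^sup>2))
           (\<lambda>f. if f \<in> rkhs M (path_of Y)
                then ereal (1 / 2 * (rkhs_norm M (path_of Y) f)\<^sup>2) else \<infinity>)"
      using G.large_deviations_rkhs unfolding XX_def K.H_def .
  }
  assume \<alpha>: "\<alpha> = 0"
  show "brownian_motion_on {0..1} M Y"
  proof (rule brownian_motion_on_modification[OF B _ _ Y_cont])
    fix t :: real assume t: "t \<in> {0..1}"
    note WY = W_Y[OF t]
    show "Y t \<in> borel_measurable M"
      by (rule sq_int_measurable[OF wiener_sq_int(2)[OF WY]])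
    have "wiener M B (step_fun [(1, 0, t)]) (step_integral B [(1, 0, t)])"
    proof -
      have ps: "\<forall>(x, l, r)\<in>set [(1, 0, t)]. 0 \<le> l \<and> l \<le> r"
        using t by simp
      show ?thesis
        unfolding wiener_def
        using ps L2_lim_const[OF step_integral_isometry(1)[OF B ps]] L2_lim_const[OF step_integral_isometry(2)[OF B ps]]
        by (intro exI[of _ "\<lambda>_. [(1, 0, t)]"]) auto
    qed
    \<comment> \<open>For \<alpha> = 0 the integrands differ at most at 0, where the step interval
      is open, and at \<open>t\<close>, where \<open>0 powr 0\<close> is 0.\<close>
    from wiener_AE_unique[OF B WY this, of "{0, t}"]
    have "AE \<omega> in M. Y t \<omega> = step_integral B [(1, 0, t)] \<omega>"
      using t by (auto simp: \<alpha> step_fun_def split: split_indicator)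
    moreover have "AE \<omega> in M. B 0 \<omega> = 0"
      using B by (simp add: brownian_motion_on_def)
    ultimately show "AE \<omega> in M. Y t \<omega> = B t \<omega>"
      by eventually_elim (simp add: step_integral_def)
  qed
qed

end
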